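(* Let $X$ be a Polish space, $\mathcal M(X)$ the space of non-negative finite Borel measures on $X$ with the weak topology, and $\mathcal B_r=\{\mu\in\mathcal M(X):\mu(X)\le r\}$ for $r\ge0$. The following are equivalent: (i) $\mathcal Q$ is a non-negative Borel measure on $\mathcal M(X)$ satisfying: - non-triviality: $\mathcal Q(\mathcal B_0)=0$; - normalization: $\mathcal Q(\mathcal B_1)=1$; - invariance: $\mathcal Q$ is projectively invariant for the action of the group of multipliers $\mathfrak M(X)$ on $\mathcal M(X)$; (ii) $\mathcal Q=\dfrac{1}{\Gamma(\theta+1)}\,\mathcal L_{\theta,\nu}$ with $$\theta:=\int\mu(X)\,e^{-\mu(X)}\,d\mathcal Q(\mu)\qquad\text{and}\qquad \nu:=\theta^{-1}\int\mu(\cdot)\,e^{-\mu(X)}\,d\mathcal Q(\mu).$$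
   Context: **Multipliers.** $\mathfrak M(X)=\{e^a: a:X\to\mathbb R\text{ bounded Borel}\}$, a group under pointwise product, acts on $\mathcal M(X)$ by $\mu\mapsto e^a\cdot\mu$ (the measure with density $e^a$ w.r.t. $\mu$). A measure $\mathcal Q$ on $\mathcal M(X)$ is projectively invariant for this action if for every $k\in\mathfrak M(X)$ one has $(k\,\cdot)_\sharp\mathcal Q=R_k\,\mathcal Q$ for a constant $R_k$ (depending only on $k$). **Dirichlet–Ferguson measure.** For a Borel probability $\nu$ on $X$, $\mathcal D_\nu$ denotes the Dirichlet–Ferguson measure with intensity $\nu$: the Borel probability measure on $\mathcal P(X)$ (Borel probability measures on $X$) under which, for every finite Borel partition $(A_1,\dots,A_k)$ of $X$, the vector $(\eta(A_1),\dots,\eta(A_k))$ is Dirichlet distributed with parameters $(\nu(A_1),\dots,\nu(A_k))$ (coordinates with zero parameter being a.s. $0$). When $\nu$ is diffuse, it is the unique Borel probability measure on $\mathcal P(X)$ such that, for every bounded Borel $F:\mathcal P(X)\times X\times[0,1]\to\mathbb R$, $$\int\int_X F(\eta,x,\eta\{x\})\,d\eta(x)\,d\mathcal D_\nu(\eta)=\int\int_0^1\int_X F((1-t)\eta+t\delta_x,x,t)\,d\nu(x)\,dt\,d\mathcal D_\nu(\eta).$$ **Multiplicative infinite-dimensional Lebesgue measure.** For $\theta>0$ let $d\lambda_\theta(t)=t^{\theta-1}dt/\Gamma(\theta)$ on $(0,\infty)$. For $\theta>0$ and $\nu\in\mathcal P(X)$, $\mathcal L_{\theta,\nu}$ is the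 push-forward of $\mathcal D_\nu\otimes\lambda_\theta$ under $(\eta,t)\mapsto t\eta$, a measure on $\mathcal M(X)$.
   Formalization: The constants as printed are inconsistent; proved instead: Q = Γ(θ+1)·L_{θ,ν} (not 1/Γ(θ+1)), with θ and ν computed from Q/∫e^{-μ(X)}dQ in place of Q, and L_{θ,ν} built from the Dirichlet–Ferguson measure of intensity θν rather than ν. *)

theory Defs
  imports "HOL-Probability.Probability"
begin

definition borel_of :: "'b topology \<Rightarrow> 'b measure" where
  "borel_of T = sigma (topspace T) {U. openin T U}"

definition finite_borel_measures :: "'a::topological_space measure set" where
  "finite_borel_measures = {\<mu>. sets \<mu> = sets borel \<and> finite_measure \<mu>}"

text \<open>The coarsest topology on the finite Borel measures for which integration of every
  bounded continuous function is continuous.\<close>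

definition weak_topology :: "'a::topological_space measure topology" where
  "weak_topology = topology_generated_by
     {{\<mu> \<in> finite_borel_measures. (LINT x|\<mu>. f x) \<in> U} | (f :: 'a \<Rightarrow> real) U.
        continuous_on UNIV f \<and> bounded (range f) \<and> open U}"

abbreviation finite_measures_algebra :: "'a::topological_space measure measure" where
  "finite_measures_algebra \<equiv> borel_of weak_topology"

definition prob_measures_algebra :: "'a::topological_space measure measure" where
  "prob_measures_algebra = borel_of (subtopology weak_topology {\<eta>. prob_space \<eta>})"

definition mass_ball :: "real \<Rightarrow> 'a::topological_space measure set" where
  "mass_ball r = {\<mu> \<in> finite_borel_measures. measure \<mu> UNIV \<le> r}"

definition multipliers :: "('a::topological_space \<Rightarrow> real) set" where
  "multipliers = {(\<lambda>x. exp (a x)) | a. a \<in> borel_measurable borel \<and> bounded (range a)}"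

definition mult_action :: "('a \<Rightarrow> real) \<Rightarrow> 'a measure \<Rightarrow> 'a measure" where
  "mult_action k \<mu> = density \<mu> (\<lambda>x. ennreal (k x))"

definition projectively_invariant :: "'a::topological_space measure measure \<Rightarrow> bool" where
  "projectively_invariant Q \<longleftrightarrow>
     (\<forall>k\<in>multipliers. \<exists>R::real. 0 \<le> R \<and>
        distr Q finite_measures_algebra (mult_action k) = scale_measure (ennreal R) Q)"

definition gamma_law :: "real \<Rightarrow> real measure" where
  "gamma_law a = (if a = 0 then return borel 0
     else density lborel (\<lambda>t. ennreal (t powr (a - 1) * exp (- t) / Gamma a) * indicator {0<..} t))"

text \<open>Ferguson's definition of the Dirichlet distribution, which allows some (not all) of the
  parameters to vanish: the law of a vector of independent Gamma variables divided by its sum.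
  The parameters are \<open>a 0, \<dots>, a (n - 1)\<close>.\<close>

definition dirichlet :: "nat \<Rightarrow> (nat \<Rightarrow> real) \<Rightarrow> (nat \<Rightarrow> real) measure" where
  "dirichlet n a = distr (Pi\<^sub>M {..<n} (\<lambda>i. gamma_law (a i))) (Pi\<^sub>M {..<n} (\<lambda>_. borel))
     (\<lambda>x. \<lambda>i\<in>{..<n}. x i / (\<Sum>j<n. x j))"

definition borel_partition :: "nat \<Rightarrow> (nat \<Rightarrow> 'a::topological_space set) \<Rightarrow> bool" where
  "borel_partition n A \<longleftrightarrow> (\<forall>i<n. A i \<in> sets borel) \<and> disjoint_family_on A {..<n} \<and>
     (\<Union>i<n. A i) = UNIV"

text \<open>\<open>dirichlet_ferguson \<alpha> D\<close>: \<open>D\<close> is the Dirichlet--Ferguson measure whose intensity is the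
  finite non-zero Borel measure \<open>\<alpha>\<close>.\<close>

definition dirichlet_ferguson ::
    "'a::topological_space measure \<Rightarrow> 'a measure measure \<Rightarrow> bool" where
  "dirichlet_ferguson \<alpha> D \<longleftrightarrow> sets D = sets prob_measures_algebra \<and> prob_space D \<and>
     (\<forall>n A. borel_partition n A \<longrightarrow>
        distr D (Pi\<^sub>M {..<n} (\<lambda>_. borel)) (\<lambda>\<eta>. \<lambda>i\<in>{..<n}. measure \<eta> (A i)) =
        dirichlet n (\<lambda>i. measure \<alpha> (A i)))"

definition lambda_measure :: "real \<Rightarrow> real measure" where
  "lambda_measure \<theta> =
     density lborel (\<lambda>t. ennreal (t powr (\<theta> - 1) / Gamma \<theta>) * indicator {0<..} t)"

text \<open>\<open>multiplicative_lebesgue \<theta> \<nu> L\<close>: \<open>L\<close> is the multiplicative infinite-dimensional Lebesgue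
  measure with parameters \<open>\<theta>\<close> and \<open>\<nu>\<close>. The Dirichlet--Ferguson factor has intensity \<open>\<theta>\<nu>\<close>, of
  total mass \<open>\<theta>\<close>: with intensity \<open>\<nu>\<close> the measure is projectively invariant under multipliers
  only if \<open>\<theta> = 1\<close> or \<open>\<nu>\<close> is a Dirac measure.\<close>

definition multiplicative_lebesgue ::
    "real \<Rightarrow> 'a::topological_space measure \<Rightarrow> 'a measure measure \<Rightarrow> bool" where
  "multiplicative_lebesgue \<theta> \<nu> L \<longleftrightarrow>
     0 < \<theta> \<and> sets \<nu> = sets borel \<and> prob_space \<nu> \<and>
     (\<exists>D. dirichlet_ferguson (scale_measure (ennreal \<theta>) \<nu>) D \<and>
          L = distr (D \<Otimes>\<^sub>M lambda_measure \<theta>) finite_measures_algebra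
                (\<lambda>(\<eta>, t). scale_measure (ennreal t) \<eta>))"

definition laplace_mass :: "'a::topological_space measure measure \<Rightarrow> ennreal" where
  "laplace_mass Q = (\<integral>\<^sup>+\<mu>. ennreal (exp (- measure \<mu> UNIV)) \<partial>Q)"

definition tilted_intensity :: "'a::topological_space measure measure \<Rightarrow> 'a measure" where
  "tilted_intensity Q = measure_of UNIV (sets borel)
     (\<lambda>A. \<integral>\<^sup>+\<mu>. emeasure \<mu> A * ennreal (exp (- measure \<mu> UNIV)) \<partial>Q)"

end

theory Submission
  imports Defs
begin

text \<open>Under a multiplier-invariant measure the values \<open>\<mu> (A i)\<close> on a Borel partition have a law on the
  orthant that is projectively invariant under coordinatewise scaling. Its box function is then
  multiplicative and monotone, so the law is a product of power laws \<open>lambda_measure (a i)\<close> (the Dirac mass at 0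
  if \<open>a i = 0\<close>), with \<open>a i\<close> read off from the tilted intensity. Weighting by \<open>exp (- mass)\<close> turns the power laws into
  Gamma laws, so the normalised measure is Dirichlet--Ferguson; homogeneity in the total mass makes
  it independent of the mass, which gives the product structure of the multiplicative
  Lebesgue measure \<open>L\<close>. Conversely the partition marginals of \<open>L\<close> are such products, so step multipliers \<open>exp b\<close>
  rescale \<open>L\<close> by \<open>exp (- \<theta> \<integral> b d\<nu>)\<close>, and a general multiplier is squeezed
  between step multipliers.\<close>

section \<open>Measurability on the space of finite measures\<close>

text \<open>The laws that occur are infinite measures, so each identification goes through an
  intersection-stable family of sets of finite measure: rays \<open>{..<r}\<close>,
  \<open>lower_box\<close>, \<open>evaluation_box\<close>. Finiteness is won in two stages. The
  hypotheses on Q speak only of mass balls, so constant multipliers come first and force the law of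
  the total mass to be \<open>Gamma (\<theta> + 1)\<close> times a power law with \<theta> > 0. Only
  then is \<open>exp (- mass)\<close> known to be integrable, which the argument on partitions
  needs. The factor \<open>Gamma (\<theta> + 1)\<close> is the reciprocal of the mass of (0,1] under
  \<open>lambda_measure \<theta>\<close>; it is also the Laplace mass of Q, and after division by it
  the integral of mass times \<open>exp (- mass)\<close> is \<theta> itself and not \<theta> times
  that factor. A second obstacle is measurability: the Borel sets come from a topology generated by
  uncountably many integrals, whereas constructed maps are only seen through their values on Borel
  sets. A countable network of evaluation-measurable sets bridges the two.\<close>

lemma topspace_weak_topology:
  "topspace (weak_topology :: 'a::topological_space measure topology) = finite_borel_measures"
proof -
  let ?S = "{{\<mu> \<in> finite_borel_measures. (LINT x|\<mu>. f x) \<in> U} | (f :: 'a \<Rightarrow> real) U.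
        continuous_on UNIV f \<and> bounded (range f) \<and> open U}"
  have "finite_borel_measures \<in> ?S"
    by (rule CollectI, rule exI[of _ "\<lambda>_. 0"], rule exI[of _ UNIV]) auto
  hence "\<Union>?S = finite_borel_measures" by blast
  thus ?thesis unfolding weak_topology_def topology_generated_by_topspace .
qed

lemma space_borel_of: "space (borel_of T) = topspace T"
  unfolding borel_of_def by (rule space_measure_of) (auto dest: openin_subset)

lemma sets_borel_of: "sets (borel_of T) = sigma_sets (topspace T) {U. openin T U}"
  unfolding borel_of_def by (rule sets_measure_of) (auto dest: openin_subset)

lemma space_finite_measures_algebra:
  "space (finite_measures_algebra :: 'a::topological_space measure measure) = finite_borel_measures"
  by (simp add: space_borel_of topspace_weak_topology)

lemma finite_borel_measuresD:
  assumes "\<mu> \<in> finite_borel_measures"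
  shows "sets \<mu> = sets borel" "finite_measure \<mu>" "space \<mu> = UNIV"
  using assms sets_eq_imp_space_eq[of \<mu> borel] by (auto simp: finite_borel_measures_def)

lemma integral_measurable_finite_measures_algebra:
  fixes f :: "'a::topological_space \<Rightarrow> real"
  assumes "continuous_on UNIV f" "bounded (range f)"
  shows "(\<lambda>\<mu>. LINT x|\<mu>. f x) \<in> borel_measurable finite_measures_algebra"
proof (rule borel_measurableI)
  fix U :: "real set" assume "open U"
  hence "openin weak_topology {\<mu> \<in> finite_borel_measures. (LINT x|\<mu>. f x) \<in> U}"
    unfolding weak_topology_def using assms by (intro topology_generated_by_Basis) blast
  moreover have "(\<lambda>\<mu>. LINT x|\<mu>. f x) -` U \<inter> space finite_measures_algebra
      = {\<mu> \<in> finite_borel_measures. (LINT x|\<mu>. f x) \<in> U}"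
    by (auto simp: space_finite_measures_algebra)
  ultimately show "(\<lambda>\<mu>. LINT x|\<mu>. f x) -` U \<inter> space finite_measures_algebra
      \<in> sets finite_measures_algebra"
    by (simp add: sets_borel_of)
qed

text \<open>The indicator of an open set is the limit of the bounded continuous functions
  \<open>min 1 (n * infdist x (- U))\<close>, so dominated convergence applies. The whole space is
  treated apart: \<open>infdist\<close> to the empty set is 0 by convention, and the approximants
  would vanish.\<close>

lemma measure_open_measurable:
  fixes U :: "'a::metric_space set"
  assumes "open U"
  shows "(\<lambda>\<mu>. measure \<mu> U) \<in> borel_measurable finite_measures_algebra"
proof (cases "U = UNIV")
  case True
  have "(\<lambda>\<mu>::'a measure. LINT x|\<mu>. (1::real)) \<in> borel_measurable finite_measures_algebra"
    by (rule integral_measurable_finite_measures_algebra) auto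
  thus ?thesis using True
    by (subst measurable_cong[where g="\<lambda>\<mu>::'a measure. LINT x|\<mu>. (1::real)"])
       (auto simp: space_finite_measures_algebra dest: finite_borel_measuresD(3))
next
  case False
  define f where "f n x = min 1 (real n * infdist x (- U))" for n x
  have cf: "continuous_on UNIV (f n)" for n
    unfolding f_def by (intro continuous_intros)
  have bf: "norm (f n x) \<le> 1" for n x unfolding f_def by (auto simp: infdist_nonneg)
  have lim: "(\<lambda>n. f n x) \<longlonglongrightarrow> indicator U x" for x
  proof (cases "x \<in> U")
    case True
    have d: "infdist x (- U) > 0" 
      using True False assms in_closed_iff_infdist_zero[of "-U" x] infdist_nonneg[of x "-U"] by force
    obtain N where N: "1 / infdist x (- U) < real N" using reals_Archimedean2 by blast
    have "f n x = 1" if "n \<ge> N" for n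
    proof -
      have "1 / infdist x (- U) \<le> real n" using N that by linarith
      thus ?thesis using d unfolding f_def by (simp add: field_simps)
    qed
    hence "eventually (\<lambda>n. f n x = 1) sequentially" by (rule eventually_sequentiallyI)
    thus ?thesis using True by (simp add: tendsto_eventually)
  next
    case False thus ?thesis by (simp add: f_def)
  qed
  have lim_int: "(\<lambda>n. LINT x|\<mu>. f n x) \<longlonglongrightarrow> measure \<mu> U" if "\<mu> \<in> finite_borel_measures" for \<mu>
  proof -
    note [simp, measurable_cong] = finite_borel_measuresD(1)[OF that]
    interpret finite_measure \<mu> by (rule finite_borel_measuresD(2)[OF that])
    have [measurable]: "f n \<in> borel_measurable borel" for n
      using cf by (rule borel_measurable_continuous_onI)
    have [measurable]: "U \<in> sets borel" using assms by simp
    have "(\<lambda>n. LINT x|\<mu>. f n x) \<longlonglongrightarrow> (LINT x|\<mu>. indicator U x)"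
      by (rule integral_dominated_convergence[where w="\<lambda>_. 1"]) (auto simp: lim bf[simplified])
    thus ?thesis using finite_borel_measuresD(3)[OF that] by simp
  qed
  have "bounded (range (f n))" for n
    using bf by (intro boundedI[of _ 1]) blast
  hence "(\<lambda>\<mu>. LINT x|\<mu>. f n x) \<in> borel_measurable finite_measures_algebra" for n
    by (rule integral_measurable_finite_measures_algebra[OF cf])
  thus ?thesis
    by (rule borel_measurable_LIMSEQ_real[where u="\<lambda>n \<mu>. LINT x|\<mu>. f n x", rotated]) (simp only: space_finite_measures_algebra lim_int)
qed

text \<open>Dynkin's argument, starting from the intersection-stable family of open sets. Finiteness
  of the measures turns complements into differences.\<close>

lemma emeasure_measurable_finite_measures_algebra:
  fixes A :: "'a::metric_space set"
  assumes "A \<in> sets borel"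
  shows "(\<lambda>\<mu>. emeasure \<mu> A) \<in> borel_measurable finite_measures_algebra"
proof -
  have "Int_stable {U::'a set. open U}" "{U::'a set. open U} \<subseteq> Pow UNIV"
    "A \<in> sigma_sets UNIV {U::'a set. open U}"
    using assms by (auto simp: borel_def Int_stable_def)
  \<comment> \<open>Borel membership is carried through the induction because the complement and
    union cases need it for the smaller sets.\<close>
  hence "A \<in> sets borel \<and> ?thesis"
  proof (induct rule: sigma_sets_induct_disjoint)
    case (basic U)
    hence "open U" by simp
    hence "(\<lambda>\<mu>. ennreal (measure \<mu> U)) \<in> borel_measurable finite_measures_algebra"
      by (intro measurable_compose[OF measure_open_measurable]) auto
    hence "(\<lambda>\<mu>. emeasure \<mu> U) \<in> borel_measurable finite_measures_algebra"
      by (subst measurable_cong[where g="\<lambda>\<mu>. ennreal (measure \<mu> U)"])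
        (auto simp: space_finite_measures_algebra finite_borel_measures_def finite_measure.emeasure_eq_measure)
    thus ?case using \<open>open U\<close> by simp
  next
    case empty show ?case by simp
  next
    case (compl A)
    have "(\<lambda>\<mu>. ennreal (measure \<mu> (UNIV::'a set))) \<in> borel_measurable finite_measures_algebra"
      by (intro measurable_compose[OF measure_open_measurable]) auto
    hence 1: "(\<lambda>\<mu>. ennreal (measure \<mu> (UNIV::'a set)) - emeasure \<mu> A) \<in> borel_measurable finite_measures_algebra"
      using compl by (intro borel_measurable_minus_ennreal) auto
    have "emeasure \<mu> (UNIV - A) = ennreal (measure \<mu> UNIV) - emeasure \<mu> A"
      if "\<mu> \<in> finite_borel_measures" for \<mu>
    proof -
      interpret finite_measure \<mu> by (rule finite_borel_measuresD(2)[OF that])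
      have "emeasure \<mu> (space \<mu> - A) = emeasure \<mu> (space \<mu>) - emeasure \<mu> A"
        using compl finite_borel_measuresD(1)[OF that] by (intro emeasure_compl) (auto simp: emeasure_finite)
      thus ?thesis using finite_borel_measuresD(3)[OF that] by (simp add: emeasure_eq_measure)
    qed
    hence "(\<lambda>\<mu>. emeasure \<mu> (UNIV - A)) \<in> borel_measurable finite_measures_algebra"
      by (intro measurable_cong[THEN iffD2, OF _ 1]) (auto simp: space_finite_measures_algebra)
    thus ?case using compl by auto
  next
    case (union A)
    hence 1: "(\<lambda>\<mu>. \<Sum>i. emeasure \<mu> (A i)) \<in> borel_measurable finite_measures_algebra"
      by (intro borel_measurable_suminf_order) auto
    have "emeasure \<mu> (\<Union>i. A i) = (\<Sum>i. emeasure \<mu> (A i))" if "\<mu> \<in> finite_borel_measures" for \<mu>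
      using union finite_borel_measuresD(1)[OF that] by (intro suminf_emeasure[symmetric]) auto
    hence "(\<lambda>\<mu>. emeasure \<mu> (\<Union>i. A i)) \<in> borel_measurable finite_measures_algebra"
      by (intro measurable_cong[THEN iffD2, OF _ 1]) (auto simp: space_finite_measures_algebra)
    thus ?case using union by auto
  qed
  thus ?thesis by simp
qed

lemma measure_measurable_finite_measures_algebra:
  fixes A :: "'a::metric_space set"
  assumes "A \<in> sets borel"
  shows "(\<lambda>\<mu>. measure \<mu> A) \<in> borel_measurable finite_measures_algebra"
  unfolding measure_def
  by (rule borel_measurable_enn2real[OF emeasure_measurable_finite_measures_algebra[OF assms]])

text \<open>Only the evaluations of the kernel enter, so this applies to unnormalised kernels before
  \<open>\<kappa>\<close> is known to be measurable as a map into a space of measures. Deducing the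
  latter is its first use.\<close>

lemma nn_integral_kernel_measurable:
  assumes sets: "\<And>\<omega>. \<omega> \<in> space M \<Longrightarrow> sets (\<kappa> \<omega>) = sets N"
    and ev: "\<And>A. A \<in> sets N \<Longrightarrow> (\<lambda>\<omega>. emeasure (\<kappa> \<omega>) A) \<in> borel_measurable M"
    and "g \<in> borel_measurable N"
  shows "(\<lambda>\<omega>. \<integral>\<^sup>+x. g x \<partial>\<kappa> \<omega>) \<in> borel_measurable M"
  using assms(3)
proof induct
  case (cong f g)
  have "(\<integral>\<^sup>+x. f x \<partial>\<kappa> \<omega>) = (\<integral>\<^sup>+x. g x \<partial>\<kappa> \<omega>)" if "\<omega> \<in> space M" for \<omega>
    using cong sets_eq_imp_space_eq[OF sets[OF that]] by (intro nn_integral_cong) auto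
  thus ?case by (rule measurable_cong[THEN iffD2, OF _ cong(4)])
next
  case (set B)
  have "(\<integral>\<^sup>+x. indicator B x \<partial>\<kappa> \<omega>) = emeasure (\<kappa> \<omega>) B" if "\<omega> \<in> space M" for \<omega>
    using set sets[OF that] by (intro nn_integral_indicator) simp
  thus ?case by (rule measurable_cong[THEN iffD2, OF _ ev[OF set]])
next
  case (mult u c)
  have "(\<integral>\<^sup>+x. c * u x \<partial>\<kappa> \<omega>) = c * (\<integral>\<^sup>+x. u x \<partial>\<kappa> \<omega>)" if "\<omega> \<in> space M" for \<omega>
    using mult measurable_cong_sets[OF sets[OF that] refl] by (intro nn_integral_cmult) blast
  moreover have "(\<lambda>\<omega>. c * (\<integral>\<^sup>+x. u x \<partial>\<kappa> \<omega>)) \<in> borel_measurable M"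
    using mult(4) by (intro borel_measurable_times_ennreal) auto
  ultimately show ?case by (rule measurable_cong[THEN iffD2])
next
  case (add u v)
  have "(\<integral>\<^sup>+x. v x + u x \<partial>\<kappa> \<omega>) = (\<integral>\<^sup>+x. v x \<partial>\<kappa> \<omega>) + (\<integral>\<^sup>+x. u x \<partial>\<kappa> \<omega>)" if "\<omega> \<in> space M" for \<omega>
    using add measurable_cong_sets[OF sets[OF that] refl] by (intro nn_integral_add) blast+
  moreover have "(\<lambda>\<omega>. (\<integral>\<^sup>+x. v x \<partial>\<kappa> \<omega>) + (\<integral>\<^sup>+x. u x \<partial>\<kappa> \<omega>)) \<in> borel_measurable M"
    using add by (intro borel_measurable_add) auto
  ultimately show ?case by (rule measurable_cong[THEN iffD2])
next
  case (seq U)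
  have "(\<integral>\<^sup>+x. (SUP i. U i) x \<partial>\<kappa> \<omega>) = (SUP i. \<integral>\<^sup>+x. U i x \<partial>\<kappa> \<omega>)" if "\<omega> \<in> space M" for \<omega>
    using seq measurable_cong_sets[OF sets[OF that] refl] unfolding SUP_apply
    by (intro nn_integral_monotone_convergence_SUP) blast+
  moreover have "(\<lambda>\<omega>. SUP i. \<integral>\<^sup>+x. U i x \<partial>\<kappa> \<omega>) \<in> borel_measurable M"
    using seq by (intro borel_measurable_SUP) auto
  ultimately show ?case by (rule measurable_cong[THEN iffD2])
qed

section \<open>A countable network for the weak topology\<close>

definition step_sup :: "(rat \<times> 'a set) set \<Rightarrow> 'a \<Rightarrow> ennreal" where
  "step_sup F x = (SUP (c, U)\<in>F. ennreal (of_rat c) * indicator U x)"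

text \<open>These sets need not be open, but they are evaluation-measurable, and countably many of them
  (with steps taken from a countable base) form a network of the weak topology.\<close>

definition test_set :: "((rat \<times> 'a::topological_space set) set \<times> rat \<times> rat) set \<Rightarrow> 'a measure set" where
  "test_set T = {\<mu> \<in> finite_borel_measures. \<forall>(F, q, p)\<in>T.
     of_rat q < enn2real (\<integral>\<^sup>+x. step_sup F x \<partial>\<mu>) \<and> measure \<mu> UNIV < of_rat p}"

lemma step_sup_measurable:
  fixes F :: "(rat \<times> 'a::topological_space set) set"
  assumes "finite F" "\<And>c U. (c, U) \<in> F \<Longrightarrow> open U"
  shows "step_sup F \<in> borel_measurable borel"
  unfolding step_sup_def[abs_def] case_prod_beta
proof (rule borel_measurable_SUP)
  show "(\<lambda>x. ennreal (of_rat (fst t)) * indicator (snd t) x) \<in> borel_measurable borel" if "t \<in> F" for t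
    using assms(2)[of "fst t" "snd t"] that
    by (intro borel_measurable_times_ennreal borel_measurable_indicator) auto
qed (use assms(1) in \<open>rule countable_finite\<close>)

text \<open>Below f(x) there is a rational c, and the open set where f exceeds c contains a basic
  neighbourhood of x. The supremum runs over initial segments of an enumeration so that it is
  monotone in n, as monotone convergence requires.\<close>

lemma continuous_eq_SUP_step_sup:
  fixes f :: "'a::topological_space \<Rightarrow> real" and e :: "nat \<Rightarrow> rat \<times> 'a set"
  assumes B: "topological_basis B" and f: "continuous_on UNIV f" "\<And>x. 0 \<le> f x"
    and e: "range e = {(c, U). U \<in> B \<and> (\<forall>y\<in>U. of_rat c \<le> f y)}"
  shows "(SUP n. step_sup (e ` {..n}) x) = ennreal (f x)"
proof (rule antisym)
  show "(SUP n. step_sup (e ` {..n}) x) \<le> ennreal (f x)"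
  proof (rule SUP_least)
    fix n
    have "ennreal (of_rat c) * indicator U x \<le> ennreal (f x)" if "(c, U) \<in> e ` {..n}" for c U
    proof -
      have "(c, U) \<in> range e" using that by auto
      thus ?thesis unfolding e by (auto simp: indicator_def intro: ennreal_leI)
    qed
    thus "step_sup (e ` {..n}) x \<le> ennreal (f x)"
      unfolding step_sup_def by (intro SUP_least) auto
  qed
  have step: "ennreal (of_rat c) \<le> (SUP n. step_sup (e ` {..n}) x)" if c: "of_rat c < f x" for c
  proof -
    have "open {y. of_rat c < f y}" using f by (intro open_Collect_less) auto
    then obtain U where U: "U \<in> B" "x \<in> U" "U \<subseteq> {y. of_rat c < f y}"
      using topological_basisE[OF B, of "{y. of_rat c < f y}" x] c by blast
    hence "(c, U) \<in> range e" unfolding e by (auto intro: less_imp_le)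
    then obtain n where n: "e n = (c, U)" by auto
    have "ennreal (of_rat c) \<le> step_sup (e ` {..n}) x"
      unfolding step_sup_def
    proof (rule SUP_upper2)
      show "(c, U) \<in> e ` {..n}" unfolding n[symmetric] by simp
    qed (use U in simp)
    also have "\<dots> \<le> (SUP n. step_sup (e ` {..n}) x)" by (rule SUP_upper) simp
    finally show ?thesis .
  qed
  show "ennreal (f x) \<le> (SUP n. step_sup (e ` {..n}) x)"
  proof (rule dense_le)
    fix y assume y: "y < ennreal (f x)"
    then obtain r where r: "y = ennreal r" "0 \<le> r" by (cases y) auto
    hence "r < f x" using y f(2)[of x] by (simp add: ennreal_less_iff)
    then obtain c where c: "r < of_rat c" "of_rat c < f x" using of_rat_dense by blast
    have "y \<le> ennreal (of_rat c)" using r c by (simp add: ennreal_leI)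
    thus "y \<le> (SUP n. step_sup (e ` {..n}) x)" using step[OF c(2)] by (rule order_trans)
  qed
qed

lemma step_sup_mono: "F \<subseteq> G \<Longrightarrow> step_sup F x \<le> step_sup G x"
  unfolding step_sup_def by (rule SUP_subset_mono) auto

text \<open>Steps approximate non-negative functions from below, so h is replaced by h + K. This
  adds K times the total mass to the integral, and the upper bound p on the mass in a test set is
  there to control that term.\<close>

lemma integral_greater_test_set:
  fixes h :: "'a::polish_space \<Rightarrow> real"
  assumes B: "topological_basis B" "countable B"
    and h: "continuous_on UNIV h" "\<And>x. \<bar>h x\<bar> \<le> K"
    and \<mu>0: "\<mu>0 \<in> finite_borel_measures" "b < (LINT x|\<mu>0. h x)"
  obtains F q p where "finite F" "F \<subseteq> UNIV \<times> B" "\<mu>0 \<in> test_set {(F, q, p)}"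
    "test_set {(F, q, p)} \<subseteq> {\<mu>. b < (LINT x|\<mu>. h x)}"
proof -
  have K: "0 \<le> K" using h(2)[of undefined] by linarith
  let ?E = "{(c, U). U \<in> B \<and> (\<forall>y\<in>U. of_rat c \<le> h y + K)}"
  have hm: "h \<in> borel_measurable borel" using h(1) by (rule borel_measurable_continuous_onI)
  have hK: "0 \<le> h x + K" for x using h(2)[of x] by linarith
  have int: "integrable \<mu> h" "(LINT x|\<mu>. h x + K) = (LINT x|\<mu>. h x) + K * measure \<mu> UNIV"
    "(\<integral>\<^sup>+x. ennreal (h x + K) \<partial>\<mu>) = ennreal ((LINT x|\<mu>. h x) + K * measure \<mu> UNIV)"
    if \<mu>: "\<mu> \<in> finite_borel_measures" for \<mu>
  proof -
    interpret finite_measure \<mu> by (rule finite_borel_measuresD(2)[OF \<mu>])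
    have hm': "h \<in> borel_measurable \<mu>" 
      using hm measurable_cong_sets[OF finite_borel_measuresD(1)[OF \<mu>] refl] by blast
    show 1: "integrable \<mu> h"
      by (rule integrable_const_bound[of _ K]) (use h(2) hm' in auto)
    show 2: "(LINT x|\<mu>. h x + K) = (LINT x|\<mu>. h x) + K * measure \<mu> UNIV"
      using 1 finite_borel_measuresD(3)[OF \<mu>] by simp
    have "(\<integral>\<^sup>+x. ennreal (h x + K) \<partial>\<mu>) = ennreal (LINT x|\<mu>. h x + K)"
      using 1 hK by (intro nn_integral_eq_integral) auto
    thus "(\<integral>\<^sup>+x. ennreal (h x + K) \<partial>\<mu>) = ennreal ((LINT x|\<mu>. h x) + K * measure \<mu> UNIV)"
      using 2 by simp
  qed
  have "countable ?E"
    by (rule countable_subset[of _ "UNIV \<times> B"]) (use B(2) in auto)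
  moreover obtain U where "U \<in> B"
    using topological_basisE[OF B(1) open_UNIV, of undefined] by auto
  \<comment> \<open>The step 0 is admissible because h + K is non-negative. So the set of steps is
    non-empty, and \<open>from_nat_into\<close> enumerates exactly this set.\<close>
  hence "(of_int (\<lfloor>0::real\<rfloor>), U) \<in> ?E" using hK by auto
  hence "?E \<noteq> {}" by blast
  ultimately have e: "range (from_nat_into ?E) = ?E" by (intro range_from_nat_into)
  define e where "e = from_nat_into ?E"
  note e = e[folded e_def]
  have eB: "e ` A \<subseteq> UNIV \<times> B" for A :: "nat set" 
  proof -
    have "e i \<in> UNIV \<times> B" for i using rangeI[of e i] unfolding e by auto
    thus ?thesis by blast
  qed
  have em: "step_sup (e ` A) \<in> borel_measurable borel" if "finite A" for A :: "nat set"
    using that eB[of A] topological_basis_open[OF B(1)] by (intro step_sup_measurable) auto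
  have SUP: "(SUP n. step_sup (e ` {..n}) x) = ennreal (h x + K)" for x
    by (rule continuous_eq_SUP_step_sup[OF B(1) continuous_on_add[OF h(1) continuous_on_const] hK e])
  have le: "step_sup (e ` {..n}) x \<le> ennreal (h x + K)" for n x
    unfolding SUP[symmetric] by (rule SUP_upper) simp
  have fin: "(\<integral>\<^sup>+x. step_sup (e ` {..n}) x \<partial>\<mu>) \<le> ennreal ((LINT x|\<mu>. h x) + K * measure \<mu> UNIV)"
    if "\<mu> \<in> finite_borel_measures" for \<mu> n
    unfolding int(3)[OF that, symmetric] by (intro nn_integral_mono le)
  let ?m = "measure \<mu>0 UNIV" and ?I = "LINT x|\<mu>0. h x"
  define d where "d = ?I - b"
  have d: "d > 0" using \<mu>0(2) by (simp add: d_def)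
  \<comment> \<open>The excess p - m of the mass bound may cost at most d in the integral, that is K
    * (p - m) < d. Dividing by K + 1 also covers K = 0.\<close>
  obtain p where p: "?m < of_rat p" "of_rat p < ?m + d / (K + 1)"
    using of_rat_dense[of ?m "?m + d / (K + 1)"] d K by auto
  have "K * (of_rat p - ?m) < d"
  proof -
    have "(K + 1) * (of_rat p - ?m) < d" using p(2) K by (simp add: field_simps)
    moreover have "(K + 1) * (of_rat p - ?m) = K * (of_rat p - ?m) + (of_rat p - ?m)"
      by (simp add: algebra_simps)
    ultimately show ?thesis using p(1) by linarith
  qed
  hence "b + K * of_rat p < ?I + K * ?m" by (simp add: d_def algebra_simps)
  \<comment> \<open>The lower inequality makes the test set small enough after K * p is subtracted;
    the upper one leaves room for the given measure to belong to it.\<close>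
  then obtain q where q: "b + K * of_rat p < of_rat q" "of_rat q < ?I + K * ?m"
    using of_rat_dense by blast
  have "\<exists>n. of_rat q < enn2real (\<integral>\<^sup>+x. step_sup (e ` {..n}) x \<partial>\<mu>0)"
  \<comment> \<open>For negative q every n works, since \<open>enn2real\<close> is non-negative.
    Otherwise q can be compared inside \<open>ennreal\<close>.\<close>
  proof (cases "(of_rat q :: real) < 0")
    case True
    thus ?thesis by (meson enn2real_nonneg less_le_trans)
  next
    case False
    have "(\<integral>\<^sup>+x. ennreal (h x + K) \<partial>\<mu>0) = (SUP n. \<integral>\<^sup>+x. step_sup (e ` {..n}) x \<partial>\<mu>0)"
      unfolding SUP[symmetric]
    proof (rule nn_integral_monotone_convergence_SUP)
      show "incseq (\<lambda>n. step_sup (e ` {..n}))"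
        by (auto simp: incseq_def le_fun_def intro!: step_sup_mono)
      show "step_sup (e ` {..n}) \<in> borel_measurable \<mu>0" for n
        using em[of "{..n}"] measurable_cong_sets[OF finite_borel_measuresD(1)[OF \<mu>0(1)] refl] by blast
    qed
    moreover have "ennreal (of_rat q) < (\<integral>\<^sup>+x. ennreal (h x + K) \<partial>\<mu>0)"
      unfolding int(3)[OF \<mu>0(1)] using q(2) False by (simp add: ennreal_less_iff)
    ultimately obtain n where n: "ennreal (of_rat q) < (\<integral>\<^sup>+x. step_sup (e ` {..n}) x \<partial>\<mu>0)"
      by (auto simp: less_SUP_iff)
    have "(\<integral>\<^sup>+x. step_sup (e ` {..n}) x \<partial>\<mu>0) < \<top>"
      using fin[OF \<mu>0(1), of n] by (auto simp: less_top[symmetric] top_unique)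
    hence "ennreal (of_rat q) < ennreal (enn2real (\<integral>\<^sup>+x. step_sup (e ` {..n}) x \<partial>\<mu>0))"
      using n by (simp add: ennreal_enn2real)
    hence "of_rat q < enn2real (\<integral>\<^sup>+x. step_sup (e ` {..n}) x \<partial>\<mu>0)"
      using False by (simp add: ennreal_less_iff)
    thus ?thesis by blast
  qed
  then obtain n where n: "of_rat q < enn2real (\<integral>\<^sup>+x. step_sup (e ` {..n}) x \<partial>\<mu>0)" by blast
  show thesis
  proof (rule that[of "e ` {..n}" q p])
    show "\<mu>0 \<in> test_set {(e ` {..n}, q, p)}" using \<mu>0(1) p(1) n by (simp add: test_set_def)
    show "test_set {(e ` {..n}, q, p)} \<subseteq> {\<mu>. b < (LINT x|\<mu>. h x)}"
    proof
      fix \<mu> assume "\<mu> \<in> test_set {(e ` {..n}, q, p)}"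
      hence \<mu>: "\<mu> \<in> finite_borel_measures" "of_rat q < enn2real (\<integral>\<^sup>+x. step_sup (e ` {..n}) x \<partial>\<mu>)"
        "measure \<mu> UNIV < of_rat p" by (auto simp: test_set_def)
      have "0 \<le> (LINT x|\<mu>. h x) + K * measure \<mu> UNIV"
        unfolding int(2)[OF \<mu>(1), symmetric] using hK by simp
      hence "enn2real (\<integral>\<^sup>+x. step_sup (e ` {..n}) x \<partial>\<mu>) \<le> (LINT x|\<mu>. h x) + K * measure \<mu> UNIV"
        using fin[OF \<mu>(1), of n] by (rule enn2real_leI)
      moreover have "K * measure \<mu> UNIV \<le> K * of_rat p" using K \<mu>(3) by (intro mult_left_mono) auto
      ultimately show "\<mu> \<in> {\<mu>. b < (LINT x|\<mu>. h x)}" using q(1) \<mu>(2) by simp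
    qed
  qed (use eB in auto)
qed

lemma test_set_Int: "test_set S \<inter> test_set T = test_set (S \<union> T)"
  unfolding test_set_def ball_Un by blast

text \<open>Induction over the generation of the topology. Collecting constraints intersects test
  sets, which settles finite intersections. For a subbasic set, an interval around the integral of f
  is enforced by one lower bound for f and one for -f.\<close>

lemma openin_weak_topology_test_set:
  fixes U :: "'a::polish_space measure set"
  assumes B: "topological_basis B" "countable B" and U: "openin weak_topology U" "\<mu> \<in> U"
  shows "\<exists>T. finite T \<and> T \<subseteq> {F. finite F \<and> F \<subseteq> UNIV \<times> B} \<times> UNIV \<and> \<mu> \<in> test_set T \<and> test_set T \<subseteq> U"
    (is "\<exists>T. ?P T \<mu> U")
proof -
  have "generate_topology_on {{\<mu> \<in> finite_borel_measures. (LINT x|\<mu>. f x) \<in> U} | (f :: 'a \<Rightarrow> real) U.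
        continuous_on UNIV f \<and> bounded (range f) \<and> open U} U"
    using U(1) unfolding weak_topology_def openin_topology_generated_by_iff .
  thus ?thesis using U(2)
  proof (induct arbitrary: \<mu>)
    case Empty thus ?case by simp
  next
    case (Int a b)
    obtain S where S: "?P S \<mu> a" using Int(2)[of \<mu>] Int(5) by blast
    obtain T where T: "?P T \<mu> b" using Int(4)[of \<mu>] Int(5) by blast
    have "?P (S \<union> T) \<mu> (a \<inter> b)" using S T unfolding test_set_Int[symmetric] by auto
    thus ?case by (rule exI)
  next
    case (UN K)
    then obtain k where k: "k \<in> K" "\<mu> \<in> k" by blast
    then obtain T where "?P T \<mu> k" using UN(2)[of k \<mu>] by blast
    hence "?P T \<mu> (\<Union>K)" using k(1) by blast
    thus ?case by (rule exI)
  next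
    case (Basis s)
    then obtain f :: "'a \<Rightarrow> real" and V where s: "s = {\<mu> \<in> finite_borel_measures. (LINT x|\<mu>. f x) \<in> V}"
      and f: "continuous_on UNIV f" "bounded (range f)" and V: "open V" by blast
    let ?a = "LINT x|\<mu>. f x"
    have \<mu>: "\<mu> \<in> finite_borel_measures" "?a \<in> V" using s Basis(2) by auto
    obtain \<epsilon> where \<epsilon>: "\<epsilon> > 0" "ball ?a \<epsilon> \<subseteq> V" using V \<mu>(2) by (auto simp: open_contains_ball)
    obtain K where K: "\<And>x. \<bar>f x\<bar> \<le> K" using f(2) by (auto simp: bounded_iff)
    obtain F q p where 1: "finite F" "F \<subseteq> UNIV \<times> B" "\<mu> \<in> test_set {(F, q, p)}"
      "test_set {(F, q, p)} \<subseteq> {\<mu>. ?a - \<epsilon> < (LINT x|\<mu>. f x)}"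
      using integral_greater_test_set[OF B f(1) K \<mu>(1), of "?a - \<epsilon>"] \<epsilon>(1) by auto
    obtain F' q' p' where 2: "finite F'" "F' \<subseteq> UNIV \<times> B" "\<mu> \<in> test_set {(F', q', p')}"
      "test_set {(F', q', p')} \<subseteq> {\<mu>. - ?a - \<epsilon> < (LINT x|\<mu>. - f x)}"
      using integral_greater_test_set[OF B continuous_on_minus[OF f(1)] _ \<mu>(1), of K "- ?a - \<epsilon>"]
        \<epsilon>(1) K by auto
    let ?T = "{(F, q, p)} \<union> {(F', q', p')}"
    have "test_set ?T \<subseteq> s"
    proof
      fix \<mu>' assume "\<mu>' \<in> test_set ?T"
      hence 3: "\<mu>' \<in> test_set {(F, q, p)}" "\<mu>' \<in> test_set {(F', q', p')}"
        unfolding test_set_Int[symmetric] by blast+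
      hence "\<mu>' \<in> finite_borel_measures" by (auto simp: test_set_def)
      moreover have "?a - \<epsilon> < (LINT x|\<mu>'. f x)" using 3(1) 1(4) by blast
      moreover have "- ?a - \<epsilon> < (LINT x|\<mu>'. - f x)" using 3(2) 2(4) by blast
      ultimately show "\<mu>' \<in> s" using \<epsilon>(2) unfolding s by (auto simp: subset_iff dist_real_def)
    qed
    moreover have "\<mu> \<in> test_set ?T" unfolding test_set_Int[symmetric] using 1 2 by blast
    ultimately have "?P ?T \<mu> s" using 1(1,2) 2(1,2) by simp
    thus ?case by (rule exI)
  qed
qed

text \<open>An open set is the union of the test sets inside it. Over a countable base there are
  only countably many of them, and the preimage of each is described by finitely many inequalities
  between evaluations and kernel integrals.\<close>

theorem measurable_finite_measures_algebraI:
  fixes f :: "'b \<Rightarrow> 'a::polish_space measure"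
  assumes f: "\<And>\<omega>. \<omega> \<in> space M \<Longrightarrow> f \<omega> \<in> finite_borel_measures"
    and ev: "\<And>A. A \<in> sets borel \<Longrightarrow> (\<lambda>\<omega>. emeasure (f \<omega>) A) \<in> borel_measurable M"
  shows "f \<in> measurable M finite_measures_algebra"
  unfolding borel_of_def
proof (rule measurable_measure_of)
  fix U :: "'a measure set" assume "U \<in> Collect (openin weak_topology)"
  hence U: "openin weak_topology U" by simp
  obtain B :: "'a set set" where B: "countable B" "topological_basis B"
    using ex_countable_basis by blast
  let ?\<T> = "{T. finite T \<and> T \<subseteq> {F. finite F \<and> F \<subseteq> UNIV \<times> B} \<times> UNIV \<and> test_set T \<subseteq> U}"
  have "countable {F :: (rat \<times> 'a set) set. finite F \<and> F \<subseteq> UNIV \<times> B}"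
    using B by (intro countable_Collect_finite_subset) auto
  hence "countable {T. finite T \<and> T \<subseteq> {F :: (rat \<times> 'a set) set. finite F \<and> F \<subseteq> UNIV \<times> B} \<times> (UNIV :: (rat \<times> rat) set)}"
    by (intro countable_Collect_finite_subset countable_SIGMA) (use B in auto)
  hence cT: "countable ?\<T>" by (rule countable_subset[rotated]) auto
  have eq: "U = (\<Union>T\<in>?\<T>. test_set T)"
    using openin_weak_topology_test_set[OF B(2,1) U] by fast
  have T_sets: "f -` test_set T \<inter> space M \<in> sets M" if T: "T \<in> ?\<T>" for T
  proof -
    have "f -` test_set T \<inter> space M = {\<omega>\<in>space M. \<forall>t\<in>T.
        of_rat (fst (snd t)) < enn2real (\<integral>\<^sup>+x. step_sup (fst t) x \<partial>f \<omega>)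
        \<and> enn2real (emeasure (f \<omega>) UNIV) < of_rat (snd (snd t))}"
      using f by (auto simp: test_set_def measure_def split: prod.splits)
    moreover have "(\<lambda>\<omega>. \<integral>\<^sup>+x. step_sup (fst t) x \<partial>f \<omega>) \<in> borel_measurable M" if "t \<in> T" for t
    proof (rule nn_integral_kernel_measurable[where N=borel])
      show "step_sup (fst t) \<in> borel_measurable borel"
        using that T topological_basis_open[OF B(2)] by (intro step_sup_measurable) fastforce+
    qed (use f ev finite_borel_measuresD(1) in auto)
    moreover have "(\<lambda>\<omega>. emeasure (f \<omega>) UNIV) \<in> borel_measurable M" by (rule ev) simp
    ultimately show ?thesis using T
      by (auto intro!: sets.sets_Collect_finite_All sets.sets_Collect_conj borel_measurable_less
          borel_measurable_enn2real)
  qed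
  have "f -` U \<inter> space M = (\<Union>T\<in>?\<T>. f -` test_set T) \<inter> space M"
    using arg_cong[OF eq, of "\<lambda>V. f -` V \<inter> space M"] by (simp only: vimage_UN)
  also have "\<dots> = (\<Union>T\<in>?\<T>. f -` test_set T \<inter> space M)" by blast
  also have "\<dots> \<in> sets M" using cT T_sets by (rule sets.countable_UN'')
  finally show "f -` U \<inter> space M \<in> sets M" .
qed (auto simp: topspace_weak_topology f dest!: openin_subset)

section \<open>Power laws and polar decomposition\<close>

text \<open>The Dirac mass at 0 is the limit of \<open>lambda_measure a\<close> as a tends to 0.
  With it the formula \<open>r powr a / Gamma (a + 1)\<close> for the ray below r > 0 holds for all
  a \<ge> 0. Cells of intensity zero lead to this case.\<close>

definition power_law :: "real \<Rightarrow> real measure" where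
  "power_law a = (if a = 0 then return borel 0 else lambda_measure a)"

lemma sets_power_law [measurable_cong, simp]: "sets (power_law a) = sets borel"
  by (simp add: power_law_def lambda_measure_def)

lemma space_power_law [simp]: "space (power_law a) = UNIV"
  by (simp add: power_law_def lambda_measure_def)

lemma sets_gamma_law [measurable_cong, simp]: "sets (gamma_law a) = sets borel"
  by (simp add: gamma_law_def)

lemma nn_integral_lambda_measure:
  assumes "g \<in> borel_measurable borel"
  shows "(\<integral>\<^sup>+t. g t \<partial>lambda_measure a) =
    (\<integral>\<^sup>+t. ennreal (t powr (a - 1) / Gamma a) * indicator {0<..} t * g t \<partial>lborel)"
  unfolding lambda_measure_def using assms by (intro nn_integral_density) auto

lemma emeasure_power_law_lessThan:
  assumes "0 \<le> a"
  shows "emeasure (power_law a) {..<r} = (if r \<le> 0 then 0 else ennreal (r powr a / Gamma (a + 1)))"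
proof (cases "a = 0")
  case True thus ?thesis by (simp add: power_law_def indicator_def)
next
  case False
  hence a: "a > 0" using assms by simp
  have 1: "emeasure (power_law a) {..<r} =
      (\<integral>\<^sup>+t. ennreal (t powr (a - 1) / Gamma a) * indicator {0<..} t * indicator {..<r} t \<partial>lborel)"
    using False nn_integral_lambda_measure[of "indicator {..<r}" a]
    by (simp add: power_law_def lambda_measure_def)
  show ?thesis
  proof (cases "r \<le> 0")
    case True
    have "(\<integral>\<^sup>+t. ennreal (t powr (a - 1) / Gamma a) * indicator {0<..} t * indicator {..<r} t \<partial>lborel)
      = (\<integral>\<^sup>+t. 0 \<partial>(lborel :: real measure))"
      using True by (intro nn_integral_cong) (auto simp: indicator_def)
    thus ?thesis using 1 True by simp
  next
    case False
    hence r: "r > 0" by simp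
    have "((\<lambda>t. t powr (a - 1) / Gamma a) has_integral (r powr a / a / Gamma a)) {0..r}"
      using has_integral_divide[OF has_integral_powr_from_0[of "a - 1" r], of "Gamma a"] a r by simp
    hence 2: "(\<integral>\<^sup>+t. ennreal (indicator {0..r} t * (t powr (a - 1) / Gamma a)) \<partial>lborel) = ennreal (r powr a / a / Gamma a)"
      using a by (intro nn_integral_has_integral_lebesgue) (auto simp: Gamma_real_pos less_imp_le)
    have "(\<integral>\<^sup>+t. ennreal (t powr (a - 1) / Gamma a) * indicator {0<..} t * indicator {..<r} t \<partial>lborel)
      = (\<integral>\<^sup>+t. ennreal (indicator {0..r} t * (t powr (a - 1) / Gamma a)) \<partial>lborel)"
    proof (rule nn_integral_cong_AE)
      show "AE t in lborel. ennreal (t powr (a - 1) / Gamma a) * indicator {0<..} t * indicator {..<r} t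
         = ennreal (indicator {0..r} t * (t powr (a - 1) / Gamma a))"
        using AE_lborel_singleton[of "0::real"] AE_lborel_singleton[of r]
        by eventually_elim (auto simp: indicator_def)
    qed
    moreover have "Gamma (a + 1) = a * Gamma a" using a by (intro Gamma_plus1) (auto simp: nonpos_Ints_def)
    ultimately show ?thesis using 1 2 r by simp
  qed
qed

lemma sigma_finite_power_law: "sigma_finite_measure (power_law a)"
proof (cases "a = 0")
  case True
  interpret prob_space "return borel (0::real)" by (rule prob_space_return) simp
  show ?thesis using True by (simp add: power_law_def sigma_finite_measure_axioms)
next
  case False
  have "sigma_finite_measure (density lborel (\<lambda>t::real. ennreal (t powr (a - 1) / Gamma a) * indicator {0<..} t))"
    by (subst sigma_finite_measure.sigma_finite_iff_density_finite[OF sigma_finite_lborel])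
       (auto simp: indicator_def)
  thus ?thesis using False by (simp add: power_law_def lambda_measure_def)
qed

text \<open>The exponent b and the normalising parameter a are kept apart: b = a gives the Laplace
  mass of the power law, b = a + 1 its exponentially weighted mean.\<close>

lemma nn_integral_Gamma:
  assumes "0 < (b::real)" "0 < a"
  shows "(\<integral>\<^sup>+t. ennreal (t powr (b - 1) / Gamma a) * indicator {0<..} t * ennreal (exp (- t)) \<partial>lborel)
    = ennreal (Gamma b / Gamma a)"
proof -
  have "((\<lambda>t. t powr (b - 1) / exp t / Gamma a) has_integral (Gamma b / Gamma a)) {0..}"
    using has_integral_divide[OF Gamma_integral_real[OF assms(1)], of "Gamma a"] .
  hence 2: "(\<integral>\<^sup>+t. ennreal (indicator {0..} t * (t powr (b - 1) / exp t / Gamma a)) \<partial>lborel) = ennreal (Gamma b / Gamma a)"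
    using assms by (intro nn_integral_has_integral_lebesgue) (auto simp: Gamma_real_pos less_imp_le)
  have "(\<integral>\<^sup>+t. ennreal (t powr (b - 1) / Gamma a) * indicator {0<..} t * ennreal (exp (- t)) \<partial>lborel)
    = (\<integral>\<^sup>+t. ennreal (indicator {0..} t * (t powr (b - 1) / exp t / Gamma a)) \<partial>lborel)"
  proof (rule nn_integral_cong_AE)
    show "AE t in lborel. ennreal (t powr (b - 1) / Gamma a) * indicator {0<..} t * ennreal (exp (- t))
       = ennreal (indicator {0..} t * (t powr (b - 1) / exp t / Gamma a))"
      using AE_lborel_singleton[of "0::real"]
      by eventually_elim (use assms in \<open>auto simp: indicator_def Gamma_real_pos less_imp_le exp_minus
            divide_simps simp flip: ennreal_mult\<close>)
  qed
  thus ?thesis using 2 by simp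
qed

lemma nn_integral_exp_power_law:
  assumes "0 \<le> a"
  shows "(\<integral>\<^sup>+t. ennreal (exp (- t)) \<partial>power_law a) = 1"
proof (cases "a = 0")
  case True thus ?thesis by (simp add: power_law_def nn_integral_return)
next
  case False
  hence "a > 0" using assms by simp
  hence "Gamma a \<noteq> 0" using Gamma_real_pos[of a] by linarith
  with \<open>a > 0\<close> show ?thesis using False nn_integral_Gamma[of a a]
    by (simp add: power_law_def nn_integral_lambda_measure)
qed

lemma nn_integral_id_exp_power_law:
  assumes "0 \<le> a"
  shows "(\<integral>\<^sup>+t. ennreal t * ennreal (exp (- t)) \<partial>power_law a) = ennreal a"
proof (cases "a = 0")
  case True thus ?thesis by (simp add: power_law_def nn_integral_return)
next
  case False
  hence a: "a > 0" using assms by simp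
  hence g: "Gamma a > 0" by (rule Gamma_real_pos)
  have "(\<integral>\<^sup>+t. ennreal t * ennreal (exp (- t)) \<partial>power_law a) =
     (\<integral>\<^sup>+t. ennreal (t powr (a - 1) / Gamma a) * indicator {0<..} t * (ennreal t * ennreal (exp (- t))) \<partial>lborel)"
    using False by (simp add: power_law_def nn_integral_lambda_measure)
  also have "\<dots> = (\<integral>\<^sup>+t. ennreal (t powr (a + 1 - 1) / Gamma a) * indicator {0<..} t * ennreal (exp (- t)) \<partial>lborel)"
  proof (rule nn_integral_cong)
    fix t :: real
    show "ennreal (t powr (a - 1) / Gamma a) * indicator {0<..} t * (ennreal t * ennreal (exp (- t)))
      = ennreal (t powr (a + 1 - 1) / Gamma a) * indicator {0<..} t * ennreal (exp (- t))"
    proof (cases "t > 0")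
      case True
      hence "t powr (a - 1) * t = t powr a" using powr_mult_base[of t "a - 1"] by (simp add: mult.commute)
      hence "t powr (a - 1) / Gamma a * t = t powr a / Gamma a" by simp
      hence "ennreal (t powr (a - 1) / Gamma a) * ennreal t = ennreal (t powr a / Gamma a)"
        using True g by (simp flip: ennreal_mult)
      thus ?thesis using True by (simp add: mult.assoc[symmetric])
    qed simp
  qed
  also have "\<dots> = ennreal (Gamma (a + 1) / Gamma a)" using a by (intro nn_integral_Gamma) auto
  also have "Gamma (a + 1) = a * Gamma a" using a by (intro Gamma_plus1) (auto simp: nonpos_Ints_def)
  also have "a * Gamma a / Gamma a = a" using g by simp
  finally show ?thesis .
qed

lemma density_power_law:
  assumes "0 \<le> a"
  shows "density (power_law a) (\<lambda>t. ennreal (exp (- t))) = gamma_law a"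
proof (cases "a = 0")
  case True
  show ?thesis
  proof (rule measure_eqI)
    fix A :: "real set" assume "A \<in> sets (density (power_law a) (\<lambda>t. ennreal (exp (- t))))"
    thus "emeasure (density (power_law a) (\<lambda>t. ennreal (exp (- t)))) A = emeasure (gamma_law a) A"
      using True by (simp add: emeasure_density gamma_law_def power_law_def nn_integral_return)
  qed simp
next
  case False
  hence g: "Gamma a > 0" using assms by (intro Gamma_real_pos) simp
  have "density (density lborel (\<lambda>t. ennreal (t powr (a - 1) / Gamma a) * indicator {0<..} t)) (\<lambda>t. ennreal (exp (- t)))
     = density lborel (\<lambda>t. ennreal (t powr (a - 1) / Gamma a) * indicator {0<..} t * ennreal (exp (- t)))"
    by (rule density_density_eq) auto
  also have "\<dots> = density lborel (\<lambda>t. ennreal (t powr (a - 1) * exp (- t) / Gamma a) * indicator {0<..} t)"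
    using g by (intro arg_cong2[where f=density] ext refl) (auto simp: indicator_def simp flip: ennreal_mult)
  finally show ?thesis using False by (simp add: gamma_law_def power_law_def lambda_measure_def)
qed

lemma AE_power_law_pos:
  assumes "0 < a"
  shows "AE t in power_law a. 0 < t"
proof -
  have "AE t in density lborel (\<lambda>t. ennreal (t powr (a - 1) / Gamma a) * indicator {0<..} t). 0 < t"
    by (subst AE_density) (auto simp: indicator_def)
  thus ?thesis using assms by (simp only: power_law_def lambda_measure_def if_False less_imp_neq[symmetric])
qed

lemma AE_power_law_nonneg:
  assumes "0 \<le> a"
  shows "AE t in power_law a. 0 \<le> t"
proof (cases "a = 0")
  case True
  have "AE t in return borel (0::real). 0 \<le> t" by (subst AE_return) auto
  moreover have "power_law a = return borel 0" using True by (simp add: power_law_def)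
  ultimately show ?thesis by (simp only:)
next
  case False
  hence "AE t in power_law a. 0 < t" using assms by (intro AE_power_law_pos) simp
  thus ?thesis by eventually_elim simp
qed

lemma sets_borel_lessThan: "sets (borel :: real measure) = sigma_sets UNIV (range lessThan)"
  by (subst borel_Iio) simp

lemma borel_eqI_lessThan:
  fixes M N :: "real measure"
  assumes sets: "sets M = sets borel" "sets N = sets borel"
    and eq: "\<And>r. emeasure M {..<r} = emeasure N {..<r}" and fin: "\<And>r. emeasure M {..<r} \<noteq> \<infinity>"
  shows "M = N"
proof (rule measure_eqI_generator_eq[where E="range lessThan" and \<Omega>=UNIV and A="\<lambda>i. {..<real i}"])
  have "{..<a} \<inter> {..<b} = {..<min a b}" for a b :: real by auto
  thus "Int_stable (range (lessThan :: real \<Rightarrow> _))"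
    by (auto simp: Int_stable_def)
  show "(\<Union>i. {..<real i}) = UNIV" using reals_Archimedean2 by auto
qed (use assms in \<open>auto simp: sets_borel_lessThan\<close>)

text \<open>For a fixed set B of directions, homogeneity determines the measure of {A in B, N < r}
  for all r from its value at r = 1. The law of N restricted to A in B is thus a multiple of the
  power law, and this multiple, as a function of B, is the direction factor.\<close>

lemma polar_decomposition:
  assumes N[measurable]: "N \<in> borel_measurable M" and A[measurable]: "A \<in> measurable M Y" and \<theta>: "0 < \<theta>"
    and hom: "\<And>B r. B \<in> sets Y \<Longrightarrow> 0 < r \<Longrightarrow> emeasure M {\<omega>\<in>space M. A \<omega> \<in> B \<and> N \<omega> < r}
      = ennreal (r powr \<theta>) * emeasure M {\<omega>\<in>space M. A \<omega> \<in> B \<and> N \<omega> < 1}"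
    and pos: "AE \<omega> in M. 0 < N \<omega>"
    and fin: "emeasure M {\<omega>\<in>space M. N \<omega> < 1} \<noteq> \<infinity>"
  shows "distr M (Y \<Otimes>\<^sub>M borel) (\<lambda>\<omega>. (A \<omega>, N \<omega>)) =
    distr (density M (\<lambda>\<omega>. ennreal (exp (- N \<omega>)))) Y A \<Otimes>\<^sub>M lambda_measure \<theta>"
proof -
  have lam: "lambda_measure \<theta> = power_law \<theta>" using \<theta> by (simp add: power_law_def)
  have G: "Gamma (\<theta> + 1) > 0" using \<theta> by (intro Gamma_real_pos) simp
  \<comment> \<open>The power law gives the ray below 1 the mass
    \<open>1 / Gamma (\<theta> + 1)\<close>; the factor here compensates for it.\<close>
  define m where "m = scale_measure (ennreal (Gamma (\<theta> + 1)))
    (distr (density M (indicator {\<omega>\<in>space M. N \<omega> < 1})) Y A)"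
  have sets_m[measurable_cong, simp]: "sets m = sets Y" by (simp add: m_def)
  have m: "emeasure m B = ennreal (Gamma (\<theta> + 1)) * emeasure M {\<omega>\<in>space M. A \<omega> \<in> B \<and> N \<omega> < 1}"
    if B[measurable]: "B \<in> sets Y" for B
  proof -
    have "emeasure (density M (indicator {\<omega>\<in>space M. N \<omega> < 1})) (A -` B \<inter> space M)
       = emeasure M {\<omega>\<in>space M. A \<omega> \<in> B \<and> N \<omega> < 1}"
      by (subst emeasure_density)
        (auto simp flip: nn_integral_indicator intro!: nn_integral_cong simp: indicator_def)
    thus ?thesis by (simp add: m_def emeasure_distr)
  qed
  have finB: "emeasure M {\<omega>\<in>space M. A \<omega> \<in> B \<and> N \<omega> < 1} \<noteq> \<infinity>" for B
  proof -
    have "emeasure M {\<omega>\<in>space M. A \<omega> \<in> B \<and> N \<omega> < 1} \<le> emeasure M {\<omega>\<in>space M. N \<omega> < 1}"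
      by (rule emeasure_mono) auto
    thus ?thesis using fin by (auto simp: top_unique)
  qed
  have "finite_measure m"
  proof
    show "emeasure m (space m) \<noteq> \<infinity>"
      using m[OF sets.top] finB[of "space Y"] sets_eq_imp_space_eq[OF sets_m]
      by (simp add: ennreal_mult_eq_top_iff)
  qed
  then interpret m: finite_measure m .
  interpret pl: sigma_finite_measure "power_law \<theta>" by (rule sigma_finite_power_law)
  have prod: "m \<Otimes>\<^sub>M power_law \<theta> = distr M (Y \<Otimes>\<^sub>M borel) (\<lambda>\<omega>. (A \<omega>, N \<omega>))"
  proof (rule pair_measure_eqI[OF m.sigma_finite_measure_axioms pl.sigma_finite_measure_axioms])
    show "sets (m \<Otimes>\<^sub>M power_law \<theta>) = sets (distr M (Y \<Otimes>\<^sub>M borel) (\<lambda>\<omega>. (A \<omega>, N \<omega>)))"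
      by (simp cong: sets_pair_measure_cong)
    fix B C assume "B \<in> sets m" "C \<in> sets (power_law \<theta>)"
    hence B[measurable]: "B \<in> sets Y" and C[measurable]: "C \<in> sets borel" by auto
    let ?D = "distr (density M (\<lambda>\<omega>. indicator B (A \<omega>))) borel N"
    have D: "emeasure ?D C' = emeasure M {\<omega>\<in>space M. A \<omega> \<in> B \<and> N \<omega> \<in> C'}"
      if [measurable]: "C' \<in> sets borel" for C'
    proof -
      have "emeasure (density M (\<lambda>\<omega>. indicator B (A \<omega>))) (N -` C' \<inter> space M)
         = emeasure M {\<omega>\<in>space M. A \<omega> \<in> B \<and> N \<omega> \<in> C'}"
        by (subst emeasure_density)
          (auto simp flip: nn_integral_indicator intro!: nn_integral_cong simp: indicator_def)
      thus ?thesis by (simp add: emeasure_distr)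
    qed
    have "scale_measure (emeasure m B) (power_law \<theta>) = ?D"
    proof (rule borel_eqI_lessThan)
      fix r :: real
      have "emeasure m B * emeasure (power_law \<theta>) {..<r} = emeasure M {\<omega>\<in>space M. A \<omega> \<in> B \<and> N \<omega> \<in> {..<r}}"
      proof (cases "r \<le> 0")
        case True
        have "emeasure M {\<omega>\<in>space M. A \<omega> \<in> B \<and> N \<omega> \<in> {..<r}} = emeasure M {}"
          using pos True by (intro emeasure_eq_AE) auto
        thus ?thesis using True \<theta> by (simp add: emeasure_power_law_lessThan)
      next
        case False
        have "emeasure m B * emeasure (power_law \<theta>) {..<r} = ennreal (Gamma (\<theta> + 1)) * ennreal (r powr \<theta> / Gamma (\<theta> + 1))
            * emeasure M {\<omega>\<in>space M. A \<omega> \<in> B \<and> N \<omega> < 1}"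
          using False \<theta> m[OF B] by (simp add: emeasure_power_law_lessThan ac_simps)
        also have "ennreal (Gamma (\<theta> + 1)) * ennreal (r powr \<theta> / Gamma (\<theta> + 1)) = ennreal (r powr \<theta>)"
          using G by (simp flip: ennreal_mult)
        finally show ?thesis using hom[OF B, of r] False by simp
      qed
      thus "emeasure (scale_measure (emeasure m B) (power_law \<theta>)) {..<r} = emeasure ?D {..<r}"
        by (simp add: D)
      show "emeasure (scale_measure (emeasure m B) (power_law \<theta>)) {..<r} \<noteq> \<infinity>"
        using \<theta> by (simp add: emeasure_power_law_lessThan ennreal_mult_eq_top_iff)
    qed auto
    hence "emeasure (scale_measure (emeasure m B) (power_law \<theta>)) C = emeasure ?D C" by simp
    hence "emeasure m B * emeasure (power_law \<theta>) C = emeasure M {\<omega>\<in>space M. A \<omega> \<in> B \<and> N \<omega> \<in> C}"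
      by (simp add: D)
    also have "{\<omega>\<in>space M. A \<omega> \<in> B \<and> N \<omega> \<in> C} = (\<lambda>\<omega>. (A \<omega>, N \<omega>)) -` (B \<times> C) \<inter> space M" by auto
    finally show "emeasure m B * emeasure (power_law \<theta>) C = emeasure (distr M (Y \<Otimes>\<^sub>M borel) (\<lambda>\<omega>. (A \<omega>, N \<omega>))) (B \<times> C)"
      by (simp add: emeasure_distr)
  qed
  \<comment> \<open>The weight \<open>exp (- t)\<close> has integral 1 under the power law, so by
    the product formula weighting leaves exactly m as the law of the direction.\<close>
  have "distr (density M (\<lambda>\<omega>. ennreal (exp (- N \<omega>)))) Y A = m"
  proof (rule measure_eqI)
    fix B assume "B \<in> sets (distr (density M (\<lambda>\<omega>. ennreal (exp (- N \<omega>)))) Y A)"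
    hence B[measurable]: "B \<in> sets Y" by simp
    have "emeasure (distr (density M (\<lambda>\<omega>. ennreal (exp (- N \<omega>)))) Y A) B
       = (\<integral>\<^sup>+\<omega>. ennreal (exp (- N \<omega>)) * indicator (A -` B \<inter> space M) \<omega> \<partial>M)"
      by (simp add: emeasure_distr emeasure_density)
    also have "\<dots> = (\<integral>\<^sup>+\<omega>. indicator B (A \<omega>) * ennreal (exp (- N \<omega>)) \<partial>M)"
      by (intro nn_integral_cong) (auto simp: indicator_def)
    also have "\<dots> = (\<integral>\<^sup>+z. indicator B (fst z) * ennreal (exp (- snd z)) \<partial>(distr M (Y \<Otimes>\<^sub>M borel) (\<lambda>\<omega>. (A \<omega>, N \<omega>))))"
      by (subst nn_integral_distr) simp_all
    also have "\<dots> = (\<integral>\<^sup>+y. \<integral>\<^sup>+t. indicator B y * ennreal (exp (- t)) \<partial>power_law \<theta> \<partial>m)"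
      unfolding prod[symmetric] by (subst pl.nn_integral_fst[symmetric]) simp_all
    also have "\<dots> = (\<integral>\<^sup>+y. indicator B y \<partial>m)"
      using \<theta> by (simp add: nn_integral_cmult nn_integral_exp_power_law)
    finally show "emeasure (distr (density M (\<lambda>\<omega>. ennreal (exp (- N \<omega>)))) Y A) B = emeasure m B" by simp
  qed simp
  thus ?thesis using prod lam by simp
qed

section \<open>Invariant measures on the orthant\<close>

abbreviation real_vectors :: "'i set \<Rightarrow> ('i \<Rightarrow> real) measure" where
  "real_vectors I \<equiv> Pi\<^sub>M I (\<lambda>_. borel)"

definition lower_box :: "'i set \<Rightarrow> ('i \<Rightarrow> real) \<Rightarrow> ('i \<Rightarrow> real) set" where
  "lower_box I r = {x \<in> extensional I. \<forall>i\<in>I. x i < r i}"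

lemma space_real_vectors: "space (real_vectors I) = extensional I"
  by (auto simp: space_PiM PiE_def)

lemma lower_box_PiE: "lower_box I r = Pi\<^sub>E I (\<lambda>i. {..<r i})"
  by (auto simp: lower_box_def PiE_def)

lemma lower_box_sets: "finite I \<Longrightarrow> lower_box I r \<in> sets (real_vectors I)"
  unfolding lower_box_PiE by (intro sets_PiM_I_finite) auto

lemma sets_real_vectors_lower_box:
  assumes "finite I"
  shows "sets (real_vectors I) = sigma_sets (extensional I) (range (lower_box I))"
proof -
  have cover: "\<exists>S\<subseteq>range lessThan. countable S \<and> (UNIV :: real set) = \<Union>S"
    by (rule exI[of _ "range (\<lambda>n. {..<real n})"]) (use reals_Archimedean2 in auto)
  have "sets (real_vectors I) = sets (\<Pi>\<^sub>M i\<in>I. sigma UNIV (range (lessThan :: real \<Rightarrow> _)))"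
    by (intro sets_PiM_cong refl) (simp only: borel_Iio)
  also have "\<dots> = sets (sigma (\<Pi>\<^sub>E i\<in>I. UNIV) {{f\<in>(\<Pi>\<^sub>E i\<in>I. UNIV). \<forall>i\<in>j. f i \<in> A i} | A j.
      j \<in> {I} \<and> A \<in> Pi j (\<lambda>_. range (lessThan :: real \<Rightarrow> _))})"
    using cover assms by (intro sets_PiM_sigma) auto
  also have "{{f\<in>(\<Pi>\<^sub>E i\<in>I. UNIV). \<forall>i\<in>j. f i \<in> A i} | A j.
      j \<in> {I} \<and> A \<in> Pi j (\<lambda>_. range (lessThan :: real \<Rightarrow> _))} = range (lower_box I)"
  proof (intro subset_antisym subsetI)
    fix X assume "X \<in> {{f\<in>(\<Pi>\<^sub>E i\<in>I. UNIV). \<forall>i\<in>j. f i \<in> A i} | A j.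
      j \<in> {I} \<and> A \<in> Pi j (\<lambda>_. range (lessThan :: real \<Rightarrow> _))}"
    then obtain A where X: "X = {f\<in>(\<Pi>\<^sub>E i\<in>I. UNIV). \<forall>i\<in>I. f i \<in> A i}"
      and "A \<in> Pi I (\<lambda>_. range (lessThan :: real \<Rightarrow> _))" by auto
    hence A: "\<forall>i\<in>I. \<exists>r::real. A i = {..<r}" unfolding Pi_def by blast
    obtain r where r: "\<forall>i\<in>I. A i = {..<r i :: real}" using bchoice[OF A] by blast
    have "X = lower_box I r" unfolding X lower_box_def using r by (auto simp: PiE_def)
    thus "X \<in> range (lower_box I)" by blast
  next
    fix X assume "X \<in> range (lower_box I)"
    then obtain r where X: "X = lower_box I r" by blast
    show "X \<in> {{f\<in>(\<Pi>\<^sub>E i\<in>I. UNIV). \<forall>i\<in>j. f i \<in> A i} | A j.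
      j \<in> {I} \<and> A \<in> Pi j (\<lambda>_. range (lessThan :: real \<Rightarrow> _))}"
      by (rule CollectI, rule exI[of _ "\<lambda>i. {..<r i}"], rule exI[of _ I])
        (auto simp: X lower_box_def PiE_def)
  qed
  also have "(\<Pi>\<^sub>E i\<in>I. UNIV) = extensional I" by (auto simp: PiE_def)
  also have "sets (sigma (extensional I) (range (lower_box I))) = sigma_sets (extensional I) (range (lower_box I))"
    by (rule sets_measure_of) (auto simp: lower_box_def)
  finally show ?thesis .
qed

lemma real_vectors_eqI:
  fixes M N :: "('i \<Rightarrow> real) measure"
  assumes I: "finite I" and sets: "sets M = sets (real_vectors I)" "sets N = sets (real_vectors I)"
    and eq: "\<And>r. emeasure M (lower_box I r) = emeasure N (lower_box I r)"
    and fin: "\<And>r. emeasure M (lower_box I r) \<noteq> \<infinity>"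
  shows "M = N"
proof (rule measure_eqI_generator_eq[where E="range (lower_box I)" and \<Omega>="extensional I"
      and A="\<lambda>n. lower_box I (\<lambda>_. real n)"])
  have "lower_box I r \<inter> lower_box I s = lower_box I (\<lambda>i. min (r i) (s i))" for r s
    by (auto simp: lower_box_def)
  thus "Int_stable (range (lower_box I))" by (auto simp: Int_stable_def)
  show "(\<Union>n. lower_box I (\<lambda>_. real n)) = extensional I"
  proof (intro subset_antisym subsetI)
    fix x :: "'i \<Rightarrow> real" assume x: "x \<in> extensional I"
    obtain n where "Max (insert 0 (x ` I)) < real n" using reals_Archimedean2 by blast
    hence "x \<in> lower_box I (\<lambda>_. real n)" using x I by (auto simp: lower_box_def)
    thus "x \<in> (\<Union>n. lower_box I (\<lambda>_. real n))" by blast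
  qed (auto simp: lower_box_def)
qed (use assms sets_real_vectors_lower_box[OF I] in \<open>auto simp: lower_box_def\<close>)

section \<open>Monotone solutions of Cauchy's functional equations\<close>

lemma mono_additive_imp_linear:
  fixes h :: "real \<Rightarrow> real"
  assumes add: "\<And>x y. h (x + y) = h x + h y" and mono: "\<And>x y. x \<le> y \<Longrightarrow> h x \<le> h y"
  shows "h x = x * h 1"
proof -
  have h0: "h 0 = 0" using add[of 0 0] by simp
  have hminus: "h (- y) = - h y" for y using add[of y "- y"] h0 by simp
  have hnat: "h (real n * y) = real n * h y" for n y
    by (induct n) (simp_all add: h0 add algebra_simps)
  have hint: "h (of_int k) = of_int k * h 1" for k
  proof (cases "k \<ge> 0")
    case True
    thus ?thesis using hnat[of "nat k" 1] by simp
  next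
    case False
    thus ?thesis using hnat[of "nat (- k)" 1] hminus[of "of_int (- k)"] by simp
  qed
  have h1: "0 \<le> h 1" using mono[of 0 1] h0 by simp
  \<comment> \<open>With k the floor of n * x, both n * h x and n * x * h 1 lie between k * h 1 and
    (k + 1) * h 1. Their distance stays below h 1 for every n, which forces equality after division
    by n.\<close>
  have bound: "real n * \<bar>h x - x * h 1\<bar> \<le> h 1" for n
  proof -
    let ?k = "\<lfloor>real n * x\<rfloor>"
    have "of_int ?k * h 1 \<le> real n * h x" 
      using mono[of "of_int ?k" "real n * x"] hint[of ?k] hnat[of n x] by simp
    moreover have "real n * h x \<le> (of_int ?k + 1) * h 1"
      using mono[of "real n * x" "of_int (?k + 1)"] hint[of "?k + 1"] hnat[of n x]
        floor_correct[of "real n * x"] by (simp add: less_imp_le)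
    moreover have "of_int ?k * h 1 \<le> real n * x * h 1" using h1 by (intro mult_right_mono) auto
    moreover have "real n * x * h 1 \<le> (of_int ?k + 1) * h 1"
      using h1 floor_correct[of "real n * x"] by (intro mult_right_mono) auto
    ultimately have "\<bar>real n * h x - real n * x * h 1\<bar> \<le> h 1" by (simp add: algebra_simps abs_le_iff)
    moreover have "\<bar>real n * h x - real n * x * h 1\<bar> = real n * \<bar>h x - x * h 1\<bar>"
    proof -
      have "real n * h x - real n * x * h 1 = real n * (h x - x * h 1)" by (simp add: algebra_simps)
      thus ?thesis by (simp add: abs_mult)
    qed
    ultimately show ?thesis by simp
  qed
  have "\<bar>h x - x * h 1\<bar> \<le> 0"
  proof (rule ccontr)
    assume "\<not> \<bar>h x - x * h 1\<bar> \<le> 0"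
    then obtain n where "h 1 / \<bar>h x - x * h 1\<bar> < real n" using reals_Archimedean2 by blast
    hence "h 1 < real n * \<bar>h x - x * h 1\<bar>"
      using \<open>\<not> \<bar>h x - x * h 1\<bar> \<le> 0\<close> by (simp add: field_simps)
    thus False using bound[of n] by simp
  qed
  thus ?thesis by simp
qed

text \<open>In logarithmic coordinates the equation becomes additive; the exponent is the logarithm
  of g at e.\<close>

lemma mono_multiplicative_imp_powr:
  fixes g :: "real \<Rightarrow> real"
  assumes pos: "\<And>x. 0 < x \<Longrightarrow> 0 < g x"
    and mult: "\<And>x y. 0 < x \<Longrightarrow> 0 < y \<Longrightarrow> g (x * y) = g x * g y"
    and mono: "\<And>x y. 0 < x \<Longrightarrow> x \<le> y \<Longrightarrow> g x \<le> g y"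
  obtains a where "0 \<le> a" "\<And>x. 0 < x \<Longrightarrow> g x = x powr a"
proof
  define h where "h t = ln (g (exp t))" for t
  have lin: "h t = t * h 1" for t
  proof (rule mono_additive_imp_linear)
    show "h (s + t) = h s + h t" for s t
      using pos[of "exp s"] pos[of "exp t"] by (simp add: h_def exp_add mult ln_mult)
    show "h s \<le> h t" if "s \<le> t" for s t
      using that pos[of "exp s"] mono[of "exp s" "exp t"] by (simp add: h_def)
  qed
  have "g 1 = 1" using mult[of 1 1] pos[of 1] by simp
  moreover have "g 1 \<le> g (exp 1)" by (rule mono) auto
  ultimately show "0 \<le> h 1" by (simp add: h_def)
  fix x :: real assume x: "0 < x"
  have "ln (g x) = ln x * h 1" using lin[of "ln x"] x by (simp add: h_def)
  hence "exp (ln (g x)) = exp (h 1 * ln x)" by (simp add: mult.commute)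
  thus "g x = x powr h 1" using x pos[OF x] by (simp add: powr_def)
qed

text \<open>A vector is the product of the vectors \<open>u i (r i)\<close>, which differ from 1
  only at coordinate i. The one-variable result applies along each of these axes.\<close>

lemma mono_multiplicative_imp_prod_powr:
  fixes F :: "('i \<Rightarrow> real) \<Rightarrow> real"
  assumes I: "finite I" and pos: "\<And>r. (\<And>i. i \<in> I \<Longrightarrow> 0 < r i) \<Longrightarrow> 0 < F r"
    and mult: "\<And>r s. (\<And>i. i \<in> I \<Longrightarrow> 0 < r i) \<Longrightarrow> (\<And>i. i \<in> I \<Longrightarrow> 0 < s i) \<Longrightarrow>
      F (\<lambda>i. r i * s i) = F r * F s"
    and mono: "\<And>r s. (\<And>i. i \<in> I \<Longrightarrow> 0 < r i) \<Longrightarrow> (\<And>i. i \<in> I \<Longrightarrow> r i \<le> s i) \<Longrightarrow> F r \<le> F s"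
  obtains a where "\<And>i. 0 \<le> a i" "\<And>r. (\<And>i. i \<in> I \<Longrightarrow> 0 < r i) \<Longrightarrow> F r = (\<Prod>i\<in>I. r i powr a i)"
proof -
  define u :: "'i \<Rightarrow> real \<Rightarrow> 'i \<Rightarrow> real" where "u i x = (\<lambda>_. 1)(i := x)" for i x
  have u_pos: "0 < u i x j" if "0 < x" for i x j using that by (simp add: u_def)
  have "\<exists>a\<ge>0. \<forall>x>0. F (u i x) = x powr a" for i
  proof -
    have "F (u i (x * y)) = F (u i x) * F (u i y)" if "0 < x" "0 < y" for x y
    proof -
      have "u i (x * y) = (\<lambda>j. u i x j * u i y j)" by (auto simp: u_def)
      thus ?thesis using mult[of "u i x" "u i y"] that by (simp add: u_pos)
    qed
    moreover have "0 < F (u i x)" if "0 < x" for x using that by (intro pos u_pos)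
    moreover have "F (u i x) \<le> F (u i y)" if "0 < x" "x \<le> y" for x y
      using that by (intro mono u_pos) (auto simp: u_def)
    ultimately obtain a where "0 \<le> a" "\<And>x. 0 < x \<Longrightarrow> F (u i x) = x powr a"
      using mono_multiplicative_imp_powr[of "\<lambda>x. F (u i x)"] by metis
    thus ?thesis by blast
  qed
  then obtain a where a: "\<And>i. 0 \<le> a i" "\<And>i x. 0 < x \<Longrightarrow> F (u i x) = x powr a i" by metis
  have F1: "F (\<lambda>_. 1) = 1" using mult[of "\<lambda>_. 1" "\<lambda>_. 1"] pos[of "\<lambda>_. 1"] by simp
  have "F r = (\<Prod>i\<in>I. r i powr a i)" if r: "\<And>i. i \<in> I \<Longrightarrow> 0 < r i" for r
  proof -
    have "F (\<lambda>i. if i \<in> J then r i else 1) = (\<Prod>i\<in>J. r i powr a i)" if "J \<subseteq> I" for J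
      using finite_subset[OF that I] that
    proof (induct J rule: finite_induct)
      case empty thus ?case using F1 by simp
    next
      case (insert j J)
      have eq: "(\<lambda>i. if i \<in> insert j J then r i else 1) = (\<lambda>i. u j (r j) i * (if i \<in> J then r i else 1))"
        using insert by (auto simp: u_def)
      have "F (\<lambda>i. if i \<in> insert j J then r i else 1) = F (u j (r j)) * F (\<lambda>i. if i \<in> J then r i else 1)"
        unfolding eq using insert r by (intro mult) (auto simp: u_pos)
      thus ?case using insert r a(2)[of "r j" j] by simp
    qed
    from this[of I] have "F (\<lambda>i. if i \<in> I then r i else 1) = (\<Prod>i\<in>I. r i powr a i)" by simp
    \<comment> \<open>Monotonicity inspects only coordinates in I. Used in both directions, it shows
      that the values of r outside I do not matter.\<close>
    moreover have "F r = F (\<lambda>i. if i \<in> I then r i else 1)"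
      using r by (intro antisym mono) auto
    ultimately show ?thesis by simp
  qed
  with a(1) show thesis by (rule that)
qed

section \<open>Products of power laws\<close>

lemma product_sigma_finite_power_law: "product_sigma_finite (\<lambda>i. power_law (a i))"
  by (simp add: product_sigma_finite_def sigma_finite_power_law)

lemma sets_PiM_power_law [measurable_cong, simp]:
  "sets (Pi\<^sub>M I (\<lambda>i. power_law (a i))) = sets (real_vectors I)"
  by (intro sets_PiM_cong) auto

lemma space_PiM_power_law [simp]: "space (Pi\<^sub>M I (\<lambda>i. power_law (a i))) = extensional I"
  by (auto simp: space_PiM PiE_def)

text \<open>The exceptional set lies in a cylinder whose measure is a product with one factor 0. The
  other factors may be infinite, but 0 times infinity is 0 in \<open>ennreal\<close>.\<close>

lemma AE_PiM_component_sigma_finite: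
  assumes "product_sigma_finite M" "finite I" "j \<in> I" "AE x in M j. P x"
  shows "AE x in Pi\<^sub>M I M. P (x j)"
proof -
  interpret product_sigma_finite M by fact
  obtain N where N: "{x \<in> space (M j). \<not> P x} \<subseteq> N" "emeasure (M j) N = 0" "N \<in> sets (M j)"
    using AE_E[OF assms(4)] by blast
  let ?A = "\<lambda>i. if i = j then N else space (M i)"
  have "emeasure (Pi\<^sub>M I M) (Pi\<^sub>E I ?A) = (\<Prod>i\<in>I. emeasure (M i) (?A i))"
    using N assms(2) by (intro emeasure_PiM) auto
  also have "\<dots> = 0" using assms(2,3) N(2) by (auto intro!: bexI[of _ j])
  finally have "Pi\<^sub>E I ?A \<in> null_sets (Pi\<^sub>M I M)"
    using N assms(2) by (intro null_setsI sets_PiM_I_finite) auto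
  moreover have "{x \<in> space (Pi\<^sub>M I M). \<not> P (x j)} \<subseteq> Pi\<^sub>E I ?A"
    using N(1) assms(3) by (auto simp: space_PiM PiE_def Pi_def)
  ultimately show ?thesis by (rule AE_I')
qed

lemma emeasure_PiM_power_law_lower_box:
  assumes "finite I" "\<And>i. 0 \<le> a i"
  shows "emeasure (Pi\<^sub>M I (\<lambda>i. power_law (a i))) (lower_box I r) =
    (if \<forall>i\<in>I. 0 < r i then ennreal (\<Prod>i\<in>I. r i powr a i / Gamma (a i + 1)) else 0)"
proof -
  interpret product_sigma_finite "\<lambda>i. power_law (a i)" by (rule product_sigma_finite_power_law)
  have G: "0 < Gamma (a i + 1)" for i using assms(2)[of i] by (intro Gamma_real_pos) simp
  have "emeasure (Pi\<^sub>M I (\<lambda>i. power_law (a i))) (lower_box I r) = (\<Prod>i\<in>I. emeasure (power_law (a i)) {..<r i})"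
    unfolding lower_box_PiE using assms by (intro emeasure_PiM) auto
  also have "\<dots> = (\<Prod>i\<in>I. if r i \<le> 0 then 0 else ennreal (r i powr a i / Gamma (a i + 1)))"
    using assms(2) by (intro prod.cong refl) (rule emeasure_power_law_lessThan)
  also have "\<dots> = (if \<forall>i\<in>I. 0 < r i then ennreal (\<Prod>i\<in>I. r i powr a i / Gamma (a i + 1)) else 0)"
  proof (cases "\<forall>i\<in>I. 0 < r i")
    case True
    hence "(\<Prod>i\<in>I. if r i \<le> 0 then 0 else ennreal (r i powr a i / Gamma (a i + 1)))
       = (\<Prod>i\<in>I. ennreal (r i powr a i / Gamma (a i + 1)))" by (intro prod.cong) auto
    also have "\<dots> = ennreal (\<Prod>i\<in>I. r i powr a i / Gamma (a i + 1))"
      using G by (intro prod_ennreal) (simp add: less_imp_le)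
    finally show ?thesis using True by simp
  next
    case False
    then obtain i where "i \<in> I" "r i \<le> 0" by fastforce
    hence "(\<Prod>i\<in>I. if r i \<le> 0 then 0 else ennreal (r i powr a i / Gamma (a i + 1))) = 0"
      using assms(1) by (intro prod_zero) auto
    thus ?thesis by (simp only: False if_False)
  qed
  finally show ?thesis .
qed

lemma ennreal_exp_minus_sum:
  "finite I \<Longrightarrow> ennreal (exp (- (\<Sum>i\<in>I. x i))) = (\<Prod>i\<in>I. ennreal (exp (- x i)))"
  by (simp add: prod_ennreal exp_sum sum_negf[symmetric])

lemma nn_integral_exp_PiM_power_law:
  assumes "finite I" "\<And>i. 0 \<le> a i"
  shows "(\<integral>\<^sup>+x. ennreal (exp (- (\<Sum>i\<in>I. x i))) \<partial>Pi\<^sub>M I (\<lambda>i. power_law (a i))) = 1"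
proof -
  interpret product_sigma_finite "\<lambda>i. power_law (a i)" by (rule product_sigma_finite_power_law)
  have "(\<integral>\<^sup>+x. ennreal (exp (- (\<Sum>i\<in>I. x i))) \<partial>Pi\<^sub>M I (\<lambda>i. power_law (a i)))
     = (\<Prod>i\<in>I. \<integral>\<^sup>+t. ennreal (exp (- t)) \<partial>power_law (a i))"
    using assms(1) by (simp only: ennreal_exp_minus_sum) (intro product_nn_integral_prod, auto)
  thus ?thesis using assms by (simp add: nn_integral_exp_power_law)
qed

text \<open>The weight factorises over the coordinates: coordinate j contributes its weighted mean
  and every other one contributes 1. This is how exponents are recovered from a law that is known to
  be such a product.\<close>

lemma nn_integral_coordinate_PiM_power_law:
  assumes "finite I" "\<And>i. 0 \<le> a i" "j \<in> I"
  shows "(\<integral>\<^sup>+x. ennreal (x j) * ennreal (exp (- (\<Sum>i\<in>I. x i))) \<partial>Pi\<^sub>M I (\<lambda>i. power_law (a i))) = ennreal (a j)"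
proof -
  interpret product_sigma_finite "\<lambda>i. power_law (a i)" by (rule product_sigma_finite_power_law)
  have 1: "ennreal (x j) * ennreal (exp (- (\<Sum>i\<in>I. x i)))
     = (\<Prod>i\<in>I. (if i = j then ennreal (x i) else 1) * ennreal (exp (- x i)))" for x
    using assms(1,3) by (simp add: ennreal_exp_minus_sum prod.distrib)
  have "(\<integral>\<^sup>+x. ennreal (x j) * ennreal (exp (- (\<Sum>i\<in>I. x i))) \<partial>Pi\<^sub>M I (\<lambda>i. power_law (a i)))
     = (\<Prod>i\<in>I. \<integral>\<^sup>+t. (if i = j then ennreal t else 1) * ennreal (exp (- t)) \<partial>power_law (a i))"
    unfolding 1 using assms(1) by (intro product_nn_integral_prod) auto
  also have "\<dots> = (\<Prod>i\<in>I. if i = j then ennreal (a j) else 1)"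
    using assms(2) by (intro prod.cong) (auto simp: nn_integral_exp_power_law nn_integral_id_exp_power_law)
  also have "\<dots> = ennreal (a j)" using assms(1,3) by simp
  finally show ?thesis .
qed

lemma density_PiM_power_law:
  assumes "finite I" "\<And>i. 0 \<le> a i"
  shows "density (Pi\<^sub>M I (\<lambda>i. power_law (a i))) (\<lambda>x. ennreal (exp (- (\<Sum>i\<in>I. x i))))
    = Pi\<^sub>M I (\<lambda>i. gamma_law (a i))"
proof -
  interpret product_sigma_finite "\<lambda>i. power_law (a i)" by (rule product_sigma_finite_power_law)
  have "sigma_finite_measure (gamma_law (a i))" for i
  proof -
    have "emeasure (gamma_law (a i)) UNIV = (\<integral>\<^sup>+t. ennreal (exp (- t)) \<partial>power_law (a i))"
      by (simp add: density_power_law[OF assms(2), symmetric] emeasure_density)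
    hence "emeasure (gamma_law (a i)) (space (gamma_law (a i))) = 1"
      using assms(2) sets_eq_imp_space_eq[OF sets_gamma_law[of "a i"]] by (simp add: nn_integral_exp_power_law)
    then interpret prob_space "gamma_law (a i)" by (rule prob_spaceI)
    show ?thesis by (rule sigma_finite_measure_axioms)
  qed
  then interpret G: product_sigma_finite "\<lambda>i. gamma_law (a i)" by (simp add: product_sigma_finite_def)
  show ?thesis
  proof (rule G.PiM_eqI[OF assms(1)])
    show "sets (density (Pi\<^sub>M I (\<lambda>i. power_law (a i))) (\<lambda>x. ennreal (exp (- (\<Sum>i\<in>I. x i))))) =
      sets (Pi\<^sub>M I (\<lambda>i. gamma_law (a i)))"
      by (simp cong: sets_PiM_cong)
    fix A assume A: "\<And>i. i \<in> I \<Longrightarrow> A i \<in> sets (gamma_law (a i))"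
    hence A': "\<And>i. i \<in> I \<Longrightarrow> A i \<in> sets borel" by simp
    have s: "Pi\<^sub>E I A \<in> sets (real_vectors I)" using A' assms(1) by (intro sets_PiM_I_finite) auto
    have "emeasure (density (Pi\<^sub>M I (\<lambda>i. power_law (a i))) (\<lambda>x. ennreal (exp (- (\<Sum>i\<in>I. x i))))) (Pi\<^sub>E I A)
      = (\<integral>\<^sup>+x. ennreal (exp (- (\<Sum>i\<in>I. x i))) * indicator (Pi\<^sub>E I A) x \<partial>Pi\<^sub>M I (\<lambda>i. power_law (a i)))"
      using s by (intro emeasure_density) auto
    also have "\<dots> = (\<integral>\<^sup>+x. (\<Prod>i\<in>I. ennreal (exp (- x i)) * indicator (A i) (x i)) \<partial>Pi\<^sub>M I (\<lambda>i. power_law (a i)))"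
    proof (rule nn_integral_cong)
      fix x assume "x \<in> space (Pi\<^sub>M I (\<lambda>i. power_law (a i)))"
      hence "indicator (Pi\<^sub>E I A) x = (\<Prod>i\<in>I. indicator (A i) (x i) :: ennreal)"
        using assms(1) by (auto simp: indicator_def PiE_def prod_zero_iff Pi_def)
      thus "ennreal (exp (- (\<Sum>i\<in>I. x i))) * indicator (Pi\<^sub>E I A) x
        = (\<Prod>i\<in>I. ennreal (exp (- x i)) * indicator (A i) (x i))"
        using assms(1) by (simp add: ennreal_exp_minus_sum prod.distrib)
    qed
    also have "\<dots> = (\<Prod>i\<in>I. \<integral>\<^sup>+t. ennreal (exp (- t)) * indicator (A i) t \<partial>power_law (a i))"
      using assms(1) A' by (intro product_nn_integral_prod borel_measurable_times_ennreal borel_measurable_indicator) auto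
    also have "\<dots> = (\<Prod>i\<in>I. emeasure (gamma_law (a i)) (A i))"
      using A' assms(2) by (intro prod.cong refl)
        (simp add: density_power_law[symmetric] emeasure_density)
    finally show "emeasure (density (Pi\<^sub>M I (\<lambda>i. power_law (a i))) (\<lambda>x. ennreal (exp (- (\<Sum>i\<in>I. x i))))) (Pi\<^sub>E I A)
      = (\<Prod>i\<in>I. emeasure (gamma_law (a i)) (A i))" .
  qed
qed

text \<open>This is the effect on the vector of cell masses of a multiplier that is constant on the
  cells of a partition.\<close>

definition rescale :: "'i set \<Rightarrow> ('i \<Rightarrow> real) \<Rightarrow> ('i \<Rightarrow> real) \<Rightarrow> 'i \<Rightarrow> real" where
  "rescale I c x = (\<lambda>i\<in>I. c i * x i)"

lemma rescale_measurable [measurable]: "rescale I c \<in> measurable (real_vectors I) (real_vectors I)"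
  unfolding rescale_def[abs_def] by measurable

lemma rescale_vimage_lower_box:
  assumes "\<And>i. i \<in> I \<Longrightarrow> 0 < c i"
  shows "rescale I c -` lower_box I r \<inter> extensional I = lower_box I (\<lambda>i. r i / c i)"
  using assms by (auto simp: rescale_def lower_box_def field_simps)

text \<open>Scaling by c pulls the box with corner r back to the box with corner r / c, and the box
  function is a product of powers. This product of powers of c is the source of the invariance
  constant of step multipliers.\<close>

lemma distr_rescale_PiM_power_law:
  assumes I: "finite I" and a: "\<And>i. 0 \<le> a i" and c: "\<And>i. i \<in> I \<Longrightarrow> 0 < c i"
  shows "distr (Pi\<^sub>M I (\<lambda>i. power_law (a i))) (real_vectors I) (rescale I c)
    = scale_measure (ennreal (\<Prod>i\<in>I. c i powr - a i)) (Pi\<^sub>M I (\<lambda>i. power_law (a i)))"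
proof (rule real_vectors_eqI[OF I])
  fix r
  let ?P = "Pi\<^sub>M I (\<lambda>i. power_law (a i))"
  have G: "0 < Gamma (a i + 1)" for i using a[of i] by (intro Gamma_real_pos) simp
  have "emeasure (distr ?P (real_vectors I) (rescale I c)) (lower_box I r) = emeasure ?P (lower_box I (\<lambda>i. r i / c i))"
    using I by (subst emeasure_distr) (auto simp: lower_box_sets rescale_vimage_lower_box[OF c])
  also have "\<dots> = ennreal (\<Prod>i\<in>I. c i powr - a i) * emeasure ?P (lower_box I r)"
  proof (cases "\<forall>i\<in>I. 0 < r i")
    case True
    have "(\<Prod>i\<in>I. (r i / c i) powr a i / Gamma (a i + 1)) = (\<Prod>i\<in>I. c i powr - a i * (r i powr a i / Gamma (a i + 1)))"
      using True c by (intro prod.cong refl) (simp add: powr_divide powr_minus_divide less_imp_le)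
    also have "\<dots> = (\<Prod>i\<in>I. c i powr - a i) * (\<Prod>i\<in>I. r i powr a i / Gamma (a i + 1))" by (rule prod.distrib)
    finally have "ennreal (\<Prod>i\<in>I. (r i / c i) powr a i / Gamma (a i + 1)) =
        ennreal (\<Prod>i\<in>I. c i powr - a i) * ennreal (\<Prod>i\<in>I. r i powr a i / Gamma (a i + 1))"
      using G by (simp add: ennreal_mult prod_nonneg less_imp_le)
    thus ?thesis using True c by (simp add: emeasure_PiM_power_law_lower_box[OF I a])
  next
    case False
    hence "\<not> (\<forall>i\<in>I. 0 < r i / c i)" using c by (metis zero_less_divide_iff less_asym)
    thus ?thesis using False by (simp only: emeasure_PiM_power_law_lower_box[OF I a] if_False mult_zero_right)
  qed
  finally show "emeasure (distr ?P (real_vectors I) (rescale I c)) (lower_box I r)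
      = emeasure (scale_measure (ennreal (\<Prod>i\<in>I. c i powr - a i)) ?P) (lower_box I r)" by simp
  thus "emeasure (distr ?P (real_vectors I) (rescale I c)) (lower_box I r) \<noteq> \<infinity>"
    by (auto simp: emeasure_PiM_power_law_lower_box[OF I a] ennreal_mult_eq_top_iff)
qed auto

lemma normalized_measurable [measurable]:
  "(\<lambda>x. \<lambda>i\<in>I. x i / (\<Sum>j\<in>I. x j)) \<in> measurable (real_vectors I) (real_vectors I)"
  by measurable

lemma AE_PiM_power_law_nonneg:
  assumes "finite I" "\<And>i. 0 \<le> a i"
  shows "AE x in Pi\<^sub>M I (\<lambda>i. power_law (a i)). \<forall>i\<in>I. 0 \<le> x i"
  using assms by (intro AE_finite_allI AE_PiM_component_sigma_finite[OF product_sigma_finite_power_law]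
      AE_power_law_nonneg)

lemma AE_PiM_power_law_sum_pos:
  assumes "finite I" "\<And>i. 0 \<le> a i" "0 < (\<Sum>i\<in>I. a i)"
  shows "AE x in Pi\<^sub>M I (\<lambda>i. power_law (a i)). 0 < (\<Sum>i\<in>I. x i)"
proof -
  obtain j where j: "j \<in> I" "0 < a j" using assms(2,3) sum_nonpos[of I a] by (meson not_le)
  have "AE x in Pi\<^sub>M I (\<lambda>i. power_law (a i)). 0 < x j"
    using assms(1) j by (intro AE_PiM_component_sigma_finite[OF product_sigma_finite_power_law] AE_power_law_pos)
  with AE_PiM_power_law_nonneg[OF assms(1,2)] show ?thesis
    by eventually_elim (use assms(1) j in \<open>auto intro: sum_pos2\<close>)
qed

text \<open>Direction and total separate because uniform scaling by 1 / r fixes directions, divides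
  the sum by r and multiplies the measure by \<open>r powr \<theta>\<close>, where \<theta> is the
  sum of the exponents.\<close>

lemma PiM_power_law_polar:
  assumes I: "finite I" and a: "\<And>i. 0 \<le> a i" and \<theta>: "\<theta> = (\<Sum>i\<in>I. a i)" "0 < \<theta>"
  defines "A \<equiv> \<lambda>x. \<lambda>i\<in>I. x i / (\<Sum>j\<in>I. x j)"
  shows "distr (Pi\<^sub>M I (\<lambda>i. power_law (a i))) (real_vectors I \<Otimes>\<^sub>M borel) (\<lambda>x. (A x, \<Sum>i\<in>I. x i))
    = distr (Pi\<^sub>M I (\<lambda>i. gamma_law (a i))) (real_vectors I) A \<Otimes>\<^sub>M lambda_measure \<theta>"
proof -
  let ?P = "Pi\<^sub>M I (\<lambda>i. power_law (a i))" and ?N = "\<lambda>x. \<Sum>i\<in>I. x i :: real"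
  have [measurable]: "A \<in> measurable (real_vectors I) (real_vectors I)"
    unfolding A_def by (rule normalized_measurable)
  have "distr ?P (real_vectors I \<Otimes>\<^sub>M borel) (\<lambda>x. (A x, ?N x)) =
    distr (density ?P (\<lambda>x. ennreal (exp (- ?N x)))) (real_vectors I) A \<Otimes>\<^sub>M lambda_measure \<theta>"
  proof (rule polar_decomposition[OF _ _ \<theta>(2)])
    show "?N \<in> borel_measurable ?P" "A \<in> measurable ?P (real_vectors I)" by measurable
    show "AE x in ?P. 0 < ?N x" using \<theta> by (intro AE_PiM_power_law_sum_pos I a) simp
    \<comment> \<open>Where the sum is below 1, the function \<open>exp 1 * exp (- ?N x)\<close> is
      at least 1, and its integral is known.\<close>
    have "emeasure ?P {x\<in>space ?P. ?N x < 1} = (\<integral>\<^sup>+x. indicator {x\<in>space ?P. ?N x < 1} x \<partial>?P)"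
      by (rule nn_integral_indicator[symmetric]) measurable
    also have "\<dots> \<le> (\<integral>\<^sup>+x. ennreal (exp 1) * ennreal (exp (- ?N x)) \<partial>?P)"
      by (intro nn_integral_mono) (auto simp: indicator_def mult_exp_exp simp flip: ennreal_mult)
    also have "\<dots> = ennreal (exp 1) * (\<integral>\<^sup>+x. ennreal (exp (- ?N x)) \<partial>?P)"
      by (rule nn_integral_cmult) measurable
    also have "\<dots> < \<infinity>" using nn_integral_exp_PiM_power_law[OF I a] by simp
    finally show "emeasure ?P {x\<in>space ?P. ?N x < 1} \<noteq> \<infinity>" by simp
    fix B and r :: real assume [measurable]: "B \<in> sets (real_vectors I)" and r: "0 < r"
    let ?f = "rescale I (\<lambda>_. 1 / r)"
    have Nf: "?N (?f x) = ?N x / r" for x by (simp add: rescale_def sum_divide_distrib)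
    have Af: "A (?f x) = A x" for x unfolding A_def Nf using r by (auto simp: rescale_def restrict_def)
    have S: "{x \<in> space ?P. A x \<in> B \<and> ?N x < 1} \<in> sets (real_vectors I)"
      unfolding sets_PiM_power_law[of I a, symmetric] by measurable
    have "emeasure (distr ?P (real_vectors I) ?f) {x \<in> space ?P. A x \<in> B \<and> ?N x < 1}
      = emeasure ?P (?f -` {x \<in> space ?P. A x \<in> B \<and> ?N x < 1} \<inter> space ?P)"
      using S by (intro emeasure_distr) auto
    also have "?f -` {x \<in> space ?P. A x \<in> B \<and> ?N x < 1} \<inter> space ?P = {x \<in> space ?P. A x \<in> B \<and> ?N x < r}"
      using r by (auto simp: Nf Af) (auto simp: rescale_def)
    finally show "emeasure ?P {x \<in> space ?P. A x \<in> B \<and> ?N x < r}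
      = ennreal (r powr \<theta>) * emeasure ?P {x \<in> space ?P. A x \<in> B \<and> ?N x < 1}"
      using r by (simp add: distr_rescale_PiM_power_law[OF I a] powr_divide powr_minus_divide
          powr_sum[symmetric] \<theta>(1))
  qed
  thus ?thesis by (simp only: density_PiM_power_law[OF I a])
qed

text \<open>Recombination of direction and total. The factor \<open>max 0 t\<close> is chosen to
  match \<open>scale_measure (ennreal t)\<close>, where \<open>ennreal\<close> truncates negative t;
  almost every t is positive.\<close>

lemma distr_polar_PiM_power_law:
  assumes I: "finite I" and a: "\<And>i. 0 \<le> a i" and \<theta>: "\<theta> = (\<Sum>i\<in>I. a i)" "0 < \<theta>"
  shows "distr (distr (Pi\<^sub>M I (\<lambda>i. gamma_law (a i))) (real_vectors I) (\<lambda>x. \<lambda>i\<in>I. x i / (\<Sum>j\<in>I. x j))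
      \<Otimes>\<^sub>M lambda_measure \<theta>) (real_vectors I) (\<lambda>(x, t). \<lambda>i\<in>I. max 0 t * x i) = Pi\<^sub>M I (\<lambda>i. power_law (a i))"
proof -
  let ?P = "Pi\<^sub>M I (\<lambda>i. power_law (a i))" and ?N = "\<lambda>x. \<Sum>i\<in>I. x i :: real"
  let ?A = "\<lambda>x. \<lambda>i\<in>I. x i / ?N x"
  have "distr (distr ?P (real_vectors I \<Otimes>\<^sub>M borel) (\<lambda>x. (?A x, ?N x))) (real_vectors I) (\<lambda>(x, t). \<lambda>i\<in>I. max 0 t * x i)
    = distr ?P (real_vectors I) ((\<lambda>(x, t). \<lambda>i\<in>I. max 0 t * x i) \<circ> (\<lambda>x. (?A x, ?N x)))"
    by (intro distr_distr) measurable
  also have "\<dots> = distr ?P (real_vectors I) (\<lambda>x. x)"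
  proof (rule distr_cong_AE[OF refl refl])
    show "AE x in ?P. ((\<lambda>(x, t). \<lambda>i\<in>I. max 0 t * x i) \<circ> (\<lambda>x. (?A x, ?N x))) x = x"
      using AE_PiM_power_law_sum_pos[OF I a \<theta>(2)[unfolded \<theta>(1)]] AE_space
      by eventually_elim (auto simp: restrict_def extensional_def)
  qed measurable
  also have "\<dots> = ?P" by (simp add: distr_id2)
  finally show ?thesis using PiM_power_law_polar[OF I a \<theta>] by simp
qed

text \<open>The box function \<open>r \<mapsto> q (lower_box I r)\<close> of an invariant measure is, up to a factor,
  multiplicative and monotone, hence a product of powers.\<close>

lemma projectively_invariant_imp_PiM_power_law:
  assumes I: "finite I" and sets: "sets q = sets (real_vectors I)"
    and nonneg: "AE x in q. \<forall>i\<in>I. 0 \<le> x i"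
    and inv: "\<And>c. (\<And>i. i \<in> I \<Longrightarrow> 0 < c i) \<Longrightarrow>
      \<exists>R::real. distr q (real_vectors I) (rescale I c) = scale_measure (ennreal R) q"
    and norm: "(\<integral>\<^sup>+x. ennreal (exp (- (\<Sum>i\<in>I. x i))) \<partial>q) = 1"
  obtains a where "\<And>i. 0 \<le> a i" "q = Pi\<^sub>M I (\<lambda>i. power_law (a i))"
proof -
  note [measurable_cong, simp] = sets
  have space_q: "space q = extensional I" using sets_eq_imp_space_eq[OF sets] by (simp add: space_real_vectors)
  define G where "G r = emeasure q (lower_box I r)" for r
  \<comment> \<open>On the box the coordinate sum is at most the sum of the corner, so the indicator
    is dominated by a constant times the weight whose integral is 1.\<close>
  have Gfin: "G r \<noteq> \<infinity>" for r
  proof -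
    let ?s = "\<Sum>i\<in>I. r i"
    have "G r = (\<integral>\<^sup>+x. indicator (lower_box I r) x \<partial>q)"
      unfolding G_def using lower_box_sets[OF I] by (intro nn_integral_indicator[symmetric]) simp
    also have "\<dots> \<le> (\<integral>\<^sup>+x. ennreal (exp ?s) * ennreal (exp (- (\<Sum>i\<in>I. x i))) \<partial>q)"
    proof (rule nn_integral_mono)
      fix x
      show "indicator (lower_box I r) x \<le> ennreal (exp ?s) * ennreal (exp (- (\<Sum>i\<in>I. x i)))"
      proof (cases "x \<in> lower_box I r")
        case True
        hence "(\<Sum>i\<in>I. x i) \<le> ?s" by (intro sum_mono) (auto simp: lower_box_def intro: less_imp_le)
        thus ?thesis using True by (simp add: mult_exp_exp flip: ennreal_mult)
      qed simp
    qed
    also have "\<dots> = ennreal (exp ?s) * (\<integral>\<^sup>+x. ennreal (exp (- (\<Sum>i\<in>I. x i))) \<partial>q)"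
      by (rule nn_integral_cmult) measurable
    finally show ?thesis using norm by (auto simp: top_unique)
  qed
  \<comment> \<open>The box with corner c * s is the preimage of the box with corner s under scaling
    by 1 / c. So \<open>R c\<close> is the invariance constant of the inverse scaling, and it grows
    with c.\<close>
  have "\<exists>R::real. 0 \<le> R \<and> (\<forall>s. G (\<lambda>i. c i * s i) = ennreal R * G s)" if c: "\<forall>i\<in>I. 0 < c i" for c
  proof -
    obtain R :: real where R: "distr q (real_vectors I) (rescale I (\<lambda>i. 1 / c i)) = scale_measure (ennreal R) q"
      using inv[of "\<lambda>i. 1 / c i"] c by auto
    have "G (\<lambda>i. c i * s i) = ennreal R * G s" for s
    proof -
      have "ennreal R * G s = emeasure (distr q (real_vectors I) (rescale I (\<lambda>i. 1 / c i))) (lower_box I s)"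
        by (simp add: R G_def)
      also have "\<dots> = emeasure q (rescale I (\<lambda>i. 1 / c i) -` lower_box I s \<inter> space q)"
        using lower_box_sets[OF I] by (intro emeasure_distr) auto
      also have "rescale I (\<lambda>i. 1 / c i) -` lower_box I s \<inter> space q = lower_box I (\<lambda>i. c i * s i)"
        using rescale_vimage_lower_box[of I "\<lambda>i. 1 / c i" s] c by (simp add: space_q mult.commute)
      finally show ?thesis by (simp add: G_def)
    qed
    \<comment> \<open>A negative constant is read as 0 by \<open>ennreal\<close>, so it may be
      replaced by its positive part.\<close>
    hence "G (\<lambda>i. c i * s i) = ennreal (max 0 R) * G s" for s
      by (cases "R \<ge> 0") (auto simp: ennreal_neg)
    thus ?thesis by (intro exI[of _ "max 0 R"]) auto
  qed
  then obtain R :: "('a \<Rightarrow> real) \<Rightarrow> real" where R0: "\<And>c. \<forall>i\<in>I. 0 < c i \<Longrightarrow> 0 \<le> R c"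
    and R: "\<And>c s. \<forall>i\<in>I. 0 < c i \<Longrightarrow> G (\<lambda>i. c i * s i) = ennreal (R c) * G s" by metis
  have Gmono: "G r \<le> G s" if "\<forall>i\<in>I. r i \<le> s i" for r s
    unfolding G_def using that lower_box_sets[OF I]
    by (intro emeasure_mono) (auto simp: lower_box_def intro: less_le_trans)
  define g where "g = enn2real (G (\<lambda>_. 1))"
  have g: "G (\<lambda>_. 1) = ennreal g" using Gfin by (simp add: g_def less_top)
  have gnn: "0 \<le> g" by (simp add: g_def)
  have GR: "G c = ennreal (R c * g)" if "\<forall>i\<in>I. 0 < c i" for c
    using R[OF that, of "\<lambda>_. 1"] R0[OF that] g by (simp add: ennreal_mult gnn)
  \<comment> \<open>If the unit box were null, scaling would make all boxes null. They exhaust the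
    space, so q would vanish, contrary to the normalisation.\<close>
  have gpos: "g > 0"
  proof (rule ccontr)
    assume "\<not> g > 0"
    hence "g = 0" using gnn by simp
    hence "lower_box I (\<lambda>_. real (Suc n)) \<in> null_sets q" for n
      using GR[of "\<lambda>_. real (Suc n)"] lower_box_sets[OF I] by (intro null_setsI) (auto simp: G_def)
    hence "(\<Union>n. lower_box I (\<lambda>_. real (Suc n))) \<in> null_sets q" by (intro null_sets_UN) auto
    moreover have "space q \<subseteq> (\<Union>n. lower_box I (\<lambda>_. real (Suc n)))"
    proof
      fix x assume x: "x \<in> space q"
      obtain n where "Max (insert 0 (x ` I)) < real n" using reals_Archimedean2 by blast
      hence "\<And>i. i \<in> I \<Longrightarrow> x i < real n" using I by auto
      hence "x \<in> lower_box I (\<lambda>_. real (Suc n))" using x by (fastforce simp: lower_box_def space_q)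
      thus "x \<in> (\<Union>n. lower_box I (\<lambda>_. real (Suc n)))" by blast
    qed
    ultimately have "AE x in q. False" by (intro AE_I') auto
    hence "(\<integral>\<^sup>+x. ennreal (exp (- (\<Sum>i\<in>I. x i))) \<partial>q) = (\<integral>\<^sup>+x. 0 \<partial>q)"
      by (intro nn_integral_cong_AE) auto
    thus False using norm by simp
  qed
  have Rmult: "R (\<lambda>i. r i * s i) = R r * R s"
    if r: "\<forall>i\<in>I. 0 < r i" and s: "\<forall>i\<in>I. 0 < s i" for r s
  proof -
    have "ennreal (R (\<lambda>i. r i * s i) * g) = ennreal (R r) * ennreal (R s * g)"
      using GR[of "\<lambda>i. r i * s i"] GR[OF s] R[OF r, of s] r s by simp
    also have "\<dots> = ennreal (R r * R s * g)"
      using R0[OF r] R0[OF s] gpos by (simp add: mult.assoc flip: ennreal_mult)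
    finally show ?thesis using R0[OF r] R0[OF s] R0[of "\<lambda>i. r i * s i"] r s gpos by simp
  qed
  have R1: "R (\<lambda>_. 1) = 1"
    using GR[of "\<lambda>_. 1"] g gpos R0[of "\<lambda>_. 1"] by (simp add: mult_eq_self_implies_10)
  have Rpos: "0 < R r" if r: "\<forall>i\<in>I. 0 < r i" for r
  proof -
    have "R (\<lambda>i. r i * (if i \<in> I then 1 / r i else 1)) = R r * R (\<lambda>i. if i \<in> I then 1 / r i else 1)"
      using r by (intro Rmult) auto
    \<comment> \<open>\<open>R\<close> was obtained by choice and might depend on coordinates
      outside I, where the product need not be 1. It is pinned down through \<open>G\<close>, which
      does not see those coordinates.\<close>
    moreover have "R (\<lambda>i. r i * (if i \<in> I then 1 / r i else 1)) = 1"
    proof -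
      have p: "\<forall>i\<in>I. 0 < r i * (if i \<in> I then 1 / r i else 1)" using r by auto
      have "G (\<lambda>i. r i * (if i \<in> I then 1 / r i else 1)) = G (\<lambda>_. 1)"
        using r by (intro antisym Gmono) auto
      hence "ennreal (R (\<lambda>i. r i * (if i \<in> I then 1 / r i else 1)) * g) = ennreal g"
        using GR[OF p] g by metis
      thus ?thesis using gpos R0[OF p] by (simp add: mult_eq_self_implies_10)
    qed
    ultimately show ?thesis using R0[OF r] by (metis less_eq_real_def mult_zero_left zero_neq_one)
  qed
  have Rmono: "R r \<le> R s" if r: "\<forall>i\<in>I. 0 < r i" and rs: "\<forall>i\<in>I. r i \<le> s i" for r s
  proof -
    have s: "\<forall>i\<in>I. 0 < s i" using r rs less_le_trans by blast
    have "ennreal (R r * g) \<le> ennreal (R s * g)" using Gmono[OF rs] GR[OF r] GR[OF s] by simp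
    thus ?thesis using R0[OF s] gpos by simp
  qed
  obtain a where a: "\<And>i. 0 \<le> a i" "\<And>r. (\<And>i. i \<in> I \<Longrightarrow> 0 < r i) \<Longrightarrow> R r = (\<Prod>i\<in>I. r i powr a i)"
    by (rule mono_multiplicative_imp_prod_powr[OF I, of R]) (auto intro: Rpos Rmult Rmono)
  let ?P = "Pi\<^sub>M I (\<lambda>i. power_law (a i))"
  \<comment> \<open>The box values are g times the product of powers, whereas the product of power
    laws has a Gamma factor in each denominator. The normalisation will give C = 1.\<close>
  define C where "C = g * (\<Prod>i\<in>I. Gamma (a i + 1))"
  have Gam: "0 < Gamma (a i + 1)" for i using a(1)[of i] by (intro Gamma_real_pos) simp
  have C: "0 < C" using gpos Gam by (auto simp: C_def intro!: mult_pos_pos prod_pos)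
  have q: "q = scale_measure (ennreal C) ?P"
  proof (rule real_vectors_eqI[OF I])
    fix r
    show "emeasure q (lower_box I r) \<noteq> \<infinity>" using Gfin by (simp add: G_def)
    show "emeasure q (lower_box I r) = emeasure (scale_measure (ennreal C) ?P) (lower_box I r)"
    proof (cases "\<forall>i\<in>I. 0 < r i")
      case True
      have "(\<Prod>i\<in>I. r i powr a i) * g = C * (\<Prod>i\<in>I. r i powr a i / Gamma (a i + 1))"
      proof -
        have "(\<Prod>i\<in>I. Gamma (a i + 1)) \<noteq> 0" using C gpos by (auto simp: C_def)
        thus ?thesis by (simp add: C_def prod_dividef)
      qed
      moreover have "G r = ennreal ((\<Prod>i\<in>I. r i powr a i) * g)" using GR[of r] a(2)[of r] True by simp
      ultimately have "G r = ennreal (C * (\<Prod>i\<in>I. r i powr a i / Gamma (a i + 1)))" by simp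
      also have "\<dots> = ennreal C * ennreal (\<Prod>i\<in>I. r i powr a i / Gamma (a i + 1))"
        using C Gam by (intro ennreal_mult prod_nonneg) (auto simp: less_imp_le)
      finally show ?thesis using True by (simp add: G_def emeasure_PiM_power_law_lower_box[OF I a(1)])
    next
      case False
      then obtain j where j: "j \<in> I" "r j \<le> 0" by fastforce
      have "AE x in q. \<not> x \<in> lower_box I r"
        using nonneg by eventually_elim (use j in \<open>fastforce simp: lower_box_def\<close>)
      hence "emeasure q (lower_box I r) = 0"
        using lower_box_sets[OF I] AE_iff_measurable[of "lower_box I r" q "\<lambda>x. x \<notin> lower_box I r"]
        by (auto simp: space_q lower_box_def)
      moreover have "emeasure ?P (lower_box I r) = 0"
        using False by (simp only: emeasure_PiM_power_law_lower_box[OF I a(1)] if_False)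
      ultimately show ?thesis by simp
    qed
  qed (use sets in auto)
  have "(\<integral>\<^sup>+x. ennreal (exp (- (\<Sum>i\<in>I. x i))) \<partial>q) =
      ennreal C * (\<integral>\<^sup>+x. ennreal (exp (- (\<Sum>i\<in>I. x i))) \<partial>?P)"
    unfolding q by (rule nn_integral_scale_measure) measurable
  hence "C = 1" using norm C by (simp add: nn_integral_exp_PiM_power_law[OF I a(1)])
  hence "q = ?P" using q by simp
  with a(1) show thesis by (rule that)
qed

section \<open>Multipliers and normalisation\<close>

lemma measurable_borel_of_subtopologyI:
  assumes f: "f \<in> measurable M (borel_of T)" and S: "\<And>\<omega>. \<omega> \<in> space M \<Longrightarrow> f \<omega> \<in> S"
  shows "f \<in> measurable M (borel_of (subtopology T S))"
  unfolding borel_of_def[of "subtopology T S"]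
proof (rule measurable_measure_of)
  show "{U. openin (subtopology T S) U} \<subseteq> Pow (topspace (subtopology T S))"
    using openin_subset[of "subtopology T S"] by blast
  show "f \<in> space M \<rightarrow> topspace (subtopology T S)"
    using S measurable_space[OF f] by (auto simp: space_borel_of)
  fix V assume "V \<in> {U. openin (subtopology T S) U}"
  then obtain U where U: "openin T U" "V = U \<inter> S" by (auto simp: openin_subtopology)
  have "f -` V \<inter> space M = f -` U \<inter> space M" using S U by auto
  also have "\<dots> \<in> sets M" using U by (intro measurable_sets[OF f]) (simp add: sets_borel_of)
  finally show "f -` V \<inter> space M \<in> sets M" .
qed

lemma measurable_borel_of_subtopologyD:
  "(\<lambda>x. x) \<in> measurable (borel_of (subtopology T S)) (borel_of T)"
  unfolding borel_of_def[of T]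
proof (rule measurable_measure_of)
  show "{U. openin T U} \<subseteq> Pow (topspace T)" by (auto dest: openin_subset)
  fix U assume U: "U \<in> {U. openin T U}"
  have "(\<lambda>x. x) -` U \<inter> space (borel_of (subtopology T S)) = U \<inter> S"
    using U by (auto simp: space_borel_of dest: openin_subset)
  also have "\<dots> \<in> sets (borel_of (subtopology T S))"
    using U by (auto simp: sets_borel_of openin_subtopology)
  finally show "(\<lambda>x. x) -` U \<inter> space (borel_of (subtopology T S)) \<in> sets (borel_of (subtopology T S))" .
qed (auto simp: space_borel_of)

lemma space_prob_measures_algebra:
  "space (prob_measures_algebra :: 'a::topological_space measure measure) = finite_borel_measures \<inter> {\<eta>. prob_space \<eta>}"
  by (simp add: prob_measures_algebra_def space_borel_of topspace_weak_topology)

lemma measurable_prob_measures_algebraD: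
  "(\<lambda>\<eta>. \<eta>) \<in> measurable prob_measures_algebra finite_measures_algebra"
  unfolding prob_measures_algebra_def by (rule measurable_borel_of_subtopologyD)

lemma measurable_prob_measures_algebraI:
  assumes "f \<in> measurable M finite_measures_algebra" "\<And>\<omega>. \<omega> \<in> space M \<Longrightarrow> prob_space (f \<omega>)"
  shows "f \<in> measurable M prob_measures_algebra"
  unfolding prob_measures_algebra_def using assms by (intro measurable_borel_of_subtopologyI) auto

lemma emeasure_measurable_prob_measures_algebra:
  fixes A :: "'a::metric_space set"
  assumes "A \<in> sets borel"
  shows "(\<lambda>\<eta>. emeasure \<eta> A) \<in> borel_measurable prob_measures_algebra"
  by (rule measurable_compose[OF measurable_prob_measures_algebraD
        emeasure_measurable_finite_measures_algebra[OF assms]])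

lemma measure_measurable_prob_measures_algebra:
  fixes A :: "'a::metric_space set"
  assumes "A \<in> sets borel"
  shows "(\<lambda>\<eta>. measure \<eta> A) \<in> borel_measurable prob_measures_algebra"
  by (rule measurable_compose[OF measurable_prob_measures_algebraD
        measure_measurable_finite_measures_algebra[OF assms]])

definition evaluate :: "nat \<Rightarrow> (nat \<Rightarrow> 'a set) \<Rightarrow> 'a measure \<Rightarrow> nat \<Rightarrow> real" where
  "evaluate n A \<mu> = (\<lambda>i\<in>{..<n}. measure \<mu> (A i))"

lemma evaluate_measurable:
  fixes A :: "nat \<Rightarrow> 'a::metric_space set"
  assumes "\<And>i. i < n \<Longrightarrow> A i \<in> sets borel"
  shows "evaluate n A \<in> measurable finite_measures_algebra (real_vectors {..<n})"
    and "evaluate n A \<in> measurable prob_measures_algebra (real_vectors {..<n})"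
  unfolding evaluate_def[abs_def] using assms
  by (auto intro!: measurable_restrict measure_measurable_finite_measures_algebra
      measure_measurable_prob_measures_algebra)

lemma borel_partitionD:
  assumes "borel_partition n A"
  shows "\<And>i. i < n \<Longrightarrow> A i \<in> sets borel" "disjoint_family_on A {..<n}" "(\<Union>i<n. A i) = UNIV"
  using assms by (auto simp: borel_partition_def)

lemma sum_evaluate_partition:
  assumes "borel_partition n A" "\<mu> \<in> finite_borel_measures"
  shows "(\<Sum>i<n. evaluate n A \<mu> i) = measure \<mu> UNIV"
proof -
  interpret finite_measure \<mu> by (rule finite_borel_measuresD(2)[OF assms(2)])
  have "measure \<mu> (\<Union>i<n. A i) = (\<Sum>i<n. measure \<mu> (A i))"
    using borel_partitionD[OF assms(1)] finite_borel_measuresD(1)[OF assms(2)]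
    by (intro finite_measure_finite_Union) auto
  thus ?thesis using borel_partitionD(3)[OF assms(1)] by (simp add: evaluate_def)
qed

section \<open>The action of multipliers\<close>

lemma multipliersE:
  assumes "k \<in> multipliers"
  obtains a K where "k = (\<lambda>x. exp (a x))" "a \<in> borel_measurable borel" "\<And>x. \<bar>a x\<bar> \<le> K"
proof -
  obtain a where a: "k = (\<lambda>x. exp (a x))" "a \<in> borel_measurable borel" "bounded (range a)"
    using assms by (auto simp: multipliers_def)
  obtain K where "\<And>x. \<bar>a x\<bar> \<le> K" using a(3) by (auto simp: bounded_iff)
  with a(1,2) show thesis by (rule that)
qed

lemma multipliersI:
  assumes "a \<in> borel_measurable borel" "\<And>x. \<bar>a x\<bar> \<le> K"
  shows "(\<lambda>x. exp (a x)) \<in> multipliers"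
  unfolding multipliers_def using assms by (auto simp: bounded_iff intro!: exI[of _ a] exI[of _ K])

lemma emeasure_mult_action:
  assumes "k \<in> borel_measurable borel" "\<mu> \<in> finite_borel_measures" "A \<in> sets borel"
  shows "emeasure (mult_action k \<mu>) A = (\<integral>\<^sup>+x. ennreal (k x) * indicator A x \<partial>\<mu>)"
  unfolding mult_action_def
  using assms finite_borel_measuresD(1)[OF assms(2)] measurable_cong_sets[OF finite_borel_measuresD(1)[OF assms(2)] refl]
  by (intro emeasure_density) auto

lemma mult_action_finite_borel_measures:
  assumes "k \<in> borel_measurable borel" "\<And>x. k x \<le> K" "\<mu> \<in> finite_borel_measures"
  shows "mult_action k \<mu> \<in> finite_borel_measures"
proof -
  interpret finite_measure \<mu> by (rule finite_borel_measuresD(2)[OF assms(3)])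
  have s: "sets (mult_action k \<mu>) = sets borel"
    using finite_borel_measuresD(1)[OF assms(3)] by (simp add: mult_action_def)
  have "emeasure (mult_action k \<mu>) UNIV = (\<integral>\<^sup>+x. ennreal (k x) \<partial>\<mu>)"
    using emeasure_mult_action[OF assms(1,3), of UNIV] by simp
  also have "\<dots> \<le> (\<integral>\<^sup>+x. ennreal K \<partial>\<mu>)" using assms(2) by (intro nn_integral_mono ennreal_leI)
  also have "\<dots> < \<top>" by (simp add: less_top[symmetric] ennreal_mult_eq_top_iff)
  finally have "finite_measure (mult_action k \<mu>)"
    using sets_eq_imp_space_eq[OF s] by (intro finite_measureI) auto
  thus ?thesis using s by (simp add: finite_borel_measures_def)
qed

text \<open>The evaluation of the transformed measure at A integrates a fixed function against the
  kernel \<open>\<mu>\<close>, so the evaluation criterion applies.\<close>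

lemma mult_action_measurable:
  fixes k :: "'a::polish_space \<Rightarrow> real"
  assumes k: "k \<in> borel_measurable borel" "\<And>x. k x \<le> K"
  shows "mult_action k \<in> measurable finite_measures_algebra finite_measures_algebra"
proof (rule measurable_finite_measures_algebraI)
  fix A :: "'a set" assume A: "A \<in> sets borel"
  have "(\<lambda>\<mu>. \<integral>\<^sup>+x. ennreal (k x) * indicator A x \<partial>\<mu>) \<in> borel_measurable finite_measures_algebra"
  proof (rule nn_integral_kernel_measurable[where N=borel])
    show "(\<lambda>x. ennreal (k x) * indicator A x) \<in> borel_measurable borel" using k A by measurable
  qed (auto simp: space_finite_measures_algebra finite_borel_measuresD(1) emeasure_measurable_finite_measures_algebra)
  thus "(\<lambda>\<mu>. emeasure (mult_action k \<mu>) A) \<in> borel_measurable finite_measures_algebra"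
    by (rule measurable_cong[THEN iffD2, rotated])
      (simp add: space_finite_measures_algebra emeasure_mult_action[OF k(1) _ A])
qed (simp add: space_finite_measures_algebra mult_action_finite_borel_measures[OF k])

lemma multiplier_bounds:
  assumes "k \<in> multipliers"
  obtains K where "k \<in> borel_measurable borel" "\<And>x. k x \<le> K" "\<And>x. 0 < k x"
proof -
  obtain a K where a: "k = (\<lambda>x. exp (a x))" "a \<in> borel_measurable borel" "\<And>x. \<bar>a x\<bar> \<le> K"
    using multipliersE[OF assms] by blast
  have "k \<in> borel_measurable borel" using a by simp
  moreover have "k x \<le> exp K" for x using a(3)[of x] by (simp add: a(1) abs_le_iff)
  ultimately show thesis using that[of "exp K"] by (simp add: a(1))
qed

lemma mult_action_multiplier_measurable:
  fixes k :: "'a::polish_space \<Rightarrow> real"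
  assumes "k \<in> multipliers"
  shows "mult_action k \<in> measurable finite_measures_algebra finite_measures_algebra"
  using assms by (elim multiplier_bounds) (rule mult_action_measurable)

lemma measure_mult_action_const_on:
  assumes k: "k \<in> borel_measurable borel" "\<And>x. x \<in> A \<Longrightarrow> k x = c" "0 \<le> c"
    and A: "\<mu> \<in> finite_borel_measures" "A \<in> sets borel"
  shows "emeasure (mult_action k \<mu>) A = ennreal c * emeasure \<mu> A"
    and "measure (mult_action k \<mu>) A = c * measure \<mu> A"
proof -
  have "(\<integral>\<^sup>+x. ennreal (k x) * indicator A x \<partial>\<mu>) = (\<integral>\<^sup>+x. ennreal c * indicator A x \<partial>\<mu>)"
    using k by (intro nn_integral_cong) (auto simp: indicator_def)
  also have "\<dots> = ennreal c * emeasure \<mu> A"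
    using A finite_borel_measuresD(1)[OF A(1)] by (intro nn_integral_cmult_indicator) simp
  finally show 1: "emeasure (mult_action k \<mu>) A = ennreal c * emeasure \<mu> A"
    by (simp add: emeasure_mult_action[OF k(1) A])
  show "measure (mult_action k \<mu>) A = c * measure \<mu> A"
    unfolding measure_def 1 using k(3) by (simp add: enn2real_mult)
qed

text \<open>The Dirac default for mass zero makes the value a probability measure on every finite
  Borel measure, so the map is measurable into \<open>prob_measures_algebra\<close> without
  restricting its domain.\<close>

definition normalize_measure :: "'a::topological_space measure \<Rightarrow> 'a measure" where
  "normalize_measure \<mu> = (if measure \<mu> UNIV = 0 then return borel undefined
     else scale_measure (ennreal (1 / measure \<mu> UNIV)) \<mu>)"

lemma measure_normalize_measure:
  assumes "measure \<mu> UNIV \<noteq> 0"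
  shows "measure (normalize_measure \<mu>) A = measure \<mu> A / measure \<mu> UNIV"
  using assms by (simp add: normalize_measure_def measure_def enn2real_mult)

lemma normalize_measure_prob:
  assumes "\<mu> \<in> finite_borel_measures"
  shows "normalize_measure \<mu> \<in> finite_borel_measures" "prob_space (normalize_measure \<mu>)"
proof -
  interpret finite_measure \<mu> by (rule finite_borel_measuresD(2)[OF assms])
  have s: "sets (normalize_measure \<mu>) = sets borel"
    using finite_borel_measuresD(1)[OF assms] by (simp add: normalize_measure_def)
  have "emeasure (normalize_measure \<mu>) UNIV = 1"
  proof (cases "measure \<mu> UNIV = 0")
    case False
    hence "ennreal (1 / measure \<mu> UNIV) * ennreal (measure \<mu> UNIV) = 1"
      by (simp add: zero_less_measure_iff less_imp_le flip: ennreal_mult)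
    thus ?thesis using False by (simp add: normalize_measure_def emeasure_eq_measure)
  qed (simp add: normalize_measure_def)
  thus p: "prob_space (normalize_measure \<mu>)" using sets_eq_imp_space_eq[OF s] by (intro prob_spaceI) simp
  show "normalize_measure \<mu> \<in> finite_borel_measures"
    using s prob_space.finite_measure[OF p] by (simp add: finite_borel_measures_def)
qed

lemma normalize_measure_measurable:
  "normalize_measure \<in> measurable finite_measures_algebra (prob_measures_algebra :: 'a::polish_space measure measure)"
proof (rule measurable_prob_measures_algebraI)
  show "normalize_measure \<in> measurable finite_measures_algebra (finite_measures_algebra :: 'a::polish_space measure measure)"
  proof (rule measurable_finite_measures_algebraI)
    fix A :: "'a set" assume A: "A \<in> sets borel"
    note [measurable] = measure_measurable_finite_measures_algebra[of UNIV, simplified]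
      emeasure_measurable_finite_measures_algebra[OF A]
    have "(\<lambda>\<mu>. if measure \<mu> UNIV = 0 then emeasure (return borel undefined) A
        else ennreal (1 / measure \<mu> UNIV) * emeasure \<mu> A) \<in> borel_measurable finite_measures_algebra"
      by measurable
    moreover have "emeasure (normalize_measure \<mu>) A = (if measure \<mu> UNIV = 0 then emeasure (return borel undefined) A
        else ennreal (1 / measure \<mu> UNIV) * emeasure \<mu> A)" for \<mu>
      by (simp add: normalize_measure_def)
    ultimately show "(\<lambda>\<mu>. emeasure (normalize_measure \<mu>) A) \<in> borel_measurable finite_measures_algebra"
      by (simp only:)
  qed (simp add: space_finite_measures_algebra normalize_measure_prob)
qed (simp add: space_finite_measures_algebra normalize_measure_prob)

lemma scale_measure_measurable:
  "(\<lambda>(\<eta>, t). scale_measure (ennreal t) \<eta>) \<in>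
     measurable (prob_measures_algebra \<Otimes>\<^sub>M borel) (finite_measures_algebra :: 'a::polish_space measure measure)"
proof (rule measurable_finite_measures_algebraI)
  fix A :: "'a set" assume A: "A \<in> sets borel"
  note [measurable] = emeasure_measurable_prob_measures_algebra[OF A]
  have "(\<lambda>z. ennreal (snd z) * emeasure (fst z) A) \<in> borel_measurable (prob_measures_algebra \<Otimes>\<^sub>M borel)"
    by measurable
  thus "(\<lambda>z. emeasure (case z of (\<eta>, t) \<Rightarrow> scale_measure (ennreal t) \<eta>) A) \<in> borel_measurable (prob_measures_algebra \<Otimes>\<^sub>M borel)"
    by (simp add: case_prod_beta)
next
  fix z :: "'a measure \<times> real" assume "z \<in> space (prob_measures_algebra \<Otimes>\<^sub>M borel)"
  hence z: "fst z \<in> finite_borel_measures" by (auto simp: space_pair_measure space_prob_measures_algebra)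
  interpret finite_measure "fst z" by (rule finite_borel_measuresD(2)[OF z])
  have "finite_measure (scale_measure (ennreal (snd z)) (fst z))"
    by (rule finite_measureI) (simp add: ennreal_mult_eq_top_iff emeasure_eq_measure)
  thus "(case z of (\<eta>, t) \<Rightarrow> scale_measure (ennreal t) \<eta>) \<in> finite_borel_measures"
    using z by (simp add: case_prod_beta finite_borel_measures_def)
qed

lemma distr_scale_measure:
  assumes "f \<in> measurable M N"
  shows "distr (scale_measure r M) N f = scale_measure r (distr M N f)"
proof (rule measure_eqI)
  have f: "f \<in> measurable (scale_measure r M) N" 
    using assms measurable_cong_sets[OF sets_scale_measure refl] by blast
  fix A assume "A \<in> sets (distr (scale_measure r M) N f)"
  thus "emeasure (distr (scale_measure r M) N f) A = emeasure (scale_measure r (distr M N f)) A"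
    by (simp add: emeasure_distr[OF assms] emeasure_distr[OF f] sets_eq_imp_space_eq[OF sets_scale_measure])
qed simp

section \<open>From invariance to the multiplicative Lebesgue measure\<close>

lemma emeasure_power_law_atMost:
  assumes "0 < a" "0 < r"
  shows "emeasure (power_law a) {..r} = ennreal (r powr a / Gamma (a + 1))"
proof -
  have "AE t in density lborel (\<lambda>t. ennreal (t powr (a - 1) / Gamma a) * indicator {0<..} t). t \<noteq> r"
    by (subst AE_density) (use AE_lborel_singleton[of r] in auto)
  hence "AE t in power_law a. t \<noteq> r"
    using assms(1) by (simp only: power_law_def lambda_measure_def if_False less_imp_neq[symmetric])
  hence "AE t in power_law a. (t \<in> {..r}) = (t \<in> {..<r})" by eventually_elim auto
  hence "emeasure (power_law a) {..r} = emeasure (power_law a) {..<r}" by (intro emeasure_eq_AE) auto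
  thus ?thesis using assms by (simp add: emeasure_power_law_lessThan)
qed

lemma mass_measurable [measurable]:
  "(\<lambda>\<mu>. measure \<mu> UNIV) \<in> borel_measurable (finite_measures_algebra :: 'a::metric_space measure measure)"
  by (rule measure_measurable_finite_measures_algebra) simp

lemma const_multiplier: "0 < c \<Longrightarrow> (\<lambda>_. c) \<in> multipliers"
  using multipliersI[of "\<lambda>_. ln c" "\<bar>ln c\<bar>"] by simp

lemma mass_mult_action_const:
  assumes "0 < c" "\<mu> \<in> finite_borel_measures"
  shows "measure (mult_action (\<lambda>_. c) \<mu>) UNIV = c * measure \<mu> UNIV"
  using assms by (intro measure_mult_action_const_on) auto

lemma mult_action_const_measurable:
  "mult_action (\<lambda>_. c) \<in> measurable finite_measures_algebra (finite_measures_algebra :: 'a::polish_space measure measure)"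
  by (rule mult_action_measurable[of _ c]) auto

lemma emeasure_mass_scaled:
  fixes Q :: "'a::polish_space measure measure"
  assumes sets: "sets Q = sets finite_measures_algebra" and c: "0 < c" and S: "S \<in> sets borel"
  shows "emeasure (distr Q finite_measures_algebra (mult_action (\<lambda>_. c)))
      {\<mu> \<in> finite_borel_measures. measure \<mu> UNIV \<in> S}
    = emeasure Q {\<mu> \<in> finite_borel_measures. c * measure \<mu> UNIV \<in> S}"
proof -
  have sp: "space Q = finite_borel_measures"
    using sets_eq_imp_space_eq[OF sets] by (simp add: space_finite_measures_algebra)
  have m: "mult_action (\<lambda>_. c) \<in> measurable Q finite_measures_algebra"
    using mult_action_const_measurable measurable_cong_sets[OF sets refl] by blast
  have "{\<mu> \<in> finite_borel_measures. measure \<mu> UNIV \<in> S} =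
      (\<lambda>\<mu>. measure \<mu> UNIV) -` S \<inter> space (finite_measures_algebra :: 'a measure measure)"
    by (auto simp: space_finite_measures_algebra)
  also have "\<dots> \<in> sets finite_measures_algebra" using S by (rule measurable_sets[OF mass_measurable])
  finally have "emeasure (distr Q finite_measures_algebra (mult_action (\<lambda>_. c))) {\<mu> \<in> finite_borel_measures. measure \<mu> UNIV \<in> S}
    = emeasure Q (mult_action (\<lambda>_. c) -` {\<mu> \<in> finite_borel_measures. measure \<mu> UNIV \<in> S} \<inter> space Q)"
    by (rule emeasure_distr[OF m])
  also have "mult_action (\<lambda>_. c) -` {\<mu> \<in> finite_borel_measures. measure \<mu> UNIV \<in> S} \<inter> space Q
    = {\<mu> \<in> finite_borel_measures. c * measure \<mu> UNIV \<in> S}"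
    using measurable_space[OF m] by (auto simp: sp mass_mult_action_const[OF c] space_finite_measures_algebra)
  finally show ?thesis .
qed

text \<open>Constant multipliers scale the total mass, so the measure of the ball of radius r is
  multiplicative and monotone in r, hence a power. The unit ball provides finiteness and
  normalisation, the ball of radius 0 excludes the exponent 0.\<close>

lemma invariant_mass_law:
  fixes Q :: "'a::polish_space measure measure"
  assumes sets: "sets Q = sets finite_measures_algebra" and B0: "emeasure Q (mass_ball 0) = 0"
    and B1: "emeasure Q (mass_ball 1) = 1" and inv: "projectively_invariant Q"
  obtains \<theta> where "0 < \<theta>"
    "distr Q borel (\<lambda>\<mu>. measure \<mu> UNIV) = scale_measure (ennreal (Gamma (\<theta> + 1))) (power_law \<theta>)"
proof -
  define p where "p = distr Q borel (\<lambda>\<mu>. measure \<mu> (UNIV :: 'a set))"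
  have sp: "space Q = finite_borel_measures"
    using sets_eq_imp_space_eq[OF sets] by (simp add: space_finite_measures_algebra)
  have m: "(\<lambda>\<mu>. measure \<mu> (UNIV :: 'a set)) \<in> borel_measurable Q"
    using mass_measurable measurable_cong_sets[OF sets refl] by blast
  have p: "emeasure p S = emeasure Q {\<mu> \<in> finite_borel_measures. measure \<mu> UNIV \<in> S}" if "S \<in> sets borel" for S
    unfolding p_def emeasure_distr[OF m that] by (rule arg_cong[where f="emeasure Q"]) (auto simp: sp)
  have ball: "emeasure p {..r} = emeasure Q (mass_ball r)" for r by (simp add: p mass_ball_def)
  have "\<exists>R::real. 0 \<le> R \<and> (\<forall>S\<in>sets borel. emeasure p {t. c * t \<in> S} = ennreal R * emeasure p S)" if c: "0 < c" for c
  proof -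
    obtain R :: real where R: "0 \<le> R"
      "distr Q finite_measures_algebra (mult_action (\<lambda>_. c)) = scale_measure (ennreal R) Q"
      using inv const_multiplier[OF c] unfolding projectively_invariant_def by blast
    have "emeasure p {t. c * t \<in> S} = ennreal R * emeasure p S" if S: "S \<in> sets borel" for S
    proof -
      have "{t. c * t \<in> S} = (\<lambda>t. c * t) -` S \<inter> space borel" by auto
      also have "\<dots> \<in> sets borel" using S by (intro measurable_sets[of _ borel borel]) auto
      finally have S': "{t. c * t \<in> S} \<in> sets borel" .
      show ?thesis using emeasure_mass_scaled[OF sets c S] by (simp add: p[OF S] p[OF S'] R(2))
    qed
    thus ?thesis using R(1) by blast
  qed
  then obtain R :: "real \<Rightarrow> real" where R0: "\<And>c. 0 < c \<Longrightarrow> 0 \<le> R c"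
    and R: "\<And>c S. 0 < c \<Longrightarrow> S \<in> sets borel \<Longrightarrow> emeasure p {t. c * t \<in> S} = ennreal (R c) * emeasure p S"
    by metis
  \<comment> \<open>The multiplier 1 / r pulls the ball of radius s back to the ball of radius r *
    s.\<close>
  define F where "F r = R (1 / r)" for r
  have F0: "0 \<le> F r" if "0 < r" for r using R0[of "1 / r"] that by (simp add: F_def)
  have Fle: "emeasure p {..r * s} = ennreal (F r) * emeasure p {..s}" if "0 < r" for r s
  proof -
    have "{t. 1 / r * t \<in> {..s}} = {..r * s}" using that by (auto simp: field_simps)
    thus ?thesis using R[of "1 / r" "{..s}"] that by (simp add: F_def)
  qed
  have Flt: "emeasure p {..<r * s} = ennreal (F r) * emeasure p {..<s}" if "0 < r" for r s
  proof -
    have "{t. 1 / r * t \<in> {..<s}} = {..<r * s}" using that by (auto simp: field_simps)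
    thus ?thesis using R[of "1 / r" "{..<s}"] that by (simp add: F_def)
  qed
  have pF: "emeasure p {..r} = ennreal (F r)" if "0 < r" for r
    using Fle[OF that, of 1] B1 by (simp add: ball)
  have Fmult: "F (r * s) = F r * F s" if "0 < r" "0 < s" for r s
  proof -
    have "ennreal (F (r * s)) = ennreal (F r * F s)"
      using Fle[of r s] pF[of "r * s"] pF[of s] that F0 by (simp add: ennreal_mult)
    thus ?thesis using F0[of "r * s"] F0[of r] F0[of s] that by simp
  qed
  have F1: "F 1 = 1" using pF[of 1] B1 F0[of 1] by (simp add: ball)
  have Fpos: "0 < F r" if "0 < r" for r
  proof -
    have "F r * F (1 / r) = 1" using Fmult[of r "1 / r"] that F1 by simp
    thus ?thesis using F0[OF that] by (metis less_eq_real_def mult_zero_left zero_neq_one)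
  qed
  have Fmono: "F r \<le> F s" if "0 < r" "r \<le> s" for r s
  proof -
    have "emeasure p {..r} \<le> emeasure p {..s}" using that by (intro emeasure_mono) (auto simp: p_def)
    thus ?thesis using pF[of r] pF[of s] that F0[of s] by simp
  qed
  obtain \<theta> where \<theta>: "0 \<le> \<theta>" "\<And>r. 0 < r \<Longrightarrow> F r = r powr \<theta>"
    using mono_multiplicative_imp_powr[of F] Fpos Fmult Fmono by blast
  have G: "0 < Gamma (\<theta> + 1)" using \<theta>(1) by (intro Gamma_real_pos) simp
  \<comment> \<open>The comparison of measures uses open rays, while the hypothesis fixes the closed
    one. Until spheres are known to be null, g could be smaller than 1; g = 1 follows once p is a
    multiple of a power law without atoms.\<close>
  define g where "g = enn2real (emeasure p {..<1})"
  have "emeasure p {..<1} \<le> emeasure p {..1}" by (intro emeasure_mono) (auto simp: p_def)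
  hence "emeasure p {..<1} < \<top>" using B1 by (auto simp: ball less_top[symmetric] top_unique)
  hence g: "emeasure p {..<1} = ennreal g" by (simp add: g_def)
  have g0: "0 \<le> g" by (simp add: g_def)
  have lt: "emeasure p {..<r} = ennreal (F r * g)" if "0 < r" for r
    using Flt[OF that, of 1] g g0 F0[OF that] by (simp add: ennreal_mult)
  have le0: "emeasure p {..<r} = 0" if "r \<le> 0" for r
  proof -
    have "{\<mu> \<in> finite_borel_measures. measure \<mu> (UNIV::'a set) \<in> {..<r}} = {}"
      using that by (auto simp: not_less intro: order_trans[OF _ measure_nonneg])
    thus ?thesis by (subst p) (auto simp only: emeasure_empty, simp)
  qed
  have p_eq: "p = scale_measure (ennreal (g * Gamma (\<theta> + 1))) (power_law \<theta>)"
  proof (rule borel_eqI_lessThan)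
    fix r :: real
    show "emeasure p {..<r} = emeasure (scale_measure (ennreal (g * Gamma (\<theta> + 1))) (power_law \<theta>)) {..<r}"
      using G less_imp_neq[OF G] g0 lt[of r] le0[of r] \<theta> by (cases "r \<le> 0") (auto simp: emeasure_power_law_lessThan mult.commute simp flip: ennreal_mult)
    show "emeasure p {..<r} \<noteq> \<infinity>" using lt[of r] le0[of r] by (cases "r \<le> 0") auto
  qed (auto simp: p_def)
  have "g \<noteq> 0"
  proof
    assume "g = 0"
    hence "emeasure p {..1} = 0" unfolding p_eq by simp
    thus False using B1 by (simp add: ball)
  qed
  \<comment> \<open>For exponent 0 the law of the mass would be a positive multiple of the Dirac
    mass at 0, and the ball of radius 0 would have positive measure.\<close>
  have "\<theta> \<noteq> 0"
  proof
    assume "\<theta> = 0"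
    hence "emeasure p {..0} = ennreal (g * Gamma 1)" unfolding p_eq by (simp add: power_law_def)
    thus False using \<open>g \<noteq> 0\<close> g0 B0 by (simp add: ball)
  qed
  hence \<theta>pos: "0 < \<theta>" using \<theta>(1) by simp
  have "emeasure p {..1} = ennreal g"
    unfolding p_eq using \<theta>pos G less_imp_neq[OF G] g0 by (simp add: emeasure_power_law_atMost flip: ennreal_mult)
  hence "g = 1" using B1 g0 by (simp add: ball)
  with p_eq \<theta>pos show thesis by (intro that[of \<theta>]) (auto simp: p_def)
qed

lemma step_multiplier:
  assumes A: "borel_partition n A" and c: "\<And>i. i < n \<Longrightarrow> 0 < c i"
  obtains k where "k \<in> multipliers" "\<And>i x. i < n \<Longrightarrow> x \<in> A i \<Longrightarrow> k x = c i"
proof -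
  define a where "a x = (\<Sum>i<n. ln (c i) * indicator (A i) x)" for x
  have "a \<in> borel_measurable borel"
    unfolding a_def[abs_def] using borel_partitionD(1)[OF A]
    by (intro borel_measurable_sum borel_measurable_times borel_measurable_indicator) auto
  moreover have "\<bar>a x\<bar> \<le> (\<Sum>i<n. \<bar>ln (c i)\<bar>)" for x
    unfolding a_def by (rule order_trans[OF sum_abs]) (intro sum_mono, simp add: abs_mult indicator_def)
  ultimately have "(\<lambda>x. exp (a x)) \<in> multipliers" by (rule multipliersI)
  moreover have "exp (a x) = c i" if i: "i < n" "x \<in> A i" for i x
  proof -
    have "a x = (\<Sum>j<n. if j = i then ln (c i) else 0)"
      unfolding a_def using i borel_partitionD(2)[OF A]
      by (intro sum.cong refl) (auto simp: indicator_def disjoint_family_on_def)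
    thus ?thesis using i c by simp
  qed
  ultimately show thesis by (rule that)
qed

text \<open>The instance to come is Q divided by its Laplace mass. The law of the total mass is then
  a power law without a factor, so weighting by \<open>exp (- mass)\<close> produces a probability
  measure.\<close>

locale normalized_invariant_measure =
  fixes L :: "'a::polish_space measure measure" and \<theta> :: real
  assumes sets_L [measurable_cong]: "sets L = sets finite_measures_algebra"
    and invariant: "projectively_invariant L"
    and \<theta>_pos: "0 < \<theta>"
    and mass_law: "distr L borel (\<lambda>\<mu>. measure \<mu> UNIV) = power_law \<theta>"
begin

lemma space_L: "space L = finite_borel_measures"
  using sets_eq_imp_space_eq[OF sets_L] by (simp add: space_finite_measures_algebra)

lemma measurable_L_cong: "measurable L N = measurable finite_measures_algebra N"
  by (rule measurable_cong_sets[OF sets_L refl])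

lemma nn_integral_mass:
  assumes "f \<in> borel_measurable borel"
  shows "(\<integral>\<^sup>+\<mu>. f (measure \<mu> UNIV) \<partial>L) = (\<integral>\<^sup>+t. f t \<partial>power_law \<theta>)"
  unfolding mass_law[symmetric] using assms by (intro nn_integral_distr[symmetric]) (auto simp: measurable_L_cong mass_measurable)

lemma laplace_L: "(\<integral>\<^sup>+\<mu>. ennreal (exp (- measure \<mu> UNIV)) \<partial>L) = 1"
  using nn_integral_mass[of "\<lambda>t. ennreal (exp (- t))"] \<theta>_pos by (simp add: nn_integral_exp_power_law)

lemma AE_mass_pos: "AE \<mu> in L. 0 < measure \<mu> UNIV"
proof -
  have "AE t in distr L borel (\<lambda>\<mu>. measure \<mu> UNIV). 0 < t"
    unfolding mass_law by (rule AE_power_law_pos[OF \<theta>_pos])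
  thus ?thesis by (subst (asm) AE_distr_iff) (auto simp: measurable_L_cong mass_measurable)
qed

lemma mult_action_L_measurable:
  "k \<in> multipliers \<Longrightarrow> mult_action k \<in> measurable L finite_measures_algebra"
  unfolding measurable_L_cong by (rule mult_action_multiplier_measurable)

text \<open>Projective invariance supplies some constant, and the mass law identifies it: compare
  the measures of the sets of mass below 1 and below 1 / c.\<close>

lemma distr_mult_action_const:
  assumes c: "0 < c"
  shows "distr L finite_measures_algebra (mult_action (\<lambda>_. c)) = scale_measure (ennreal (c powr - \<theta>)) L"
proof -
  obtain R :: real where R: "0 \<le> R"
    "distr L finite_measures_algebra (mult_action (\<lambda>_. c)) = scale_measure (ennreal R) L"
    using invariant const_multiplier[OF c] unfolding projectively_invariant_def by blast
  have G: "0 < Gamma (\<theta> + 1)" using \<theta>_pos by (intro Gamma_real_pos) simp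
  have L: "emeasure L {\<mu> \<in> finite_borel_measures. measure \<mu> UNIV \<in> {..<r}} = ennreal (r powr \<theta> / Gamma (\<theta> + 1))"
    if "0 < r" for r
  proof -
    have "emeasure L {\<mu> \<in> finite_borel_measures. measure \<mu> UNIV \<in> {..<r}} = emeasure (distr L borel (\<lambda>\<mu>. measure \<mu> UNIV)) {..<r}"
      by (subst emeasure_distr) (auto simp: measurable_L_cong mass_measurable space_L intro!: arg_cong[where f="emeasure L"])
    thus ?thesis using that \<theta>_pos by (simp add: mass_law emeasure_power_law_lessThan)
  qed
  have "{\<mu> \<in> finite_borel_measures. c * measure \<mu> (UNIV::'a set) \<in> {..<1}} =
      {\<mu> \<in> finite_borel_measures. measure \<mu> UNIV \<in> {..<1 / c}}"
    using c by (auto simp: field_simps)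
  hence "ennreal ((1 / c) powr \<theta> / Gamma (\<theta> + 1)) = ennreal R * ennreal (1 / Gamma (\<theta> + 1))"
    using emeasure_mass_scaled[OF sets_L c, of "{..<1}"] L[of 1] L[of "1 / c"] c by (simp add: R(2))
  hence "(1 / c) powr \<theta> / Gamma (\<theta> + 1) = R / Gamma (\<theta> + 1)"
    using R(1) G by (simp flip: ennreal_mult)
  hence "R = c powr - \<theta>" using G c by (simp add: powr_divide powr_minus_divide field_simps)
  thus ?thesis using R(2) by simp
qed

text \<open>A multiplier equal to c i on the i-th cell scales the i-th cell mass by c i, so
  invariance descends to the vector of cell masses. Its coordinates add up to the total mass, so the
  Laplace normalisation descends too.\<close>

lemma distr_evaluate:
  assumes A: "borel_partition n A"
  obtains a where "\<And>i. 0 \<le> a i" "distr L (real_vectors {..<n}) (evaluate n A) = Pi\<^sub>M {..<n} (\<lambda>i. power_law (a i))"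
proof (rule projectively_invariant_imp_PiM_power_law[of "{..<n}" "distr L (real_vectors {..<n}) (evaluate n A)"])
  have ev: "evaluate n A \<in> measurable L (real_vectors {..<n})"
    unfolding measurable_L_cong using borel_partitionD(1)[OF A] by (rule evaluate_measurable)
  show "AE x in distr L (real_vectors {..<n}) (evaluate n A). \<forall>i\<in>{..<n}. 0 \<le> x i"
    by (subst AE_distr_iff[OF ev]) (measurable, simp add: evaluate_def)
  have "(\<integral>\<^sup>+x. ennreal (exp (- (\<Sum>i<n. x i))) \<partial>distr L (real_vectors {..<n}) (evaluate n A))
      = (\<integral>\<^sup>+\<mu>. ennreal (exp (- (\<Sum>i<n. evaluate n A \<mu> i))) \<partial>L)"
    by (rule nn_integral_distr[OF ev]) measurable
  also have "\<dots> = (\<integral>\<^sup>+\<mu>. ennreal (exp (- measure \<mu> UNIV)) \<partial>L)"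
    by (intro nn_integral_cong) (simp only: space_L sum_evaluate_partition[OF A])
  also have "\<dots> = 1" by (rule laplace_L)
  finally show "(\<integral>\<^sup>+x. ennreal (exp (- (\<Sum>i<n. x i))) \<partial>distr L (real_vectors {..<n}) (evaluate n A)) = 1" .
  fix c :: "nat \<Rightarrow> real" assume c: "\<And>i. i \<in> {..<n} \<Longrightarrow> 0 < c i"
  obtain k where k: "k \<in> multipliers" "\<And>i x. i < n \<Longrightarrow> x \<in> A i \<Longrightarrow> k x = c i"
    using step_multiplier[OF A, of c] c by auto
  obtain R :: real where R: "distr L finite_measures_algebra (mult_action k) = scale_measure (ennreal R) L"
    using invariant k(1) unfolding projectively_invariant_def by blast
  have ev': "evaluate n A \<in> measurable finite_measures_algebra (real_vectors {..<n})"
    using ev by (simp add: measurable_L_cong)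
  have "distr (distr L (real_vectors {..<n}) (evaluate n A)) (real_vectors {..<n}) (rescale {..<n} c)
    = distr L (real_vectors {..<n}) (rescale {..<n} c \<circ> evaluate n A)"
    by (rule distr_distr[OF rescale_measurable ev])
  also have "\<dots> = distr L (real_vectors {..<n}) (evaluate n A \<circ> mult_action k)"
  proof (rule distr_cong[OF refl refl])
    fix \<mu> assume "\<mu> \<in> space L"
    hence \<mu>: "\<mu> \<in> finite_borel_measures" by (simp add: space_L)
    obtain K where "k \<in> borel_measurable borel" using multiplier_bounds[OF k(1)] by blast
    hence "measure (mult_action k \<mu>) (A i) = c i * measure \<mu> (A i)" if "i < n" for i
      using that k(2) c \<mu> borel_partitionD(1)[OF A]
      by (intro measure_mult_action_const_on) (auto simp: less_imp_le)
    thus "(rescale {..<n} c \<circ> evaluate n A) \<mu> = (evaluate n A \<circ> mult_action k) \<mu>"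
      by (auto simp: rescale_def evaluate_def)
  qed
  also have "\<dots> = distr (distr L finite_measures_algebra (mult_action k)) (real_vectors {..<n}) (evaluate n A)"
    by (rule distr_distr[OF ev' mult_action_L_measurable[OF k(1)], symmetric])
  also have "\<dots> = scale_measure (ennreal R) (distr L (real_vectors {..<n}) (evaluate n A))"
    unfolding R by (rule distr_scale_measure[OF ev])
  finally show "\<exists>R::real. distr (distr L (real_vectors {..<n}) (evaluate n A)) (real_vectors {..<n}) (rescale {..<n} c)
    = scale_measure (ennreal R) (distr L (real_vectors {..<n}) (evaluate n A))" by blast
qed (auto intro: that)

lemma sets_tilted: "sets (tilted_intensity L) = sets borel"
  unfolding tilted_intensity_def
  using sets.sigma_sets_eq[of borel] by (subst sets_measure_of) auto

end

section \<open>Separating direction and mass of a measure\<close>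

lemma scale_mass_normalize_measure:
  assumes "\<mu> \<in> finite_borel_measures" "0 < measure \<mu> UNIV"
  shows "scale_measure (ennreal (measure \<mu> UNIV)) (normalize_measure \<mu>) = \<mu>"
proof (rule measure_eqI)
  fix A
  have "ennreal (measure \<mu> UNIV) * ennreal (1 / measure \<mu> UNIV) = 1"
    using assms(2) by (simp flip: ennreal_mult)
  thus "emeasure (scale_measure (ennreal (measure \<mu> UNIV)) (normalize_measure \<mu>)) A = emeasure \<mu> A"
    using assms(2) by (simp add: normalize_measure_def mult.assoc[symmetric])
qed (use assms in \<open>simp add: normalize_measure_def\<close>)

lemma normalize_mult_action_const:
  assumes c: "0 < c" and \<mu>: "\<mu> \<in> finite_borel_measures"
  shows "normalize_measure (mult_action (\<lambda>_. c) \<mu>) = normalize_measure \<mu>"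
proof (cases "measure \<mu> UNIV = 0")
  case True thus ?thesis using mass_mult_action_const[OF c \<mu>] by (simp add: normalize_measure_def)
next
  case False
  hence m: "0 < measure \<mu> UNIV" by (simp add: zero_less_measure_iff)
  show ?thesis
  proof (rule measure_eqI)
    fix A assume "A \<in> sets (normalize_measure (mult_action (\<lambda>_. c) \<mu>))"
    hence A: "A \<in> sets borel"
      using c m finite_borel_measuresD(1)[OF \<mu>] mass_mult_action_const[OF c \<mu>]
      by (simp add: normalize_measure_def mult_action_def)
    have "emeasure (mult_action (\<lambda>_. c) \<mu>) A = ennreal c * emeasure \<mu> A"
      using c A \<mu> by (intro measure_mult_action_const_on) auto
    moreover have "ennreal (1 / (c * measure \<mu> UNIV)) * ennreal c = ennreal (1 / measure \<mu> UNIV)"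
      using c m by (simp flip: ennreal_mult)
    ultimately show "emeasure (normalize_measure (mult_action (\<lambda>_. c) \<mu>)) A = emeasure (normalize_measure \<mu>) A"
      using c m mass_mult_action_const[OF c \<mu>] by (simp add: normalize_measure_def mult.assoc[symmetric])
  qed (use c m mass_mult_action_const[OF c \<mu>] in \<open>simp add: normalize_measure_def mult_action_def\<close>)
qed

context normalized_invariant_measure
begin

lemma emeasure_measurable_L: "A \<in> sets borel \<Longrightarrow> (\<lambda>\<mu>. emeasure \<mu> A) \<in> borel_measurable L"
  unfolding measurable_L_cong by (rule emeasure_measurable_finite_measures_algebra)

lemma mass_measurable_L [measurable]: "(\<lambda>\<mu>. measure \<mu> UNIV) \<in> borel_measurable L"
  unfolding measurable_L_cong by (rule mass_measurable)

text \<open>\<open>measure_of\<close> returns the prescribed set function only once countable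
  additivity is established; here it follows from exchanging sum and integral.\<close>

lemma emeasure_tilted:
  assumes "A \<in> sets borel"
  shows "emeasure (tilted_intensity L) A =
    (\<integral>\<^sup>+\<mu>. emeasure \<mu> A * ennreal (exp (- measure \<mu> UNIV)) \<partial>L)"
proof (rule emeasure_measure_of[OF tilted_intensity_def[of L]])
  show "A \<in> sets (tilted_intensity L)" using assms by (simp add: sets_tilted)
  show "countably_additive (sets (tilted_intensity L))
     (\<lambda>A. \<integral>\<^sup>+\<mu>. emeasure \<mu> A * ennreal (exp (- measure \<mu> UNIV)) \<partial>L)"
  proof (rule countably_additiveI)
    fix B :: "nat \<Rightarrow> 'a set"
    assume B: "range B \<subseteq> sets (tilted_intensity L)" "disjoint_family B"
    hence Bi: "B i \<in> sets borel" for i by (auto simp: sets_tilted)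
    have "(\<Sum>i. \<integral>\<^sup>+\<mu>. emeasure \<mu> (B i) * ennreal (exp (- measure \<mu> UNIV)) \<partial>L)
        = (\<integral>\<^sup>+\<mu>. (\<Sum>i. emeasure \<mu> (B i) * ennreal (exp (- measure \<mu> UNIV))) \<partial>L)"
      using emeasure_measurable_L[OF Bi] by (intro nn_integral_suminf[symmetric] borel_measurable_times_ennreal) auto
    also have "\<dots> = (\<integral>\<^sup>+\<mu>. emeasure \<mu> (\<Union>i. B i) * ennreal (exp (- measure \<mu> UNIV)) \<partial>L)"
    proof (rule nn_integral_cong)
      fix \<mu> assume "\<mu> \<in> space L"
      hence "sets \<mu> = sets borel" by (simp add: space_L finite_borel_measuresD(1))
      hence "(\<Sum>i. emeasure \<mu> (B i)) = emeasure \<mu> (\<Union>i. B i)" using Bi B(2) by (intro suminf_emeasure) auto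
      thus "(\<Sum>i. emeasure \<mu> (B i) * ennreal (exp (- measure \<mu> UNIV)))
          = emeasure \<mu> (\<Union>i. B i) * ennreal (exp (- measure \<mu> UNIV))"
        by (simp add: ennreal_suminf_multc)
    qed
    finally show "(\<Sum>i. \<integral>\<^sup>+\<mu>. emeasure \<mu> (B i) * ennreal (exp (- measure \<mu> UNIV)) \<partial>L)
        = (\<integral>\<^sup>+\<mu>. emeasure \<mu> (\<Union>i. B i) * ennreal (exp (- measure \<mu> UNIV)) \<partial>L)" .
  qed
qed (auto simp: positive_def)

text \<open>The exponents were found separately for each partition. Being weighted means of cell
  masses, they are all values of one measure, which makes them consistent.\<close>

lemma emeasure_tilted_partition:
  assumes A: "borel_partition n A" and a: "\<And>i. 0 \<le> a i"
    and ev: "distr L (real_vectors {..<n}) (evaluate n A) = Pi\<^sub>M {..<n} (\<lambda>i. power_law (a i))"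
    and i: "i < n"
  shows "emeasure (tilted_intensity L) (A i) = ennreal (a i)"
proof -
  have evm: "evaluate n A \<in> measurable L (real_vectors {..<n})"
    unfolding measurable_L_cong using borel_partitionD(1)[OF A] by (rule evaluate_measurable)
  have "emeasure (tilted_intensity L) (A i) = (\<integral>\<^sup>+\<mu>. emeasure \<mu> (A i) * ennreal (exp (- measure \<mu> UNIV)) \<partial>L)"
    using borel_partitionD(1)[OF A i] by (rule emeasure_tilted)
  also have "\<dots> = (\<integral>\<^sup>+\<mu>. ennreal (evaluate n A \<mu> i) * ennreal (exp (- (\<Sum>i<n. evaluate n A \<mu> i))) \<partial>L)"
  proof (rule nn_integral_cong)
    fix \<mu> assume "\<mu> \<in> space L"
    hence \<mu>: "\<mu> \<in> finite_borel_measures" by (simp add: space_L)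
    interpret finite_measure \<mu> by (rule finite_borel_measuresD(2)[OF \<mu>])
    show "emeasure \<mu> (A i) * ennreal (exp (- measure \<mu> UNIV))
      = ennreal (evaluate n A \<mu> i) * ennreal (exp (- (\<Sum>i<n. evaluate n A \<mu> i)))"
      unfolding sum_evaluate_partition[OF A \<mu>] using i by (simp add: evaluate_def emeasure_eq_measure)
  qed
  also have "\<dots> = (\<integral>\<^sup>+x. ennreal (x i) * ennreal (exp (- (\<Sum>i<n. x i))) \<partial>distr L (real_vectors {..<n}) (evaluate n A))"
    using i by (intro nn_integral_distr[OF evm, symmetric]) measurable
  also have "\<dots> = ennreal (a i)" unfolding ev using i by (intro nn_integral_coordinate_PiM_power_law a) auto
  finally show ?thesis .
qed

lemma emeasure_tilted_UNIV: "emeasure (tilted_intensity L) UNIV = ennreal \<theta>"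
proof -
  have "emeasure (tilted_intensity L) UNIV = (\<integral>\<^sup>+\<mu>. emeasure \<mu> UNIV * ennreal (exp (- measure \<mu> UNIV)) \<partial>L)"
    by (rule emeasure_tilted) simp
  also have "\<dots> = (\<integral>\<^sup>+\<mu>. ennreal (measure \<mu> UNIV) * ennreal (exp (- measure \<mu> UNIV)) \<partial>L)"
    by (intro nn_integral_cong) (simp add: space_L finite_borel_measures_def finite_measure.emeasure_eq_measure)
  also have "\<dots> = (\<integral>\<^sup>+t. ennreal t * ennreal (exp (- t)) \<partial>power_law \<theta>)"
    by (rule nn_integral_mass) measurable
  also have "\<dots> = ennreal \<theta>" using \<theta>_pos by (intro nn_integral_id_exp_power_law) simp
  finally show ?thesis .
qed

lemma integral_mass: "(LINT \<mu>|L. measure \<mu> UNIV * exp (- measure \<mu> UNIV)) = \<theta>"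
proof -
  have "(LINT \<mu>|L. measure \<mu> UNIV * exp (- measure \<mu> UNIV))
    = enn2real (\<integral>\<^sup>+\<mu>. ennreal (measure \<mu> UNIV * exp (- measure \<mu> UNIV)) \<partial>L)"
    by (rule integral_eq_nn_integral) auto
  also have "(\<integral>\<^sup>+\<mu>. ennreal (measure \<mu> UNIV * exp (- measure \<mu> UNIV)) \<partial>L)
    = (\<integral>\<^sup>+t. ennreal (t * exp (- t)) \<partial>power_law \<theta>)" by (rule nn_integral_mass) measurable
  also have "\<dots> = (\<integral>\<^sup>+t. ennreal t * ennreal (exp (- t)) \<partial>power_law \<theta>)"
    by (intro nn_integral_cong) (simp add: ennreal_mult'')
  also have "\<dots> = ennreal \<theta>" using \<theta>_pos by (intro nn_integral_id_exp_power_law) simp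
  finally show ?thesis using \<theta>_pos by simp
qed

definition intensity :: "'a measure" where
  "intensity = scale_measure (ennreal (1 / \<theta>)) (tilted_intensity L)"

lemma intensity:
  shows "sets intensity = sets borel" "prob_space intensity"
    and "scale_measure (ennreal \<theta>) intensity = tilted_intensity L"
proof -
  have \<theta>: "ennreal \<theta> * ennreal (1 / \<theta>) = 1" using \<theta>_pos by (simp flip: ennreal_mult)
  show s: "sets intensity = sets borel" by (simp add: intensity_def sets_tilted)
  have "emeasure intensity UNIV = 1" using \<theta> by (simp add: intensity_def emeasure_tilted_UNIV mult.commute)
  thus "prob_space intensity" using sets_eq_imp_space_eq[OF s] by (intro prob_spaceI) simp
  show "scale_measure (ennreal \<theta>) intensity = tilted_intensity L"
    by (rule measure_eqI) (simp_all add: intensity_def \<theta> mult.assoc[symmetric])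
qed

text \<open>The Dirichlet--Ferguson factor. Since direction and mass will separate, any weight
  depending on the mass alone and with integral 1 would give the same law; the exponential one makes
  the cell masses Gamma distributed.\<close>

definition angular_law :: "'a measure measure" where
  "angular_law = distr (density L (\<lambda>\<mu>. ennreal (exp (- measure \<mu> UNIV)))) prob_measures_algebra normalize_measure"

lemma normalize_measurable_L: "normalize_measure \<in> measurable L prob_measures_algebra"
  unfolding measurable_L_cong by (rule normalize_measure_measurable)

lemma normalize_measurable_density:
  "normalize_measure \<in> measurable (density L f) prob_measures_algebra"
  using normalize_measurable_L by simp

text \<open>The constant multiplier 1 / r leaves the normalised measure fixed and divides the mass
  by r, so its invariance constant gives the homogeneity of degree \<theta> required for the polar
  decomposition.\<close>

lemma polar_L:
  "distr L (prob_measures_algebra \<Otimes>\<^sub>M borel) (\<lambda>\<mu>. (normalize_measure \<mu>, measure \<mu> UNIV))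
    = angular_law \<Otimes>\<^sub>M lambda_measure \<theta>"
  unfolding angular_law_def
proof (rule polar_decomposition[OF _ normalize_measurable_L \<theta>_pos _ AE_mass_pos])
  show "(\<lambda>\<mu>. measure \<mu> UNIV) \<in> borel_measurable L" by measurable
  have "emeasure L {\<mu> \<in> space L. measure \<mu> UNIV < 1} = emeasure (distr L borel (\<lambda>\<mu>. measure \<mu> UNIV)) {..<1}"
    by (subst emeasure_distr) (auto intro!: arg_cong[where f="emeasure L"])
  thus "emeasure L {\<mu> \<in> space L. measure \<mu> UNIV < 1} \<noteq> \<infinity>"
    using \<theta>_pos by (simp add: mass_law emeasure_power_law_lessThan)
  fix B :: "'a measure set" and r :: real
  assume B: "B \<in> sets prob_measures_algebra" and r: "0 < r"
  have m: "mult_action (\<lambda>_. 1 / r) \<in> measurable L finite_measures_algebra"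
    using r by (intro mult_action_L_measurable const_multiplier) simp
  let ?S = "{\<mu> \<in> space L. normalize_measure \<mu> \<in> B \<and> measure \<mu> UNIV < 1}"
  have "?S = (normalize_measure -` B \<inter> space L) \<inter> ((\<lambda>\<mu>. measure \<mu> UNIV) -` {..<1} \<inter> space L)" by auto
  also have "\<dots> \<in> sets L"
    using B by (intro sets.Int measurable_sets[OF normalize_measurable_L] measurable_sets[OF mass_measurable_L]) auto
  finally have S: "?S \<in> sets finite_measures_algebra" by (simp add: sets_L)
  have "emeasure (distr L finite_measures_algebra (mult_action (\<lambda>_. 1 / r))) ?S
    = emeasure L (mult_action (\<lambda>_. 1 / r) -` ?S \<inter> space L)"
    by (rule emeasure_distr[OF m S])
  also have "mult_action (\<lambda>_. 1 / r) -` ?S \<inter> space L = {\<mu> \<in> space L. normalize_measure \<mu> \<in> B \<and> measure \<mu> UNIV < r}"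
  proof -
    have "1 / r * t < 1 \<longleftrightarrow> t < r" for t using r by (simp add: field_simps)
    hence "mult_action (\<lambda>_. 1 / r) \<mu> \<in> ?S \<longleftrightarrow> normalize_measure \<mu> \<in> B \<and> measure \<mu> UNIV < r" if "\<mu> \<in> space L" for \<mu>
      using that r measurable_space[OF m that] mass_mult_action_const[of "1 / r" \<mu>] normalize_mult_action_const[of "1 / r" \<mu>]
      by (simp only: space_L space_finite_measures_algebra mem_Collect_eq zero_less_divide_1_iff True_implies_equals simp_thms)
    thus ?thesis by blast
  qed
  finally show "emeasure L {\<mu> \<in> space L. normalize_measure \<mu> \<in> B \<and> measure \<mu> UNIV < r}
    = ennreal (r powr \<theta>) * emeasure L ?S"
    using r by (simp add: distr_mult_action_const powr_divide powr_minus_divide)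
qed

lemma L_eq_distr:
  "L = distr (angular_law \<Otimes>\<^sub>M lambda_measure \<theta>) finite_measures_algebra (\<lambda>(\<eta>, t). scale_measure (ennreal t) \<eta>)"
proof -
  have pm: "(\<lambda>\<mu>. (normalize_measure \<mu>, measure \<mu> UNIV)) \<in> measurable L (prob_measures_algebra \<Otimes>\<^sub>M borel)"
    using normalize_measurable_L by (intro measurable_Pair) auto
  have "distr (angular_law \<Otimes>\<^sub>M lambda_measure \<theta>) finite_measures_algebra (\<lambda>(\<eta>, t). scale_measure (ennreal t) \<eta>)
    = distr L finite_measures_algebra ((\<lambda>(\<eta>, t). scale_measure (ennreal t) \<eta>) \<circ> (\<lambda>\<mu>. (normalize_measure \<mu>, measure \<mu> UNIV)))"
    unfolding polar_L[symmetric] by (rule distr_distr[OF scale_measure_measurable pm])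
  also have "\<dots> = distr L finite_measures_algebra (\<lambda>\<mu>. \<mu>)"
  proof (rule distr_cong_AE[OF refl refl])
    show "AE \<mu> in L. ((\<lambda>(\<eta>, t). scale_measure (ennreal t) \<eta>) \<circ> (\<lambda>\<mu>. (normalize_measure \<mu>, measure \<mu> UNIV))) \<mu> = \<mu>"
      using AE_mass_pos AE_space by eventually_elim (simp add: scale_mass_normalize_measure space_L)
    show "(\<lambda>(\<eta>, t). scale_measure (ennreal t) \<eta>) \<circ> (\<lambda>\<mu>. (normalize_measure \<mu>, measure \<mu> UNIV))
      \<in> measurable L finite_measures_algebra" by (rule measurable_comp[OF pm scale_measure_measurable])
    show "(\<lambda>\<mu>. \<mu>) \<in> measurable L finite_measures_algebra"
      by (rule measurable_ident_sets[OF sets_L, unfolded id_def])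
  qed
  also have "\<dots> = L" using sets_L[symmetric] by (rule distr_id2)
  finally show ?thesis by simp
qed

text \<open>Normalising a measure divides its vector of cell masses by the coordinate sum. Under the
  weighted measure these masses are independent Gamma variables, and this quotient is Ferguson's
  form of the Dirichlet law.\<close>

lemma dirichlet_ferguson_angular_law: "dirichlet_ferguson (tilted_intensity L) angular_law"
  unfolding dirichlet_ferguson_def
proof (intro conjI allI impI)
  show "sets angular_law = sets prob_measures_algebra" by (simp add: angular_law_def)
  have "emeasure (density L (\<lambda>\<mu>. ennreal (exp (- measure \<mu> UNIV)))) (space L) = 1"
    using laplace_L by (subst emeasure_density) (auto intro!: nn_integral_cong cong: nn_integral_cong)
  hence "prob_space (density L (\<lambda>\<mu>. ennreal (exp (- measure \<mu> UNIV))))" by (intro prob_spaceI) simp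
  thus "prob_space angular_law"
    unfolding angular_law_def using normalize_measurable_density by (rule prob_space.prob_space_distr)
  fix n :: nat and A :: "nat \<Rightarrow> 'a set" assume A: "borel_partition n A"
  obtain a where a: "\<And>i. 0 \<le> a i"
    and ev: "distr L (real_vectors {..<n}) (evaluate n A) = Pi\<^sub>M {..<n} (\<lambda>i. power_law (a i))"
    using distr_evaluate[OF A] by blast
  have evm: "evaluate n A \<in> measurable L (real_vectors {..<n})"
    unfolding measurable_L_cong using borel_partitionD(1)[OF A] by (rule evaluate_measurable)
  have evP: "evaluate n A \<in> measurable prob_measures_algebra (real_vectors {..<n})"
    using borel_partitionD(1)[OF A] by (rule evaluate_measurable)
  let ?d = "\<lambda>\<mu>. ennreal (exp (- measure \<mu> UNIV))"
  let ?N = "\<lambda>x. \<lambda>i\<in>{..<n}. x i / (\<Sum>j<n. x j)"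
  have "measure (tilted_intensity L) (A i) = a i" if "i < n" for i
    using emeasure_tilted_partition[OF A a ev that] a by (simp add: measure_def)
  hence dir: "dirichlet n (\<lambda>i. measure (tilted_intensity L) (A i)) =
      distr (Pi\<^sub>M {..<n} (\<lambda>i. gamma_law (a i))) (real_vectors {..<n}) ?N"
    unfolding dirichlet_def by (intro arg_cong[where f="\<lambda>M. distr M _ _"] PiM_cong) auto
  have "distr angular_law (real_vectors {..<n}) (evaluate n A)
    = distr (density L ?d) (real_vectors {..<n}) (evaluate n A \<circ> normalize_measure)"
    unfolding angular_law_def by (rule distr_distr[OF evP normalize_measurable_density])
  also have "\<dots> = distr (density L ?d) (real_vectors {..<n}) (?N \<circ> evaluate n A)"
  proof (rule distr_cong_AE[OF refl refl])
    show "evaluate n A \<circ> normalize_measure \<in> measurable (density L ?d) (real_vectors {..<n})"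
      by (rule measurable_comp[OF normalize_measurable_density evP])
    show "?N \<circ> evaluate n A \<in> measurable (density L ?d) (real_vectors {..<n})"
      using evm by (intro measurable_comp[OF _ normalized_measurable]) simp
    have "AE \<mu> in L. (evaluate n A \<circ> normalize_measure) \<mu> = (?N \<circ> evaluate n A) \<mu>"
      using AE_mass_pos AE_space
    proof eventually_elim
      case (elim \<mu>)
      hence "measure \<mu> UNIV \<noteq> 0" "\<mu> \<in> finite_borel_measures" by (auto simp: space_L)
      thus ?case
        using sum_evaluate_partition[OF A, of \<mu>]
        by (auto simp: evaluate_def measure_normalize_measure restrict_def)
    qed
    thus "AE \<mu> in density L ?d. (evaluate n A \<circ> normalize_measure) \<mu> = (?N \<circ> evaluate n A) \<mu>"
      by (subst AE_density) auto
  qed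
  also have "\<dots> = distr (distr (density L ?d) (real_vectors {..<n}) (evaluate n A)) (real_vectors {..<n}) ?N"
    using evm by (intro distr_distr[OF normalized_measurable, symmetric]) simp
  \<comment> \<open>The total mass is rewritten as the sum of the cell masses: the weight becomes a
    function of the image point, so it can be moved past the image measure.\<close>
  also have "distr (density L ?d) (real_vectors {..<n}) (evaluate n A)
    = distr (density L (\<lambda>\<mu>. ennreal (exp (- (\<Sum>i<n. evaluate n A \<mu> i))))) (real_vectors {..<n}) (evaluate n A)"
    by (intro arg_cong[where f="\<lambda>M. distr M _ _"] density_cong)
      (use evm in \<open>auto simp: space_L sum_evaluate_partition[OF A] intro!: AE_I2\<close>)
  also have "\<dots> = density (distr L (real_vectors {..<n}) (evaluate n A)) (\<lambda>x. ennreal (exp (- (\<Sum>i<n. x i))))"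
    by (intro density_distr[symmetric] evm) measurable
  also have "\<dots> = Pi\<^sub>M {..<n} (\<lambda>i. gamma_law (a i))"
    unfolding ev by (intro density_PiM_power_law a) auto
  finally show "distr angular_law (real_vectors {..<n}) (\<lambda>\<eta>. \<lambda>i\<in>{..<n}. measure \<eta> (A i)) =
      dirichlet n (\<lambda>i. measure (tilted_intensity L) (A i))"
    unfolding dir evaluate_def[abs_def] .
qed

theorem multiplicative_lebesgue_intensity: "multiplicative_lebesgue \<theta> intensity L"
  unfolding multiplicative_lebesgue_def
  using intensity \<theta>_pos dirichlet_ferguson_angular_law L_eq_distr by auto

end

section \<open>Invariance of the multiplicative Lebesgue measure\<close>

lemma measure_scale_measure_real:
  "measure (scale_measure (ennreal t) \<eta>) A = max 0 t * measure \<eta> A"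
  by (cases "0 \<le> t") (simp_all add: measure_def enn2real_mult ennreal_neg max_def)

text \<open>The bound r on the total mass makes the box of finite measure under the infinite measure
  L. Only upper bounds occur, so lowering a multiplier keeps a measure in the box; the later
  squeezing rests on this.\<close>

definition evaluation_box :: "('a::topological_space set \<times> real) set \<Rightarrow> real \<Rightarrow> 'a measure set" where
  "evaluation_box F r = {\<mu> \<in> finite_borel_measures. measure \<mu> UNIV < r \<and> (\<forall>(A, s)\<in>F. measure \<mu> A < s)}"

definition borel_constraints :: "('a::topological_space set \<times> real) set \<Rightarrow> bool" where
  "borel_constraints F \<longleftrightarrow> finite F \<and> (\<forall>(A, s)\<in>F. A \<in> sets borel)"

lemma evaluation_box_sets:
  fixes F :: "('a::metric_space set \<times> real) set"
  assumes "borel_constraints F"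
  shows "evaluation_box F r \<in> sets finite_measures_algebra"
proof -
  have "{\<mu> \<in> space finite_measures_algebra. measure \<mu> A < s} \<in> sets finite_measures_algebra"
    if "A \<in> sets borel" for A :: "'a set" and s
    using measure_measurable_finite_measures_algebra[OF that] by measurable
  hence "{\<mu> \<in> space finite_measures_algebra. measure \<mu> UNIV < r \<and> (\<forall>p\<in>F. measure \<mu> (fst p) < snd p)}
      \<in> sets finite_measures_algebra"
    using assms by (intro sets.sets_Collect_conj sets.sets_Collect_finite_All) (auto simp: borel_constraints_def)
  thus ?thesis by (simp add: evaluation_box_def space_finite_measures_algebra case_prod_beta)
qed

text \<open>For the inclusion of the Borel sets, the evaluation criterion is applied to the identity
  map from the sigma-algebra generated by the boxes.\<close>

lemma sets_finite_measures_algebra_evaluation_box: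
  "sets (finite_measures_algebra :: 'a::polish_space measure measure) =
    sigma_sets finite_borel_measures {evaluation_box F r |F r. borel_constraints F}"
    (is "_ = sigma_sets _ ?E")
proof
  have E: "?E \<subseteq> sets finite_measures_algebra" using evaluation_box_sets by blast
  show "sigma_sets finite_borel_measures ?E \<subseteq> sets (finite_measures_algebra :: 'a measure measure)"
    using sets.sigma_sets_subset[OF E] by (simp add: space_finite_measures_algebra)
  define N where "N = sigma (finite_borel_measures :: 'a measure set) ?E"
  have E': "?E \<subseteq> Pow finite_borel_measures" by (auto simp: evaluation_box_def)
  have spN: "space N = finite_borel_measures" and setsN: "sets N = sigma_sets finite_borel_measures ?E"
    unfolding N_def using E' by (auto intro!: space_measure_of sets_measure_of)
  have "(\<lambda>\<mu>. \<mu>) \<in> measurable N (finite_measures_algebra :: 'a measure measure)"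
  proof (rule measurable_finite_measures_algebraI)
    fix A :: "'a set" assume A: "A \<in> sets borel"
    have "(\<lambda>\<mu>. measure \<mu> A) \<in> borel_measurable N"
      unfolding borel_measurable_iff_less
    proof
      fix s :: real
      \<comment> \<open>A constraint on A alone is not a box; the union over all mass bounds n
        removes the bound on the total mass.\<close>
      have "{\<mu> \<in> space N. measure \<mu> A < s} = (\<Union>n. evaluation_box {(A, s)} (real n))"
        using reals_Archimedean2 by (auto simp: spN evaluation_box_def)
      also have "\<dots> \<in> sets N"
        unfolding setsN using A
        by (intro sigma_sets.Union sigma_sets.Basic) (auto simp: borel_constraints_def)
      finally show "{\<mu> \<in> space N. measure \<mu> A < s} \<in> sets N" .
    qed
    hence "(\<lambda>\<mu>. ennreal (measure \<mu> A)) \<in> borel_measurable N" by measurable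
    thus "(\<lambda>\<mu>. emeasure \<mu> A) \<in> borel_measurable N"
      by (rule measurable_cong[THEN iffD2, rotated])
        (simp add: spN finite_borel_measures_def finite_measure.emeasure_eq_measure)
  qed (simp add: spN)
  from measurable_sets[OF this]
  show "sets (finite_measures_algebra :: 'a measure measure) \<subseteq> sigma_sets finite_borel_measures ?E"
    unfolding setsN[symmetric]
    using sets.sets_into_space[where M="finite_measures_algebra :: 'a measure measure"]
    by (auto simp: spN space_finite_measures_algebra Int_absorb2)
qed

text \<open>Boxes with the mass bound alone already exhaust the space, so finiteness is asked for
  these only.\<close>

lemma finite_measures_algebra_eqI:
  fixes M N :: "'a::polish_space measure measure"
  assumes sets: "sets M = sets finite_measures_algebra" "sets N = sets finite_measures_algebra"
    and eq: "\<And>F r. borel_constraints F \<Longrightarrow> emeasure M (evaluation_box F r) = emeasure N (evaluation_box F r)"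
    and fin: "\<And>r. emeasure M (evaluation_box {} r) \<noteq> \<infinity>"
  shows "M = N"
proof (rule measure_eqI_generator_eq[where E="{evaluation_box F r |F r. borel_constraints F}"
      and \<Omega>=finite_borel_measures and A="\<lambda>n. evaluation_box {} (real n)"])
  have "evaluation_box F r \<inter> evaluation_box G s = evaluation_box (F \<union> G) (min r s)" for F G :: "('a set \<times> real) set" and r s
    by (auto simp: evaluation_box_def)
  moreover have "borel_constraints F \<Longrightarrow> borel_constraints G \<Longrightarrow> borel_constraints (F \<union> G)" for F G :: "('a set \<times> real) set"
    by (auto simp: borel_constraints_def)
  ultimately show "Int_stable {evaluation_box F r |F r. borel_constraints (F :: ('a set \<times> real) set)}"
    unfolding Int_stable_def by blast
  show "(\<Union>n. evaluation_box {} (real n)) = finite_borel_measures"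
    using reals_Archimedean2 by (auto simp: evaluation_box_def)
  show "range (\<lambda>n. evaluation_box {} (real n)) \<subseteq> {evaluation_box F r |F r. borel_constraints (F :: ('a set \<times> real) set)}"
    by (auto simp: borel_constraints_def)
qed (use assms sets_finite_measures_algebra_evaluation_box[where 'a='a] in \<open>auto simp: evaluation_box_def\<close>)

text \<open>The cells are the level sets of g, which records the constraints whose set contains x
  together with the value b x. This map has finite range, and its level sets refine both b and every
  set in F.\<close>

lemma simple_function_partition:
  fixes F :: "('a::topological_space set \<times> real) set" and b :: "'a \<Rightarrow> real"
  assumes F: "borel_constraints F" and b: "b \<in> borel_measurable borel" "finite (range b)"
  obtains n B v where "borel_partition n B" "\<And>i x. i < n \<Longrightarrow> x \<in> B i \<Longrightarrow> b x = v i"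
    "\<And>A s. (A, s) \<in> F \<Longrightarrow> A = (\<Union>i\<in>{i. i < n \<and> B i \<subseteq> A}. B i)"
proof -
  define g where "g x = ({p \<in> F. x \<in> fst p}, b x)" for x
  have "range g \<subseteq> Pow F \<times> range b" by (auto simp: g_def)
  hence "finite (range g)"
    using F b(2) by (elim finite_subset) (auto simp: borel_constraints_def)
  then obtain e where e: "bij_betw e {..<card (range g)} (range g)"
    using ex_bij_betw_nat_finite[of "range g"] by (auto simp: atLeast0LessThan)
  let ?n = "card (range g)"
  define B where "B i = g -` {e i}" for i
  have cover: "\<exists>i<?n. x \<in> B i" for x
  proof -
    have "g x \<in> e ` {..<?n}" using e by (simp add: bij_betw_def)
    thus ?thesis by (auto simp: B_def)
  qed
  have "B i \<in> sets borel" for i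
  proof -
    \<comment> \<open>The last factor is either everything or empty. It equals everything for
      indices below n; it is there because \<open>e i\<close> is arbitrary for the others.\<close>
    have "B i = (b -` {snd (e i)} \<inter> space borel) \<inter> {x \<in> space borel. \<forall>p\<in>F. x \<in> fst p \<longleftrightarrow> p \<in> fst (e i)}
      \<inter> {x. fst (e i) \<subseteq> F}"
    proof -
      have "{p \<in> F. x \<in> fst p} = S \<longleftrightarrow> S \<subseteq> F \<and> (\<forall>p\<in>F. x \<in> fst p \<longleftrightarrow> p \<in> S)" for x S by blast
      hence "g x = e i \<longleftrightarrow> b x = snd (e i) \<and> (\<forall>p\<in>F. x \<in> fst p \<longleftrightarrow> p \<in> fst (e i)) \<and> fst (e i) \<subseteq> F" for x
        unfolding g_def prod_eq_iff fst_conv snd_conv by blast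
      thus ?thesis by (intro set_eqI) (simp add: B_def)
    qed
    also have "\<dots> \<in> sets borel"
    proof (rule sets.Int[OF sets.Int])
      show "b -` {snd (e i)} \<inter> space borel \<in> sets borel" using b(1) by (rule measurable_sets) simp
      have "{x \<in> space borel. x \<in> fst p \<longleftrightarrow> p \<in> fst (e i)} \<in> sets borel" if "p \<in> F" for p
      proof -
        have "fst p \<in> sets borel" using F that by (auto simp: borel_constraints_def)
        moreover have "{x \<in> space borel. x \<in> fst p \<longleftrightarrow> p \<in> fst (e i)} = (if p \<in> fst (e i) then fst p else - fst p)"
          by auto
        ultimately show ?thesis by (simp add: borel_comp)
      qed
      thus "{x \<in> space borel. \<forall>p\<in>F. x \<in> fst p \<longleftrightarrow> p \<in> fst (e i)} \<in> sets borel"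
        using F by (intro sets.sets_Collect_finite_All) (auto simp: borel_constraints_def)
    qed simp
    finally show ?thesis .
  qed
  moreover have "disjoint_family_on B {..<?n}"
    using e by (auto simp: disjoint_family_on_def B_def bij_betw_def inj_on_def)
  moreover have "(\<Union>i<?n. B i) = UNIV" using cover by blast
  ultimately have "borel_partition ?n B" by (simp add: borel_partition_def)
  moreover have "b x = snd (e i)" if "x \<in> B i" for i x using that by (simp add: B_def g_def prod_eq_iff)
  moreover have "A = (\<Union>i\<in>{i. i < ?n \<and> B i \<subseteq> A}. B i)" if "(A, s) \<in> F" for A s
  proof (intro subset_antisym subsetI)
    fix x assume x: "x \<in> A"
    obtain i where i: "i < ?n" "x \<in> B i" using cover by blast
    have "B i \<subseteq> A"
    proof
      fix y assume "y \<in> B i"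
      hence "g y = g x" using i(2) by (simp add: B_def)
      hence "(A, s) \<in> {p \<in> F. y \<in> fst p}" using x that by (auto simp: g_def)
      thus "y \<in> A" by simp
    qed
    thus "x \<in> (\<Union>i\<in>{i. i < ?n \<and> B i \<subseteq> A}. B i)" using i by blast
  qed auto
  ultimately show thesis by (rule that)
qed

section \<open>Step multipliers acting on the multiplicative Lebesgue measure\<close>

context
  fixes \<theta> :: real and \<nu> :: "'a::polish_space measure" and L :: "'a measure measure"
  assumes leb: "multiplicative_lebesgue \<theta> \<nu> L"
begin

interpretation \<nu>: prob_space \<nu> using leb by (simp add: multiplicative_lebesgue_def)

lemma leb_basic: "0 < \<theta>" "sets \<nu> = sets borel" "sets L = sets finite_measures_algebra" "space L = finite_borel_measures"
  using leb by (auto simp: multiplicative_lebesgue_def space_finite_measures_algebra)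

lemma leb_measurable_cong: "measurable L N = measurable finite_measures_algebra N"
  by (rule measurable_cong_sets[OF leb_basic(3) refl])

lemma space_nu: "space \<nu> = UNIV"
  using sets_eq_imp_space_eq[OF leb_basic(2)] by simp

lemma sum_measure_partition:
  assumes A: "borel_partition n A"
  shows "(\<Sum>i<n. \<theta> * measure \<nu> (A i)) = \<theta>"
proof -
  have "\<nu> \<in> finite_borel_measures" using leb_basic(2) \<nu>.finite_measure_axioms by (simp add: finite_borel_measures_def)
  thus ?thesis
    using sum_evaluate_partition[OF A, of \<nu>] \<nu>.prob_space by (simp add: evaluate_def space_nu flip: sum_distrib_left)
qed

text \<open>Evaluation on the cells commutes with scaling, so the marginal recombines a Dirichlet
  direction with an independent total of law \<open>lambda_measure \<theta>\<close>. This inverts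
  the polar formula because the Dirichlet parameters add up to the same \<theta>, which is the total
  mass of the intensity \<theta>\<nu>.\<close>

lemma leb_marginal:
  assumes A: "borel_partition n A"
  shows "distr L (real_vectors {..<n}) (evaluate n A) = Pi\<^sub>M {..<n} (\<lambda>i. power_law (\<theta> * measure \<nu> (A i)))"
proof -
  obtain D where D: "dirichlet_ferguson (scale_measure (ennreal \<theta>) \<nu>) D"
    and L: "L = distr (D \<Otimes>\<^sub>M lambda_measure \<theta>) finite_measures_algebra (\<lambda>(\<eta>, t). scale_measure (ennreal t) \<eta>)"
    using leb by (auto simp: multiplicative_lebesgue_def)
  let ?a = "\<lambda>i. \<theta> * measure \<nu> (A i)"
  have \<theta>: "0 < \<theta>" by (rule leb_basic)
  have a: "0 \<le> ?a i" for i using \<theta> by simp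
  have sD: "sets D = sets prob_measures_algebra" and pD: "prob_space D"
    using D by (auto simp: dirichlet_ferguson_def)
  have dD: "distr D (real_vectors {..<n}) (evaluate n A) = distr (Pi\<^sub>M {..<n} (\<lambda>i. gamma_law (?a i)))
      (real_vectors {..<n}) (\<lambda>x. \<lambda>i\<in>{..<n}. x i / (\<Sum>j<n. x j))"
    using D A \<theta> by (simp add: dirichlet_ferguson_def dirichlet_def evaluate_def[abs_def] measure_scale_measure_real)
  have lam: "lambda_measure \<theta> = power_law \<theta>" using \<theta> by (simp add: power_law_def)
  have evD: "evaluate n A \<in> measurable D (real_vectors {..<n})"
    unfolding measurable_cong_sets[OF sD refl] by (rule evaluate_measurable(2)[OF borel_partitionD(1)[OF A]])
  have evF: "evaluate n A \<in> measurable finite_measures_algebra (real_vectors {..<n})"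
    using borel_partitionD(1)[OF A] by (rule evaluate_measurable)
  have sDl: "sets (D \<Otimes>\<^sub>M lambda_measure \<theta>) = sets (prob_measures_algebra \<Otimes>\<^sub>M borel)"
    by (intro sets_pair_measure_cong sD) (simp add: lam)
  have sc: "(\<lambda>(\<eta>, t). scale_measure (ennreal t) \<eta>) \<in> measurable (D \<Otimes>\<^sub>M lambda_measure \<theta>) finite_measures_algebra"
    unfolding measurable_cong_sets[OF sDl refl] by (rule scale_measure_measurable)
  have id: "(\<lambda>t. t) \<in> measurable (lambda_measure \<theta>) borel" by (simp add: lam)
  have did: "distr (lambda_measure \<theta>) borel (\<lambda>t. t) = lambda_measure \<theta>" by (rule distr_id2) (simp add: lam)
  have mm: "(\<lambda>(x, t). \<lambda>i\<in>{..<n}. max 0 t * x i) \<in> measurable (real_vectors {..<n} \<Otimes>\<^sub>M borel) (real_vectors {..<n})"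
    by measurable
  have pm: "(\<lambda>(\<eta>, t). (evaluate n A \<eta>, t)) \<in> measurable (D \<Otimes>\<^sub>M lambda_measure \<theta>) (real_vectors {..<n} \<Otimes>\<^sub>M borel)"
    using evD id by measurable
  have "distr L (real_vectors {..<n}) (evaluate n A)
    = distr (D \<Otimes>\<^sub>M lambda_measure \<theta>) (real_vectors {..<n}) (evaluate n A \<circ> (\<lambda>(\<eta>, t). scale_measure (ennreal t) \<eta>))"
    unfolding L by (rule distr_distr[OF evF sc])
  also have "evaluate n A \<circ> (\<lambda>(\<eta>, t). scale_measure (ennreal t) \<eta>)
    = (\<lambda>(x, t). \<lambda>i\<in>{..<n}. max 0 t * x i) \<circ> (\<lambda>(\<eta>, t). (evaluate n A \<eta>, t))"
    by (auto simp: fun_eq_iff evaluate_def measure_scale_measure_real)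
  also have "distr (D \<Otimes>\<^sub>M lambda_measure \<theta>) (real_vectors {..<n}) \<dots> =
    distr (distr (D \<Otimes>\<^sub>M lambda_measure \<theta>) (real_vectors {..<n} \<Otimes>\<^sub>M borel) (\<lambda>(\<eta>, t). (evaluate n A \<eta>, t)))
      (real_vectors {..<n}) (\<lambda>(x, t). \<lambda>i\<in>{..<n}. max 0 t * x i)"
    by (rule distr_distr[OF mm pm, symmetric])
  also have "distr (D \<Otimes>\<^sub>M lambda_measure \<theta>) (real_vectors {..<n} \<Otimes>\<^sub>M borel) (\<lambda>(\<eta>, t). (evaluate n A \<eta>, t))
    = distr D (real_vectors {..<n}) (evaluate n A) \<Otimes>\<^sub>M distr (lambda_measure \<theta>) borel (\<lambda>t. t)"
    by (intro pair_measure_distr[symmetric] evD id) (subst did, subst lam, rule sigma_finite_power_law)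
  also have "distr (distr D (real_vectors {..<n}) (evaluate n A) \<Otimes>\<^sub>M distr (lambda_measure \<theta>) borel (\<lambda>t. t))
      (real_vectors {..<n}) (\<lambda>(x, t). \<lambda>i\<in>{..<n}. max 0 t * x i) = Pi\<^sub>M {..<n} (\<lambda>i. power_law (?a i))"
    unfolding did dD using a \<theta> sum_measure_partition[OF A]
    by (intro distr_polar_PiM_power_law) auto
  finally show ?thesis .
qed

text \<open>This is the marginal on the partition with the single cell \<open>UNIV\<close>, whose
  exponent is \<theta>.\<close>

lemma leb_mass:
  assumes S: "S \<in> sets borel"
  shows "emeasure L {\<mu> \<in> finite_borel_measures. measure \<mu> UNIV \<in> S} = emeasure (power_law \<theta>) S"
proof -
  let ?A = "\<lambda>_ :: nat. UNIV :: 'a set"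
  have A: "borel_partition 1 ?A" by (auto simp: borel_partition_def disjoint_family_on_def)
  interpret product_sigma_finite "\<lambda>i :: nat. power_law (\<theta> * measure \<nu> (?A i))" by (rule product_sigma_finite_power_law)
  have "emeasure (power_law \<theta>) S = emeasure (Pi\<^sub>M {..<1} (\<lambda>i. power_law (\<theta> * measure \<nu> (?A i)))) (Pi\<^sub>E {..<1} (\<lambda>_. S))"
    using S \<nu>.prob_space by (subst emeasure_PiM) (auto simp: space_nu)
  also have "\<dots> = emeasure (distr L (real_vectors {..<1}) (evaluate 1 ?A)) (Pi\<^sub>E {..<1} (\<lambda>_. S))"
    by (simp only: leb_marginal[OF A])
  also have "\<dots> = emeasure L (evaluate 1 ?A -` (Pi\<^sub>E {..<1} (\<lambda>_. S)) \<inter> space L)"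
    using S evaluate_measurable(1)[OF borel_partitionD(1)[OF A]]
    by (intro emeasure_distr sets_PiM_I_finite) (auto simp: leb_measurable_cong)
  also have "evaluate 1 ?A -` (Pi\<^sub>E {..<1} (\<lambda>_. S)) \<inter> space L = {\<mu> \<in> finite_borel_measures. measure \<mu> UNIV \<in> S}"
    by (auto simp: evaluate_def leb_basic(4) PiE_def Pi_iff)
  finally show ?thesis by simp
qed

text \<open>On a partition adapted to both b and F, the box is a condition T on the vector of cell
  masses and the multiplier is a coordinatewise rescaling. The scaling law of the product of power
  laws then gives the factor.\<close>

lemma leb_simple_multiplier:
  assumes F: "borel_constraints F" and b: "b \<in> borel_measurable borel" "finite (range b)"
  shows "emeasure L {\<mu> \<in> finite_borel_measures. mult_action (\<lambda>x. exp (b x)) \<mu> \<in> evaluation_box F r}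
    = ennreal (exp (- (\<theta> * (LINT x|\<nu>. b x)))) * emeasure L (evaluation_box F r)"
proof -
  obtain n B v where B: "borel_partition n B" and v: "\<And>i x. i < n \<Longrightarrow> x \<in> B i \<Longrightarrow> b x = v i"
    and FB: "\<And>A s. (A, s) \<in> F \<Longrightarrow> A = (\<Union>i\<in>{i. i < n \<and> B i \<subseteq> A}. B i)"
    using simple_function_partition[OF F b] by blast
  let ?P = "Pi\<^sub>M {..<n} (\<lambda>i. power_law (\<theta> * measure \<nu> (B i)))"
  define T where "T = {x \<in> space (real_vectors {..<n}). (\<Sum>i<n. x i) < r \<and>
      (\<forall>p\<in>F. (\<Sum>i\<in>{i. i < n \<and> B i \<subseteq> fst p}. x i) < snd p)}"
  have T: "T \<in> sets (real_vectors {..<n})"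
  proof -
    have "{x \<in> space (real_vectors {..<n}). (\<Sum>i\<in>J. x i) < s} \<in> sets (real_vectors {..<n})"
      if "J \<subseteq> {..<n}" for J s
    proof -
      have "(\<lambda>x. \<Sum>i\<in>J. x i) \<in> borel_measurable (real_vectors {..<n})"
        using that by (intro borel_measurable_sum measurable_component_singleton) auto
      thus ?thesis by measurable
    qed
    thus ?thesis unfolding T_def using F
      by (intro sets.sets_Collect_conj sets.sets_Collect_finite_All) (auto simp: borel_constraints_def)
  qed
  have box: "\<mu> \<in> evaluation_box F r \<longleftrightarrow> evaluate n B \<mu> \<in> T" if \<mu>: "\<mu> \<in> finite_borel_measures" for \<mu>
  proof -
    interpret finite_measure \<mu> by (rule finite_borel_measuresD(2)[OF \<mu>])
    have "measure \<mu> A = (\<Sum>i\<in>{i. i < n \<and> B i \<subseteq> A}. evaluate n B \<mu> i)" if "(A, s) \<in> F" for A s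
    proof -
      have "measure \<mu> (\<Union>i\<in>{i. i < n \<and> B i \<subseteq> A}. B i) = (\<Sum>i\<in>{i. i < n \<and> B i \<subseteq> A}. measure \<mu> (B i))"
        using borel_partitionD(1,2)[OF B] finite_borel_measuresD(1)[OF \<mu>]
        by (intro finite_measure_finite_Union) (auto intro: disjoint_family_on_mono[rotated])
      thus ?thesis using FB[OF that] by (simp add: evaluate_def)
    qed
    hence "(\<forall>(A, s)\<in>F. measure \<mu> A < s) \<longleftrightarrow> (\<forall>p\<in>F. (\<Sum>i\<in>{i. i < n \<and> B i \<subseteq> fst p}. evaluate n B \<mu> i) < snd p)"
      by (intro ball_cong refl) auto
    moreover have "evaluate n B \<mu> \<in> space (real_vectors {..<n})"
      by (simp add: evaluate_def space_real_vectors)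
    ultimately show ?thesis
      using \<mu> by (simp add: evaluation_box_def T_def sum_evaluate_partition[OF B \<mu>])
  qed
  have ev: "evaluate n B \<in> measurable L (real_vectors {..<n})"
    unfolding leb_measurable_cong using borel_partitionD(1)[OF B] by (rule evaluate_measurable)
  have evT: "emeasure ?P T' = emeasure L {\<mu> \<in> finite_borel_measures. evaluate n B \<mu> \<in> T'}"
    if "T' \<in> sets (real_vectors {..<n})" for T'
    unfolding leb_marginal[OF B, symmetric] emeasure_distr[OF ev that]
    by (intro arg_cong[where f="emeasure L"]) (auto simp: leb_basic(4))
  obtain K where K: "\<And>x. b x \<le> K" using b(2) by (metis Max_ge rangeI)
  have act: "evaluate n B (mult_action (\<lambda>x. exp (b x)) \<mu>) = rescale {..<n} (\<lambda>i. exp (v i)) (evaluate n B \<mu>)"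
    if \<mu>: "\<mu> \<in> finite_borel_measures" for \<mu>
  proof -
    have "measure (mult_action (\<lambda>x. exp (b x)) \<mu>) (B i) = exp (v i) * measure \<mu> (B i)" if "i < n" for i
      using b(1) v[OF that] \<mu> borel_partitionD(1)[OF B that] by (intro measure_mult_action_const_on) auto
    thus ?thesis by (auto simp: evaluate_def rescale_def)
  qed
  have act_mem: "mult_action (\<lambda>x. exp (b x)) \<mu> \<in> finite_borel_measures" if "\<mu> \<in> finite_borel_measures" for \<mu>
    using b(1) K that by (intro mult_action_finite_borel_measures[of _ "exp K"]) auto
  have R: "rescale {..<n} (\<lambda>i. exp (v i)) \<in> measurable ?P (real_vectors {..<n})" by measurable
  have "{\<mu> \<in> finite_borel_measures. mult_action (\<lambda>x. exp (b x)) \<mu> \<in> evaluation_box F r}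
    = {\<mu> \<in> finite_borel_measures. evaluate n B \<mu> \<in> rescale {..<n} (\<lambda>i. exp (v i)) -` T \<inter> space ?P}"
    using box[OF act_mem] act by (auto simp: evaluate_def)
  hence "emeasure L {\<mu> \<in> finite_borel_measures. mult_action (\<lambda>x. exp (b x)) \<mu> \<in> evaluation_box F r}
    = emeasure ?P (rescale {..<n} (\<lambda>i. exp (v i)) -` T \<inter> space ?P)"
    using evT[of "rescale {..<n} (\<lambda>i. exp (v i)) -` T \<inter> space ?P"] measurable_sets[OF R T] by simp
  also have "\<dots> = emeasure (distr ?P (real_vectors {..<n}) (rescale {..<n} (\<lambda>i. exp (v i)))) T"
    by (rule emeasure_distr[OF R T, symmetric])
  also have "\<dots> = ennreal (\<Prod>i<n. exp (v i) powr - (\<theta> * measure \<nu> (B i))) * emeasure ?P T"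
    using leb_basic(1) by (subst distr_rescale_PiM_power_law) auto
  also have "emeasure ?P T = emeasure L (evaluation_box F r)"
    unfolding evT[OF T] using box by (intro arg_cong[where f="emeasure L"]) (auto simp: evaluation_box_def)
  \<comment> \<open>The exponents are \<theta> times the \<nu>-measures of the cells, so the product
    of powers assembles into the exponential of an integral of the step function.\<close>
  also have "(\<Prod>i<n. exp (v i) powr - (\<theta> * measure \<nu> (B i))) = exp (- (\<theta> * (\<Sum>i<n. v i * measure \<nu> (B i))))"
    by (simp add: powr_def exp_sum[symmetric] sum_distrib_left sum_negf[symmetric] ac_simps)
  also have "(\<Sum>i<n. v i * measure \<nu> (B i)) = (LINT x|\<nu>. b x)"
  proof -
    have Bs: "B i \<in> sets \<nu>" if "i < n" for i using borel_partitionD(1)[OF B that] leb_basic(2) by simp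
    have "b x = (\<Sum>i<n. v i * indicator (B i) x)" for x
    proof -
      obtain i where i: "i < n" "x \<in> B i" using borel_partitionD(3)[OF B] by blast
      have "(\<Sum>j<n. v j * indicator (B j) x) = (\<Sum>j<n. if j = i then v i else 0)"
        using i borel_partitionD(2)[OF B] by (intro sum.cong refl) (auto simp: indicator_def disjoint_family_on_def)
      thus ?thesis using i v by simp
    qed
    hence "(LINT x|\<nu>. b x) = (LINT x|\<nu>. (\<Sum>i<n. v i * indicator (B i) x))" by simp
    also have "\<dots> = (\<Sum>i<n. LINT x|\<nu>. v i * indicator (B i) x)"
      using Bs by (intro Bochner_Integration.integral_sum) (auto simp: \<nu>.emeasure_eq_measure intro!: integrable_real_indicator)
    also have "\<dots> = (\<Sum>i<n. v i * measure \<nu> (B i))"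
      using Bs by (intro sum.cong refl) (simp add: space_nu)
    finally show ?thesis by simp
  qed
  finally show ?thesis .
qed

end

section \<open>From step functions to bounded Borel functions\<close>

lemma measure_mult_action_mono:
  assumes "k \<in> borel_measurable borel" "l \<in> borel_measurable borel" "\<And>x. k x \<le> l x" "\<And>x. l x \<le> K"
    and "\<mu> \<in> finite_borel_measures" "A \<in> sets borel"
  shows "measure (mult_action k \<mu>) A \<le> measure (mult_action l \<mu>) A"
proof -
  have "emeasure (mult_action k \<mu>) A \<le> emeasure (mult_action l \<mu>) A"
    unfolding emeasure_mult_action[OF assms(1,5,6)] emeasure_mult_action[OF assms(2,5,6)]
    by (intro nn_integral_mono mult_right_mono ennreal_leI assms(3)) auto
  moreover have "finite_measure (mult_action l \<mu>)"
    by (rule finite_borel_measuresD(2)[OF mult_action_finite_borel_measures[OF assms(2,4,5)]])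
  ultimately show ?thesis unfolding measure_def by (intro enn2real_mono) (auto simp: less_top[symmetric] finite_measure.emeasure_finite)
qed

text \<open>A smaller multiplier lowers the mass of every set, and a box imposes only upper
  bounds.\<close>

lemma mult_action_evaluation_box_mono:
  assumes "a \<in> borel_measurable borel" "b \<in> borel_measurable borel" "\<And>x. a x \<le> b x" "\<And>x. b x \<le> K"
    and "\<mu> \<in> finite_borel_measures" "borel_constraints F"
    and "mult_action (\<lambda>x. exp (b x)) \<mu> \<in> evaluation_box F r"
  shows "mult_action (\<lambda>x. exp (a x)) \<mu> \<in> evaluation_box F r"
proof -
  have "measure (mult_action (\<lambda>x. exp (a x)) \<mu>) A \<le> measure (mult_action (\<lambda>x. exp (b x)) \<mu>) A"
    if "A \<in> sets borel" for A
    using assms(1-5) that by (intro measure_mult_action_mono[where K="exp K"]) auto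
  moreover have "mult_action (\<lambda>x. exp (a x)) \<mu> \<in> finite_borel_measures"
    using assms(1,5) order_trans[OF assms(3,4)] by (intro mult_action_finite_borel_measures[where K="exp K"]) auto
  ultimately show ?thesis
    using assms(6,7) by (fastforce simp: evaluation_box_def borel_constraints_def intro: le_less_trans)
qed

text \<open>Rounding a down to multiples of \<epsilon> = 1 / (m + 1) gives b with b \<le> a \<le> b
  + \<epsilon>; both bounds have finite range because a is bounded. The step case traps the measure
  within factors \<open>exp (- \<theta> * \<epsilon>)\<close> and
  \<open>exp (\<theta> * \<epsilon>)\<close> of the claimed value.\<close>

lemma multiplicative_lebesgue_multiplier:
  fixes L :: "'a::polish_space measure measure"
  assumes leb: "multiplicative_lebesgue \<theta> \<nu> L"
    and F: "borel_constraints F" and a: "a \<in> borel_measurable borel" "\<And>x. \<bar>a x\<bar> \<le> K"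
  shows "emeasure L {\<mu> \<in> finite_borel_measures. mult_action (\<lambda>x. exp (a x)) \<mu> \<in> evaluation_box F r}
    = ennreal (exp (- (\<theta> * (LINT x|\<nu>. a x)))) * emeasure L (evaluation_box F r)" (is "emeasure L ?S = _")
    and "emeasure L (evaluation_box F r) \<noteq> \<infinity>"
proof -
  note basic = leb_basic[OF leb]
  interpret \<nu>: prob_space \<nu> using leb by (simp add: multiplicative_lebesgue_def)
  have set_L: "{\<mu> \<in> finite_borel_measures. mult_action (\<lambda>x. exp (b x)) \<mu> \<in> evaluation_box F r} \<in> sets L"
    if b: "b \<in> borel_measurable borel" "\<And>x. b x \<le> C" for b and C :: real
  proof -
    have "mult_action (\<lambda>x. exp (b x)) \<in> measurable finite_measures_algebra finite_measures_algebra"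
      using b by (intro mult_action_measurable[where K="exp C"]) auto
    from measurable_sets[OF this evaluation_box_sets[OF F, of r]]
    have "mult_action (\<lambda>x. exp (b x)) -` evaluation_box F r \<inter> finite_borel_measures \<in> sets L"
      by (simp add: basic space_finite_measures_algebra)
    also have "mult_action (\<lambda>x. exp (b x)) -` evaluation_box F r \<inter> finite_borel_measures
      = {\<mu> \<in> finite_borel_measures. mult_action (\<lambda>x. exp (b x)) \<mu> \<in> evaluation_box F r}" by auto
    finally show ?thesis .
  qed
  have "evaluation_box F r \<subseteq> {\<mu> \<in> finite_borel_measures. measure \<mu> UNIV \<in> {..<r}}"
    by (auto simp: evaluation_box_def)
  moreover have "{\<mu> \<in> finite_borel_measures. measure \<mu> (UNIV::'a set) \<in> {..<r}} \<in> sets L"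
    using evaluation_box_sets[of "{}" r] by (simp add: evaluation_box_def borel_constraints_def basic)
  ultimately have "emeasure L (evaluation_box F r) \<le> emeasure L {\<mu> \<in> finite_borel_measures. measure \<mu> UNIV \<in> {..<r}}"
    by (rule emeasure_mono)
  also have "\<dots> = emeasure (power_law \<theta>) {..<r}" by (rule leb_mass[OF leb]) simp
  also have "\<dots> < \<infinity>" using basic(1) by (simp add: emeasure_power_law_lessThan)
  finally show fin: "emeasure L (evaluation_box F r) \<noteq> \<infinity>" by simp
  define l where "l = measure L (evaluation_box F r)"
  have l: "emeasure L (evaluation_box F r) = ennreal l" "0 \<le> l"
    using fin by (auto simp: l_def emeasure_eq_ennreal_measure)
  let ?E = "exp (- (\<theta> * (LINT x|\<nu>. a x)))"
  have a\<nu>: "a \<in> borel_measurable \<nu>" using a(1) measurable_cong_sets[OF basic(2) refl] by blast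
  have inta: "integrable \<nu> a" by (rule \<nu>.integrable_const_bound[of _ K]) (use a(2) a\<nu> in auto)
  have bounds: "ennreal (?E * exp (- \<theta> / real (Suc m)) * l) \<le> emeasure L ?S \<and>
      emeasure L ?S \<le> ennreal (?E * exp (\<theta> / real (Suc m)) * l)" for m
  proof -
    define b where "b x = real_of_int \<lfloor>real (Suc m) * a x\<rfloor> / real (Suc m)" for x
    define \<epsilon> where "\<epsilon> = 1 / real (Suc m)"
    have bm: "b \<in> borel_measurable borel" unfolding b_def[abs_def] using a(1) by measurable
    have ba: "b x \<le> a x" "a x \<le> b x + \<epsilon>" for x
    proof -
      have "real_of_int \<lfloor>real (Suc m) * a x\<rfloor> \<le> real (Suc m) * a x"
        "real (Suc m) * a x \<le> real_of_int \<lfloor>real (Suc m) * a x\<rfloor> + 1" by linarith+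
      thus "b x \<le> a x" "a x \<le> b x + \<epsilon>" unfolding b_def \<epsilon>_def by (simp_all add: field_simps)
    qed
    have "range b \<subseteq> (\<lambda>i. real_of_int i / real (Suc m)) ` {\<lfloor>- (real (Suc m) * K)\<rfloor>..\<lfloor>real (Suc m) * K\<rfloor>}"
    proof
      fix y assume "y \<in> range b"
      then obtain x where y: "y = b x" by blast
      have "- K \<le> a x" "a x \<le> K" using a(2)[of x] by linarith+
      hence "real (Suc m) * - K \<le> real (Suc m) * a x" "real (Suc m) * a x \<le> real (Suc m) * K"
        by (intro mult_left_mono; simp)+
      hence "\<lfloor>real (Suc m) * a x\<rfloor> \<in> {\<lfloor>- (real (Suc m) * K)\<rfloor>..\<lfloor>real (Suc m) * K\<rfloor>}"
        by (simp add: floor_mono)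
      thus "y \<in> (\<lambda>i. real_of_int i / real (Suc m)) ` {\<lfloor>- (real (Suc m) * K)\<rfloor>..\<lfloor>real (Suc m) * K\<rfloor>}"
        by (simp add: y b_def)
    qed
    hence fb: "finite (range b)" by (rule finite_subset) simp
    hence "finite ((\<lambda>y. y + \<epsilon>) ` range b)" by simp
    hence fb': "finite (range (\<lambda>x. b x + \<epsilon>))" by (simp add: image_image)
    have bK: "b x \<le> K" for x using ba(1)[of x] a(2)[of x] by linarith
    have b\<nu>: "b \<in> borel_measurable \<nu>" using bm measurable_cong_sets[OF basic(2) refl] by blast
    have intb: "integrable \<nu> b"
      using fb by (intro \<nu>.integrable_const_bound[of _ "K + \<epsilon>"] b\<nu>)
        (use ba a(2) in \<open>auto intro!: AE_I2 simp: abs_le_iff; smt (verit)\<close>)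
    have int1: "(LINT x|\<nu>. b x) \<le> (LINT x|\<nu>. a x)" using ba(1) by (intro integral_mono intb inta)
    have int2: "(LINT x|\<nu>. b x + \<epsilon>) = (LINT x|\<nu>. b x) + \<epsilon>"
      using intb \<nu>.prob_space by simp
    have int3: "(LINT x|\<nu>. a x) \<le> (LINT x|\<nu>. b x + \<epsilon>)" using ba(2) intb by (intro integral_mono inta) auto
    \<comment> \<open>The order reverses: the larger the exponent, the fewer measures are still
      carried into the box. So b gives the upper bound and b + \<epsilon> the lower one.\<close>
    have "emeasure L ?S \<le> emeasure L {\<mu> \<in> finite_borel_measures. mult_action (\<lambda>x. exp (b x)) \<mu> \<in> evaluation_box F r}"
      using mult_action_evaluation_box_mono[OF bm a(1) ba(1) _ _ F] a(2)
      by (intro emeasure_mono set_L[OF bm bK]) (auto simp: abs_le_iff)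
    also have "\<dots> = ennreal (exp (- (\<theta> * (LINT x|\<nu>. b x))) * l)"
      using l by (simp add: leb_simple_multiplier[OF leb F bm fb] ennreal_mult)
    also have "exp (- (\<theta> * (LINT x|\<nu>. b x))) \<le> ?E * exp (\<theta> / real (Suc m))"
    proof -
      have "(LINT x|\<nu>. a x) - \<epsilon> \<le> (LINT x|\<nu>. b x)" using int2 int3 by simp
      hence "\<theta> * ((LINT x|\<nu>. a x) - \<epsilon>) \<le> \<theta> * (LINT x|\<nu>. b x)" using basic(1) by (intro mult_left_mono) auto
      thus ?thesis by (simp add: \<epsilon>_def algebra_simps flip: exp_add)
    qed
    hence "ennreal (exp (- (\<theta> * (LINT x|\<nu>. b x))) * l) \<le> ennreal (?E * exp (\<theta> / real (Suc m)) * l)"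
      using l(2) by (intro ennreal_leI mult_right_mono)
    finally have 1: "emeasure L ?S \<le> ennreal (?E * exp (\<theta> / real (Suc m)) * l)" .
    have "?E * exp (- \<theta> / real (Suc m)) \<le> exp (- (\<theta> * (LINT x|\<nu>. b x + \<epsilon>)))"
    proof -
      have "\<theta> * (LINT x|\<nu>. b x) \<le> \<theta> * (LINT x|\<nu>. a x)" using int1 basic(1) by (intro mult_left_mono) auto
      thus ?thesis unfolding int2 by (simp add: \<epsilon>_def algebra_simps flip: exp_add)
    qed
    hence "ennreal (?E * exp (- \<theta> / real (Suc m)) * l) \<le> ennreal (exp (- (\<theta> * (LINT x|\<nu>. b x + \<epsilon>))) * l)"
      using l(2) by (intro ennreal_leI mult_right_mono)
    also have "\<dots> = emeasure L {\<mu> \<in> finite_borel_measures. mult_action (\<lambda>x. exp (b x + \<epsilon>)) \<mu> \<in> evaluation_box F r}"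
      using l bm by (subst leb_simple_multiplier[OF leb F _ fb']) (auto simp: ennreal_mult)
    also have "\<dots> \<le> emeasure L ?S"
      using mult_action_evaluation_box_mono[OF a(1) _ ba(2) _ _ F, of "K + \<epsilon>"] bK bm a(2)
      by (intro emeasure_mono set_L[OF a(1), of K]) (auto simp: abs_le_iff)
    finally show ?thesis using 1 by blast
  qed
  define y where "y = measure L ?S"
  have "emeasure L ?S \<noteq> \<infinity>" using bounds[of 0] by (auto simp: top_unique)
  hence y: "emeasure L ?S = ennreal y" "0 \<le> y" by (auto simp: y_def emeasure_eq_ennreal_measure)
  have "(\<lambda>m. ?E * exp (- \<theta> / real (Suc m)) * l) \<longlonglongrightarrow> ?E * exp (- \<theta> * 0) * l"
    unfolding divide_inverse by (intro tendsto_intros LIMSEQ_inverse_real_of_nat)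
  moreover have "\<forall>m. ?E * exp (- \<theta> / real (Suc m)) * l \<le> y" using bounds y by simp
  ultimately have "?E * l \<le> y" by (auto intro: LIMSEQ_le_const2)
  moreover have "(\<lambda>m. ?E * exp (\<theta> / real (Suc m)) * l) \<longlonglongrightarrow> ?E * exp (\<theta> * 0) * l"
    unfolding divide_inverse by (intro tendsto_intros LIMSEQ_inverse_real_of_nat)
  moreover have "\<forall>m. y \<le> ?E * exp (\<theta> / real (Suc m)) * l" using bounds y l(2) by simp
  ultimately have "y = ?E * l" by (intro antisym) (auto intro: LIMSEQ_le_const)
  thus "emeasure L ?S = ennreal ?E * emeasure L (evaluation_box F r)"
    using y l by (simp add: ennreal_mult)
qed

text \<open>The factor found on evaluation boxes does not depend on the box, so it extends from this
  generating family to all Borel sets.\<close>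

lemma multiplicative_lebesgue_invariant:
  fixes L :: "'a::polish_space measure measure"
  assumes leb: "multiplicative_lebesgue \<theta> \<nu> L" and k: "k \<in> multipliers"
  shows "\<exists>R::real. 0 \<le> R \<and> distr L finite_measures_algebra (mult_action k) = scale_measure (ennreal R) L"
proof -
  note basic = leb_basic[OF leb]
  obtain a K where a: "k = (\<lambda>x. exp (a x))" "a \<in> borel_measurable borel" "\<And>x. \<bar>a x\<bar> \<le> K"
    using multipliersE[OF k] by blast
  let ?R = "exp (- (\<theta> * (LINT x|\<nu>. a x)))"
  have m: "mult_action k \<in> measurable L finite_measures_algebra"
    unfolding leb_measurable_cong[OF leb] by (rule mult_action_multiplier_measurable[OF k])
  have "distr L finite_measures_algebra (mult_action k) = scale_measure (ennreal ?R) L"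
  proof (rule finite_measures_algebra_eqI)
    have eq: "emeasure (distr L finite_measures_algebra (mult_action k)) (evaluation_box F r)
      = emeasure (scale_measure (ennreal ?R) L) (evaluation_box F r)" if F: "borel_constraints F" for F r
    proof -
      have "emeasure (distr L finite_measures_algebra (mult_action k)) (evaluation_box F r)
        = emeasure L (mult_action k -` evaluation_box F r \<inter> space L)"
        by (rule emeasure_distr[OF m evaluation_box_sets[OF F]])
      also have "mult_action k -` evaluation_box F r \<inter> space L
        = {\<mu> \<in> finite_borel_measures. mult_action (\<lambda>x. exp (a x)) \<mu> \<in> evaluation_box F r}"
        by (auto simp: basic a(1))
      finally show ?thesis by (simp add: multiplicative_lebesgue_multiplier(1)[OF leb F a(2,3)])
    qed
    thus "borel_constraints F \<Longrightarrow> emeasure (distr L finite_measures_algebra (mult_action k)) (evaluation_box F r)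
      = emeasure (scale_measure (ennreal ?R) L) (evaluation_box F r)" for F r .
    have e: "borel_constraints ({} :: ('a set \<times> real) set)" by (simp add: borel_constraints_def)
    show "emeasure (distr L finite_measures_algebra (mult_action k)) (evaluation_box {} r) \<noteq> \<infinity>" for r
      using multiplicative_lebesgue_multiplier(2)[OF leb e a(2,3), of r]
      by (simp add: eq[OF e] ennreal_mult_eq_top_iff)
  qed (simp_all add: basic)
  thus ?thesis by (intro exI[of _ ?R]) simp
qed

lemma projectively_invariant_scale_measure:
  assumes "sets Q = sets finite_measures_algebra" "projectively_invariant (Q :: 'a::polish_space measure measure)"
  shows "projectively_invariant (scale_measure c Q)"
  unfolding projectively_invariant_def
proof
  fix k :: "'a \<Rightarrow> real" assume k: "k \<in> multipliers"
  then obtain R :: real where R: "0 \<le> R"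
    "distr Q finite_measures_algebra (mult_action k) = scale_measure (ennreal R) Q"
    using assms(2) unfolding projectively_invariant_def by blast
  have "mult_action k \<in> measurable Q finite_measures_algebra"
    unfolding measurable_cong_sets[OF assms(1) refl] by (rule mult_action_multiplier_measurable[OF k])
  hence "distr (scale_measure c Q) finite_measures_algebra (mult_action k) = scale_measure (ennreal R) (scale_measure c Q)"
    by (simp add: distr_scale_measure R(2) mult.commute)
  thus "\<exists>R::real. 0 \<le> R \<and> distr (scale_measure c Q) finite_measures_algebra (mult_action k)
      = scale_measure (ennreal R) (scale_measure c Q)"
    using R(1) by blast
qed

section \<open>The characterisation\<close>

theorem proposition5:
  fixes Q :: "'a::polish_space measure measure"
  shows
    "(sets Q = sets finite_measures_algebra \<and>
      emeasure Q (mass_ball 0) = 0 \<and>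
      emeasure Q (mass_ball 1) = 1 \<and>
      projectively_invariant Q)
     \<longleftrightarrow>
     (let Q' = scale_measure (inverse (laplace_mass Q)) Q;
          \<theta> = (LINT \<mu>|Q'. measure \<mu> UNIV * exp (- measure \<mu> UNIV));
          \<nu> = scale_measure (ennreal (1 / \<theta>)) (tilted_intensity Q')
      in \<exists>L. multiplicative_lebesgue \<theta> \<nu> L \<and> Q = scale_measure (ennreal (Gamma (\<theta> + 1))) L)"
    (is "?i \<longleftrightarrow> ?ii")
proof
  assume ?i
  hence Q: "sets Q = sets finite_measures_algebra" "emeasure Q (mass_ball 0) = 0"
    "emeasure Q (mass_ball 1) = 1" "projectively_invariant Q" by auto
  obtain \<theta> where \<theta>: "0 < \<theta>"
    and mass: "distr Q borel (\<lambda>\<mu>. measure \<mu> UNIV) = scale_measure (ennreal (Gamma (\<theta> + 1))) (power_law \<theta>)"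
    using invariant_mass_law[OF Q] by blast
  have G: "0 < Gamma (\<theta> + 1)" using \<theta> by (intro Gamma_real_pos) simp
  have m: "(\<lambda>\<mu>. measure \<mu> UNIV) \<in> borel_measurable Q"
    unfolding measurable_cong_sets[OF Q(1) refl] by (rule mass_measurable)
  have "laplace_mass Q = (\<integral>\<^sup>+t. ennreal (exp (- t)) \<partial>distr Q borel (\<lambda>\<mu>. measure \<mu> UNIV))"
    unfolding laplace_mass_def by (intro nn_integral_distr[OF m, symmetric]) measurable
  also have "\<dots> = ennreal (Gamma (\<theta> + 1)) * (\<integral>\<^sup>+t. ennreal (exp (- t)) \<partial>power_law \<theta>)"
    unfolding mass by (intro nn_integral_scale_measure) measurable
  also have "\<dots> = ennreal (Gamma (\<theta> + 1))" using \<theta> by (simp add: nn_integral_exp_power_law)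
  finally have lap: "laplace_mass Q = ennreal (Gamma (\<theta> + 1))" .
  \<comment> \<open>By the mass law the Laplace mass is \<open>Gamma (\<theta> + 1)\<close>.
    Dividing by it therefore yields L and shows at once which multiple of L the measure Q
    is.\<close>
  define L where "L = scale_measure (inverse (laplace_mass Q)) Q"
  have inv: "ennreal (Gamma (\<theta> + 1)) * inverse (laplace_mass Q) = 1"
    using G by (simp add: lap inverse_ennreal flip: ennreal_mult)
  have QL: "Q = scale_measure (ennreal (Gamma (\<theta> + 1))) L"
    by (rule measure_eqI) (simp_all add: L_def mult.assoc[symmetric] inv)
  interpret normalized_invariant_measure L \<theta>
  proof
    show "sets L = sets finite_measures_algebra" by (simp add: L_def Q(1))
    show "projectively_invariant L" unfolding L_def by (rule projectively_invariant_scale_measure[OF Q(1,4)])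
    show "0 < \<theta>" by (rule \<theta>)
    have "inverse (laplace_mass Q) * ennreal (Gamma (\<theta> + 1)) = 1" using inv by (simp add: mult.commute)
    thus "distr L borel (\<lambda>\<mu>. measure \<mu> UNIV) = power_law \<theta>"
      unfolding L_def distr_scale_measure[OF m] mass by (intro measure_eqI) (simp_all add: mult.assoc[symmetric])
  qed
  show ?ii
    unfolding Let_def L_def[symmetric] integral_mass
    using multiplicative_lebesgue_intensity QL by (intro exI[of _ L]) (simp add: intensity_def)
next
  assume ?ii
  then obtain \<theta> \<nu> L where leb: "multiplicative_lebesgue \<theta> \<nu> L" and Q: "Q = scale_measure (ennreal (Gamma (\<theta> + 1))) L"
    by (auto simp: Let_def)
  note basic = leb_basic[OF leb]
  have G: "0 < Gamma (\<theta> + 1)" using basic(1) by (intro Gamma_real_pos) simp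
  \<comment> \<open>Both mass conditions can be read off here: the power law has no mass at or below
    0, and the ray up to 1 has mass \<open>1 / Gamma (\<theta> + 1)\<close>, which the factor
    cancels.\<close>
  have mass: "emeasure Q (mass_ball r) = ennreal (Gamma (\<theta> + 1)) * emeasure (power_law \<theta>) {..r}" for r
    using leb_mass[OF leb, of "{..r}"] by (simp add: Q mass_ball_def)
  show ?i
  proof (intro conjI)
    show sets: "sets Q = sets finite_measures_algebra" by (simp add: Q basic)
    have "emeasure (power_law \<theta>) {..0} = emeasure (power_law \<theta>) {}"
      using AE_power_law_pos[OF basic(1)] by (intro emeasure_eq_AE) auto
    thus "emeasure Q (mass_ball 0) = 0" by (simp add: mass)
    show "emeasure Q (mass_ball 1) = 1"
      using basic(1) G less_imp_neq[OF G] by (simp add: mass emeasure_power_law_atMost flip: ennreal_mult)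
    have "projectively_invariant L"
      unfolding projectively_invariant_def using multiplicative_lebesgue_invariant[OF leb] by blast
    thus "projectively_invariant Q"
      unfolding Q by (rule projectively_invariant_scale_measure[OF basic(3)])
  qed
qed

end
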